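(* Let $A\in M_2(\mathbb C)^{\otimes n}$ be a quantum Boolean function. Given oracle access to $A$, with probability $1-\delta$, one can learn $A$ to precision $\epsilon$ in $L^2$ using $\operatorname{poly}\big(n,4^k,\log(\tfrac1\delta)\big)$ queries to $A$, where $$k\le k(\epsilon)\equiv\begin{cases}\operatorname{Inf}^1(A)^2\,\exp\!\Big(\frac{48\operatorname{Inf}^2(A)}{\epsilon^2}\log\frac{2\operatorname{Inf}^2(A)}{\epsilon}\Big)&\text{if }\operatorname{Inf}^2(A)\ge1,\\[2mm] \frac{\operatorname{Inf}^1(A)^2}{\operatorname{Inf}^2(A)}\,\exp\!\Big(\frac{48\operatorname{Inf}^2(A)}{\epsilon^2}\log\frac{2\sqrt{\operatorname{Inf}^2(A)}}{\epsilon}\Big)&\text{otherwise.}\end{cases}$$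
   Context: $M_2(\mathbb{C})^{\otimes n}\cong M_{2^n}(\mathbb{C})$ is the algebra of operators on $n$ qubits, with trace $\operatorname{tr}$ and identity $\mathbf 1$. $A$ is a quantum Boolean function if $A=A^*$ and $A^2=\mathbf 1$ (so $A$ is a unitary). Normalized Schatten norm: $\|A\|_p=(2^{-n}\operatorname{tr}|A|^p)^{1/p}$. For $1\le j\le n$, $d_j=\mathbb I^{\otimes(j-1)}\otimes(\mathbb I-\tfrac12\operatorname{tr}(\cdot)\mathbf 1)\otimes\mathbb I^{\otimes(n-j)}$ ($\mathbb I$ the identity map on $M_2(\mathbb C)$), and $\operatorname{Inf}^p(A)=\sum_{j=1}^n\|d_jA\|_p^p$. Oracle access to $A$ means that the unknown unitary $A$ on $n$ qubits can be applied as a black box, each application being a query. Learning $A$ to precision $\epsilon$ in $L^2$ means producing an operator $\tilde A$ (given by its coefficients in the basis of $n$-fold tensor products of Pauli matrices) with $\|A-\tilde A\|_2\le\epsilon$.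
   Formalization: A query may apply A conditioned on a control qubit, since A and −A cannot be told apart by plain applications; the learner is given an upper bound for k as input; where Inf²(A)=0, so that the formula for k(ε) reads 0/0, k(ε) is taken to be 0. *)

theory Defs
  imports
    Complex_Main
    "HOL-Computational_Algebra.Polynomial"
    "Jordan_Normal_Form.Matrix"
    "Jordan_Normal_Form.Conjugate"
    "Jordan_Normal_Form.Schur_Decomposition"
begin

section \<open>Operators on qubits\<close>

text \<open>
  Operators on \<open>n\<close> qubits are \<open>2^n \<times> 2^n\<close> complex matrices.  The tensor factors are ordered
  with the first qubit most significant, i.e. the basis vector labelled by the bits
  \<open>b_1, \<dots>, b_n\<close> has index \<open>\<Sum>j. b_j * 2^(n - j)\<close>.
\<close>

definition mtrace :: "complex mat \<Rightarrow> complex" where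
  "mtrace A = (\<Sum>i<dim_row A. A $$ (i, i))"

definition kron :: "complex mat \<Rightarrow> complex mat \<Rightarrow> complex mat" where
  "kron A B = mat (dim_row A * dim_row B) (dim_col A * dim_col B)
     (\<lambda>(i, j). A $$ (i div dim_row B, j div dim_col B) * B $$ (i mod dim_row B, j mod dim_col B))"

definition quantum_boolean :: "nat \<Rightarrow> complex mat \<Rightarrow> bool" where
  "quantum_boolean n A \<longleftrightarrow>
     A \<in> carrier_mat (2 ^ n) (2 ^ n) \<and> mat_adjoint A = A \<and> A * A = 1\<^sub>m (2 ^ n)"

definition psd :: "complex mat \<Rightarrow> bool" where
  "psd B \<longleftrightarrow> dim_row B = dim_col B \<and> (\<forall>v \<in> carrier_vec (dim_row B). 0 \<le> (B *\<^sub>v v) \<bullet>c v)"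

definition abs_mat :: "complex mat \<Rightarrow> complex mat" where
  "abs_mat A = (THE B. B \<in> carrier_mat (dim_col A) (dim_col A) \<and> psd B \<and> B * B = mat_adjoint A * A)"

text \<open>
  Only the exponents 1 and 2 are needed, so the exponent is a natural number and the power of
  the absolute value is the ordinary matrix power.
\<close>

definition schatten_norm :: "nat \<Rightarrow> nat \<Rightarrow> complex mat \<Rightarrow> real" where
  "schatten_norm n p A = root p (Re (mtrace (abs_mat A ^\<^sub>m p)) / 2 ^ n)"


section \<open>Derivatives and influences\<close>

text \<open>
  The position in \<open>{0..<2^n}\<close> with bit \<open>b\<close> at qubit \<open>j\<close>, and the bits of \<open>i\<close> elsewhere;
  and the bit of \<open>i\<close> at qubit \<open>j\<close>.
\<close>

definition set_qubit :: "nat \<Rightarrow> nat \<Rightarrow> nat \<Rightarrow> nat \<Rightarrow> nat" where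
  "set_qubit n j i b = (i div 2 ^ (n - j + 1)) * 2 ^ (n - j + 1) + b * 2 ^ (n - j) + i mod 2 ^ (n - j)"

definition get_qubit :: "nat \<Rightarrow> nat \<Rightarrow> nat \<Rightarrow> nat" where
  "get_qubit n j i = i div 2 ^ (n - j) mod 2"

text \<open>
  The map \<open>id \<otimes> T \<otimes> id\<close> with the linear map \<open>T\<close> on \<open>2 \<times> 2\<close> matrices in position \<open>j\<close>
  (\<open>1 \<le> j \<le> n\<close>): \<open>T\<close> is applied to each of the \<open>2 \<times> 2\<close> blocks of \<open>A\<close> obtained by fixing
  the row and column bits of all qubits other than \<open>j\<close>.  See \<open>on_qubit_kron\<close> below.
\<close>

definition on_qubit ::
  "nat \<Rightarrow> nat \<Rightarrow> (complex mat \<Rightarrow> complex mat) \<Rightarrow> complex mat \<Rightarrow> complex mat" where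
  "on_qubit n j T A = mat (2 ^ n) (2 ^ n)
     (\<lambda>(i, i'). T (mat 2 2 (\<lambda>(b, b'). A $$ (set_qubit n j i b, set_qubit n j i' b')))
                $$ (get_qubit n j i, get_qubit n j i'))"

definition deriv_qubit :: "nat \<Rightarrow> nat \<Rightarrow> complex mat \<Rightarrow> complex mat" where
  "deriv_qubit n j = on_qubit n j (\<lambda>X. X - (mtrace X / 2) \<cdot>\<^sub>m 1\<^sub>m 2)"

definition influence :: "nat \<Rightarrow> nat \<Rightarrow> complex mat \<Rightarrow> real" where
  "influence n p A = (\<Sum>j = 1..n. schatten_norm n p (deriv_qubit n j A) ^ p)"

text \<open>
  If the second influence vanishes then \<open>A = \<plusminus> 1\<close> and the second formula is \<open>0 / 0\<close>; the
  conventions for division and logarithm at 0 give the value 0, as appropriate for a constant.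
\<close>

definition k_bound :: "nat \<Rightarrow> real \<Rightarrow> complex mat \<Rightarrow> real" where
  "k_bound n \<epsilon> A = (let I1 = influence n 1 A; I2 = influence n 2 A in
     if I2 \<ge> 1 then I1\<^sup>2 * exp (48 * I2 / \<epsilon>\<^sup>2 * ln (2 * I2 / \<epsilon>))
     else I1\<^sup>2 / I2 * exp (48 * I2 / \<epsilon>\<^sup>2 * ln (2 * sqrt I2 / \<epsilon>)))"


section \<open>Pauli expansions\<close>

datatype pauli = PI | PX | PY | PZ

fun pauli_mat :: "pauli \<Rightarrow> complex mat" where
  "pauli_mat PI = mat_of_rows_list 2 [[1, 0], [0, 1]]"
| "pauli_mat PX = mat_of_rows_list 2 [[0, 1], [1, 0]]"
| "pauli_mat PY = mat_of_rows_list 2 [[0, - \<i>], [\<i>, 0]]"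
| "pauli_mat PZ = mat_of_rows_list 2 [[1, 0], [0, - 1]]"

fun pauli_tensor :: "pauli list \<Rightarrow> complex mat" where
  "pauli_tensor [] = 1\<^sub>m 1"
| "pauli_tensor (s # ss) = kron (pauli_mat s) (pauli_tensor ss)"

definition pauli_comb :: "nat \<Rightarrow> (pauli list \<Rightarrow> complex) \<Rightarrow> complex mat" where
  "pauli_comb n c = mat (2 ^ n) (2 ^ n) (\<lambda>(i, j). \<Sum>s | length s = n. c s * pauli_tensor s $$ (i, j))"


section \<open>Quantum query algorithms\<close>

text \<open>
  A query algorithm for an unknown \<open>n\<close>-qubit unitary acts on
  \<open>\<complex>^w \<otimes> \<complex>^2 \<otimes> (\<complex>^2)^n\<close>: a work register of dimension \<open>w\<close>, a control qubit and an
  \<open>n\<close>-qubit query register.  Starting from the first basis vector it applies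
  \<open>gate 0, query, gate 1, query, \<dots>, query, gate T\<close>, where \<open>T\<close> is the number of queries, measures
  the whole space in the standard basis, and on measurement result \<open>i\<close> announces the Pauli
  coefficients \<open>announce i\<close>.  By deferred measurement this covers adaptive intermediate
  measurements and classical randomness.

  A query applies the black box to the query register conditioned on the control qubit.  An
  unconditional application is the case where the control qubit is in its second basis state.
  Conditional application is the usual convention, and it cannot be dispensed with here: \<open>A\<close> and
  \<open>- A\<close> act identically up to a global phase, so they are indistinguishable by unconditional
  applications alone, although they are at distance 2.

  The number \<open>k\<close> governing the query budget depends on the influences of the unknown operator, so
  a learner receives an upper bound for it as a parameter and one considers families
  \<open>alg k\<close>.  Such a family has to succeed on \<open>A\<close> for every parameter above the \<open>k\<close> belonging to
  \<open>A\<close>; requiring success for a single parameter would let it encode advice about \<open>A\<close>.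
\<close>

record query_alg =
  work_dim :: nat
  num_queries :: nat
  gate :: "nat \<Rightarrow> complex mat"
  announce :: "nat \<Rightarrow> pauli list \<Rightarrow> complex"

definition unitary_mat :: "nat \<Rightarrow> complex mat \<Rightarrow> bool" where
  "unitary_mat d U \<longleftrightarrow> U \<in> carrier_mat d d \<and> mat_adjoint U * U = 1\<^sub>m d"

definition total_dim :: "nat \<Rightarrow> query_alg \<Rightarrow> nat" where
  "total_dim n alg = work_dim alg * (2 * 2 ^ n)"

definition valid_alg :: "nat \<Rightarrow> query_alg \<Rightarrow> bool" where
  "valid_alg n alg \<longleftrightarrow> work_dim alg > 0 \<and>
     (\<forall>t \<le> num_queries alg. unitary_mat (total_dim n alg) (gate alg t))"

definition controlled :: "nat \<Rightarrow> complex mat \<Rightarrow> complex mat" where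
  "controlled n A = four_block_mat (1\<^sub>m (2 ^ n)) (0\<^sub>m (2 ^ n) (2 ^ n)) (0\<^sub>m (2 ^ n) (2 ^ n)) A"

definition query :: "nat \<Rightarrow> query_alg \<Rightarrow> complex mat \<Rightarrow> complex mat" where
  "query n alg A = kron (1\<^sub>m (work_dim alg)) (controlled n A)"

primrec run_alg :: "nat \<Rightarrow> query_alg \<Rightarrow> complex mat \<Rightarrow> nat \<Rightarrow> complex vec" where
  "run_alg n alg A 0 = gate alg 0 *\<^sub>v unit_vec (total_dim n alg) 0"
| "run_alg n alg A (Suc t) = gate alg (Suc t) *\<^sub>v (query n alg A *\<^sub>v run_alg n alg A t)"

definition success_prob :: "nat \<Rightarrow> real \<Rightarrow> query_alg \<Rightarrow> complex mat \<Rightarrow> real" where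
  "success_prob n \<epsilon> alg A =
     (\<Sum>i | i < total_dim n alg \<and> schatten_norm n 2 (A - pauli_comb n (announce alg i)) \<le> \<epsilon>.
        (cmod (run_alg n alg A (num_queries alg) $ i))\<^sup>2)"


section \<open>Polynomials in three variables\<close>

definition poly3 :: "real poly poly poly \<Rightarrow> real \<Rightarrow> real \<Rightarrow> real \<Rightarrow> real" where
  "poly3 P x y z = poly (poly (poly P [:[:x:]:]) [:y:]) z"


section \<open>Consistency of the tensor conventions\<close>

lemma on_qubit_kron:
  assumes X: "X \<in> carrier_mat (2 ^ (j - 1)) (2 ^ (j - 1))"
    and Y: "Y \<in> carrier_mat 2 2"
    and Z: "Z \<in> carrier_mat (2 ^ (n - j)) (2 ^ (n - j))"
    and TY: "T Y \<in> carrier_mat 2 2"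
    and hom: "\<And>c M. M \<in> carrier_mat 2 2 \<Longrightarrow> T (c \<cdot>\<^sub>m M) = c \<cdot>\<^sub>m T M"
    and j: "1 \<le> j" "j \<le> n"
  shows "on_qubit n j T (kron X (kron Y Z)) = kron X (kron (T Y) Z)"
proof -
  define c where "c = (2::nat) ^ (n - j)"
  define a where "a = (2::nat) ^ (j - 1)"
  have c0: "c > 0" by (simp add: c_def)
  have pn: "2 ^ n = a * (2 * c)"
  proof -
    have "n = (j - 1) + Suc (n - j)" using j by simp
    then have "(2::nat) ^ n = 2 ^ (j - 1) * 2 ^ Suc (n - j)" by (metis power_add)
    then show ?thesis by (simp add: a_def c_def)
  qed
  have pc: "2 ^ (n - j + 1) = 2 * c" by (simp add: c_def)
  have dims: "dim_row X = a" "dim_col X = a" "dim_row Y = 2" "dim_col Y = 2"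
    "dim_row Z = c" "dim_col Z = c" "dim_row (T Y) = 2" "dim_col (T Y) = 2"
    using X Y Z TY by (auto simp: a_def c_def)
  have sq: "set_qubit n j i b div (2 * c) = i div (2 * c)"
    "set_qubit n j i b mod (2 * c) div c = b"
    "set_qubit n j i b mod (2 * c) mod c = i mod c"
    "set_qubit n j i b < a * (2 * c)"
    if i: "i < a * (2 * c)" and b: "b < 2" for i b
  proof -
    have low: "b * c + i mod c < 2 * c"
    proof -
      have "b * c \<le> 1 * c" using b by (intro mult_right_mono) auto
      moreover have "i mod c < c" using c0 by simp
      ultimately show ?thesis by linarith
    qed
    have e: "set_qubit n j i b = (b * c + i mod c) + (i div (2 * c)) * (2 * c)"
      unfolding set_qubit_def pc by (simp add: c_def)
    show 1: "set_qubit n j i b div (2 * c) = i div (2 * c)"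
      unfolding e using low c0 by (subst div_mult_self1) auto
    have 2: "set_qubit n j i b mod (2 * c) = b * c + i mod c"
      unfolding e using low by (subst mod_mult_self1) auto
    show "set_qubit n j i b mod (2 * c) div c = b" unfolding 2 using c0 by simp
    show "set_qubit n j i b mod (2 * c) mod c = i mod c" unfolding 2 by simp
    have "i div (2 * c) < a" using i c0 by (simp add: less_mult_imp_div_less)
    then show "set_qubit n j i b < a * (2 * c)"
      using 1 c0 by (metis div_less_iff_less_mult mult_pos_pos pos2)
  qed
  have gq: "get_qubit n j i = i mod (2 * c) div c" "i mod (2 * c) mod c = i mod c" for i
  proof -
    have "i mod (2 * c) = c * (i div c mod 2) + i mod c" by (metis mod_mult2_eq mult.commute)
    then show "get_qubit n j i = i mod (2 * c) div c" "i mod (2 * c) mod c = i mod c"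
      using c0 by (auto simp: get_qubit_def c_def)
  qed
  show ?thesis
  proof (rule eq_matI)
    fix i i' assume "i < dim_row (kron X (kron (T Y) Z))" "i' < dim_col (kron X (kron (T Y) Z))"
    then have i: "i < a * (2 * c)" and i': "i' < a * (2 * c)" by (auto simp: kron_def dims)
    let ?s = "X $$ (i div (2 * c), i' div (2 * c)) * Z $$ (i mod c, i' mod c)"
    have blk: "mat 2 2 (\<lambda>(b, b'). kron X (kron Y Z) $$ (set_qubit n j i b, set_qubit n j i' b')) = ?s \<cdot>\<^sub>m Y"
    proof (rule eq_matI)
      fix b b' assume "b < dim_row (?s \<cdot>\<^sub>m Y)" "b' < dim_col (?s \<cdot>\<^sub>m Y)"
      then have b: "b < 2" "b' < 2" by (auto simp: dims)
      show "mat 2 2 (\<lambda>(b, b'). kron X (kron Y Z) $$ (set_qubit n j i b, set_qubit n j i' b')) $$ (b, b')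
        = (?s \<cdot>\<^sub>m Y) $$ (b, b')"
        using b c0 by (simp add: kron_def dims sq[OF i b(1)] sq[OF i' b(2)])
    qed (auto simp: dims)
    have g: "get_qubit n j i < 2" "get_qubit n j i' < 2" by (auto simp: get_qubit_def)
    have m: "i mod (2 * c) < 2 * c" "i' mod (2 * c) < 2 * c" using c0 by auto
    have "on_qubit n j T (kron X (kron Y Z)) $$ (i, i')
        = (?s \<cdot>\<^sub>m T Y) $$ (get_qubit n j i, get_qubit n j i')"
      unfolding on_qubit_def pn using i i' by (simp add: blk hom[OF Y])
    also have "\<dots> = ?s * T Y $$ (get_qubit n j i, get_qubit n j i')"
      using g by (simp add: dims)
    also have "\<dots> = kron X (kron (T Y) Z) $$ (i, i')"
      using i i' m by (simp add: kron_def dims gq)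
    finally show "on_qubit n j T (kron X (kron Y Z)) $$ (i, i') = kron X (kron (T Y) Z) $$ (i, i')" .
  qed (auto simp: on_qubit_def kron_def dims pn)
qed

end

theory Submission
  imports Defs "HOL-Analysis.L2_Norm" "Jordan_Normal_Form.Spectral_Radius"
begin

text \<open>Write \<open>A\<close> as a real combination of Pauli strings whose squared coefficients sum to one. Qubit
  hypercontractivity and duality, applied to the derivatives of \<open>A\<close> as in Friedgut's theorem, show that
  all but \<open>\<epsilon>\<^sup>2 / 4\<close> of the squared coefficients lie on the Pauli strings supported on at most a constant times \<open>k(\<epsilon>)\<close>
  qubits (unless \<open>A\<close> is almost constant), hence on a set of size \<open>4\<close> to the power of a multiple of \<open>k(\<epsilon>)\<close>.

  Half of a maximally entangled state, sent through \<open>A\<close> under a control qubit and measured in the Bell basis,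
  yields a Pauli string with probability proportional to its squared coefficient. Fixing a sampled string,
  interference of its coefficient with the branch of the idle control qubit estimates the signed coefficient.
  A string of large coefficient is sampled with high probability, and the coefficients never sampled are
  small; so the error is controlled by the size of the concentration set and by \<open>1 / \<epsilon>\<close>.

  The query bound may not depend on \<open>\<epsilon>\<close> except through \<open>k\<close>. An edge isoperimetric inequality shows that
  \<open>k(\<epsilon>)\<close> is at least a multiple of \<open>ln (1 / \<epsilon>)\<close> unless \<open>A\<close> is \<open>\<epsilon>\<close>-close to \<open>1\<close> or \<open>-1\<close>; so if \<open>k\<close> is smaller
  than that, it suffices to announce the sign of the identity coefficient.\<close>

text \<open>Only the fourth norm is treated by hypercontractivity, since it comes from the
  Hilbert-Schmidt norm of a product; its dual, the 4/3-norm, is replaced by a product of trace norm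
  and Hilbert-Schmidt norm, which is how the first influence enters. The resulting constant
  \<open>5 ^ d\<close> is crude, but the exponent 48 leaves room: with x = Inf^2 / eps^2 and degree
  about 8 x, the junta bound is exponential in x with a fixed rate, while k(eps) is at least
  (Inf^1)^2 / Inf^2 times exp (24 x ln (4 x)), which exceeds any such rate up to a constant factor.

  Two obstacles shape the learner. It knows only an upper bound for k, so the algorithm of index k
  must serve at once all A with k(eps) < k + 1; it may use the size of the concentration set but not
  the set. And measurement comes last, so all Bell states are prepared first, and the choice of
  interference by the sampled string is a block-diagonal unitary controlled by that string.\<close>

section \<open>Hilbert-Schmidt norms of operator kernels\<close>

type_synonym kernel = "nat \<Rightarrow> nat \<Rightarrow> complex"

definition kmult :: "nat \<Rightarrow> kernel \<Rightarrow> kernel \<Rightarrow> kernel" where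
  "kmult N f g = (\<lambda>i j. \<Sum>k<N. f i k * g k j)"

definition kadj :: "kernel \<Rightarrow> kernel" where
  "kadj f = (\<lambda>i j. cnj (f j i))"

text \<open>Unnormalised: for \<open>n\<close> qubits this is \<open>sqrt (2 ^ n)\<close> times the
  normalised 2-norm, see \<open>schatten_2\<close>.\<close>

definition hs_norm :: "nat \<Rightarrow> kernel \<Rightarrow> real" where
  "hs_norm N f = L2_set (\<lambda>(i, j). cmod (f i j)) ({..<N} \<times> {..<N})"

lemma hs_norm_sq: "(hs_norm N f)\<^sup>2 = (\<Sum>i<N. \<Sum>j<N. (cmod (f i j))\<^sup>2)"
  unfolding hs_norm_def L2_set_def
  by (subst real_sqrt_pow2) (auto intro!: sum_nonneg simp: sum.cartesian_product case_prod_unfold)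

lemma hs_norm_nonneg [simp]: "0 \<le> hs_norm N f"
  by (simp add: hs_norm_def)

lemma hs_norm_cong:
  "(\<And>i j. i < N \<Longrightarrow> j < N \<Longrightarrow> cmod (f i j) = cmod (g i j)) \<Longrightarrow> hs_norm N f = hs_norm N g"
  unfolding hs_norm_def by (rule L2_set_cong) auto

lemma hs_norm_add: "hs_norm N (\<lambda>i j. f i j + g i j) \<le> hs_norm N f + hs_norm N g"
proof -
  have "hs_norm N (\<lambda>i j. f i j + g i j)
      \<le> L2_set (\<lambda>p. (\<lambda>(i, j). cmod (f i j)) p + (\<lambda>(i, j). cmod (g i j)) p) ({..<N} \<times> {..<N})"
    unfolding hs_norm_def by (rule L2_set_mono) (auto intro: norm_triangle_ineq)
  also have "\<dots> \<le> hs_norm N f + hs_norm N g"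
    unfolding hs_norm_def by (rule L2_set_triangle_ineq)
  finally show ?thesis .
qed

lemma hs_norm_kadj: "hs_norm N (kadj f) = hs_norm N f"
proof -
  have "(hs_norm N (kadj f))\<^sup>2 = (hs_norm N f)\<^sup>2"
    unfolding hs_norm_sq kadj_def by (subst sum.swap) simp
  then show ?thesis by (simp add: power2_eq_iff_nonneg)
qed

lemma hs_norm_cauchy_schwarz:
  "cmod (\<Sum>i<N. \<Sum>j<N. f i j * g i j) \<le> hs_norm N f * hs_norm N g"
proof -
  have "cmod (\<Sum>i<N. \<Sum>j<N. f i j * g i j)
      = cmod (\<Sum>p\<in>{..<N} \<times> {..<N}. f (fst p) (snd p) * g (fst p) (snd p))"
    by (simp add: sum.cartesian_product case_prod_unfold)
  also have "\<dots> \<le> (\<Sum>p\<in>{..<N} \<times> {..<N}. cmod (f (fst p) (snd p)) * cmod (g (fst p) (snd p)))"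
    by (rule order_trans[OF norm_sum]) (simp add: norm_mult)
  also have "\<dots> \<le> hs_norm N f * hs_norm N g"
    unfolding hs_norm_def
    using L2_set_mult_ineq[of "\<lambda>(i,j). cmod (f i j)" "\<lambda>(i,j). cmod (g i j)" "{..<N} \<times> {..<N}"]
    by (simp add: case_prod_unfold)
  finally show ?thesis .
qed

text \<open>Cyclicity of the trace brings the two factors \<open>f\<close> together, and likewise
  the two factors \<open>g\<close>.\<close>

lemma hs_norm_adj_mult_sq:
  "complex_of_real ((hs_norm N (kmult N (kadj f) g))\<^sup>2)
     = (\<Sum>k<N. \<Sum>l<N. kmult N f (kadj f) l k * kmult N g (kadj g) k l)"
proof -
  have "complex_of_real ((hs_norm N (kmult N (kadj f) g))\<^sup>2)
      = (\<Sum>i<N. \<Sum>j<N. (\<Sum>k<N. cnj (f k i) * g k j) * (\<Sum>l<N. f l i * cnj (g l j)))"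
    unfolding hs_norm_sq kmult_def kadj_def of_real_sum complex_norm_square by simp
  also have "\<dots> = (\<Sum>i<N. \<Sum>j<N. \<Sum>k<N. \<Sum>l<N. (cnj (f k i) * g k j) * (f l i * cnj (g l j)))"
    by (simp add: sum_product)
  also have "\<dots> = (\<Sum>i<N. \<Sum>k<N. \<Sum>j<N. \<Sum>l<N. (cnj (f k i) * g k j) * (f l i * cnj (g l j)))"
    by (rule sum.cong[OF refl]) (rule sum.swap)
  also have "\<dots> = (\<Sum>i<N. \<Sum>k<N. \<Sum>l<N. \<Sum>j<N. (cnj (f k i) * g k j) * (f l i * cnj (g l j)))"
    by (rule sum.cong[OF refl], rule sum.cong[OF refl], rule sum.swap)
  also have "\<dots> = (\<Sum>k<N. \<Sum>i<N. \<Sum>l<N. \<Sum>j<N. (cnj (f k i) * g k j) * (f l i * cnj (g l j)))"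
    by (rule sum.swap)
  also have "\<dots> = (\<Sum>k<N. \<Sum>l<N. \<Sum>i<N. \<Sum>j<N. (cnj (f k i) * g k j) * (f l i * cnj (g l j)))"
    by (rule sum.cong[OF refl], rule sum.swap)
  also have "\<dots> = (\<Sum>k<N. \<Sum>l<N. kmult N f (kadj f) l k * kmult N g (kadj g) k l)"
    unfolding kmult_def kadj_def sum_product
    by (intro sum.cong[OF refl]) (simp add: mult_ac)
  finally show ?thesis .
qed

lemma kmult_adj_hermitian: "kmult N f (kadj f) l k = cnj (kmult N f (kadj f) k l)"
  unfolding kmult_def kadj_def by (simp add: mult.commute)

text \<open>By \<open>hs_norm_adj_mult_sq\<close> with \<open>g = f\<close>, the square of the left
  side is the trace of the square of the hermitian kernel on the right.\<close>

lemma hs_norm_adj_mult_self: "hs_norm N (kmult N (kadj f) f) = hs_norm N (kmult N f (kadj f))"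
proof -
  have "complex_of_real ((hs_norm N (kmult N (kadj f) f))\<^sup>2)
      = complex_of_real ((hs_norm N (kmult N f (kadj f)))\<^sup>2)"
    unfolding hs_norm_adj_mult_sq
    unfolding hs_norm_sq of_real_sum complex_norm_square
    by (intro sum.cong[OF refl]) (metis kmult_adj_hermitian mult.commute)
  then show ?thesis by (simp add: power2_eq_iff_nonneg del: of_real_power)
qed

text \<open>Noncommutative Hoelder inequality for two 4-norms: Cauchy-Schwarz for the right side of
  \<open>hs_norm_adj_mult_sq\<close>, then \<open>hs_norm_adj_mult_self\<close>.\<close>

lemma hs_norm_adj_mult_le:
  "(hs_norm N (kmult N (kadj f) g))\<^sup>2 \<le> hs_norm N (kmult N (kadj f) f) * hs_norm N (kmult N (kadj g) g)"
proof -
  have "(hs_norm N (kmult N (kadj f) g))\<^sup>2 = cmod (complex_of_real ((hs_norm N (kmult N (kadj f) g))\<^sup>2))"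
    by (simp del: of_real_power)
  also have "\<dots> = cmod (\<Sum>k<N. \<Sum>l<N. kadj (kadj (kmult N f (kadj f))) l k * kmult N g (kadj g) k l)"
    unfolding hs_norm_adj_mult_sq by (simp add: kadj_def)
  also have "\<dots> = cmod (\<Sum>k<N. \<Sum>l<N. cnj (kadj (kmult N f (kadj f)) k l) * kmult N g (kadj g) k l)"
    by (simp add: kadj_def)
  also have "\<dots> \<le> hs_norm N (\<lambda>k l. cnj (kadj (kmult N f (kadj f)) k l)) * hs_norm N (kmult N g (kadj g))"
    by (rule hs_norm_cauchy_schwarz)
  also have "hs_norm N (\<lambda>k l. cnj (kadj (kmult N f (kadj f)) k l)) = hs_norm N (kadj (kmult N f (kadj f)))"
    by (rule hs_norm_cong) simp
  finally show ?thesis by (simp add: hs_norm_kadj hs_norm_adj_mult_self)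
qed

lemma kmult_assoc: "kmult N (kmult N f g) h = kmult N f (kmult N g h)"
  unfolding kmult_def sum_distrib_right sum_distrib_left
  by (intro ext, subst sum.swap) (simp add: mult.assoc)

lemma kadj_kmult: "kadj (kmult N f g) = kmult N (kadj g) (kadj f)"
  unfolding kmult_def kadj_def by (intro ext) (simp add: mult.commute)

lemma kadj_kadj [simp]: "kadj (kadj f) = f"
  by (simp add: kadj_def)

section \<open>Unitary kernels and the spectral theorem\<close>

text \<open>Kernels are total functions whose entries from \<open>N\<close> on are meaningless, so
  operators are compared up to this relation. In exchange there are no carrier conditions, and
  blocks are mere index shifts.\<close>

definition keq :: "nat \<Rightarrow> kernel \<Rightarrow> kernel \<Rightarrow> bool" where
  "keq N f g \<longleftrightarrow> (\<forall>i<N. \<forall>j<N. f i j = g i j)"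

definition kid :: kernel where
  "kid = (\<lambda>i j. if i = j then 1 else 0)"

definition kunitary :: "nat \<Rightarrow> kernel \<Rightarrow> bool" where
  "kunitary N u \<longleftrightarrow> keq N (kmult N (kadj u) u) kid"

lemma kmult_kid: "j < N \<Longrightarrow> kmult N f kid i j = f i j" "i < N \<Longrightarrow> kmult N kid f i j = f i j"
  by (auto simp: kmult_def kid_def if_distrib[of "\<lambda>x. _ * x"] if_distrib[of "\<lambda>x. x * _"] cong: if_cong)

lemma sum_kid: "i < N \<Longrightarrow> (\<Sum>k<N. kid k i * f k) = f i"
  by (simp add: kid_def if_distrib[of "\<lambda>x. x * _"] cong: if_cong)

lemma keq_kmult: "keq N f f' \<Longrightarrow> keq N g g' \<Longrightarrow> keq N (kmult N f g) (kmult N f' g')"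
  by (auto simp: keq_def kmult_def intro!: sum.cong)

lemma keq_refl [simp]: "keq N f f" by (simp add: keq_def)
lemma keq_sym: "keq N f g \<Longrightarrow> keq N g f" by (simp add: keq_def)
lemma keq_trans [trans]: "keq N f g \<Longrightarrow> keq N g h \<Longrightarrow> keq N f h" by (simp add: keq_def)
lemma keq_kid: "keq N (kmult N f kid) f" "keq N (kmult N kid f) f"
  by (auto simp: keq_def kmult_kid)

text \<open>In finite dimension a left inverse is a right inverse; the fact is borrowed from
  matrices.\<close>

lemma kunitary_right: assumes "kunitary N u" shows "keq N (kmult N u (kadj u)) kid"
proof -
  let ?U = "mat N N (\<lambda>(i,j). u i j)" and ?V = "mat N N (\<lambda>(i,j). kadj u i j)"
  have e: "mat N N (\<lambda>(i,j). f i j) * mat N N (\<lambda>(i,j). g i j) = mat N N (\<lambda>(i,j). kmult N f g i j)" for f g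
    by (rule eq_matI) (auto simp: scalar_prod_def kmult_def atLeast0LessThan)
  have "?V * ?U = 1\<^sub>m N"
    unfolding e using assms by (intro eq_matI) (auto simp: kunitary_def keq_def kid_def)
  then have "?U * ?V = 1\<^sub>m N"
    using mat_mult_left_right_inverse[of ?V N ?U] by auto
  then have *: "(?U * ?V) $$ (i,j) = 1\<^sub>m N $$ (i,j)" for i j by simp
  show ?thesis unfolding keq_def
  proof (intro allI impI)
    fix i j assume "i < N" "j < N"
    then show "kmult N u (kadj u) i j = kid i j" using *[of i j] unfolding e by (simp add: kid_def)
  qed
qed

lemma kunitary_kmult:
  assumes "kunitary N u" "kunitary N v"
  shows "kunitary N (kmult N u v)"
proof -
  have "keq N (kmult N (kadj (kmult N u v)) (kmult N u v)) (kmult N (kadj v) (kmult N (kmult N (kadj u) u) v))"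
    by (simp add: kadj_kmult kmult_assoc)
  also have "keq N \<dots> (kmult N (kadj v) (kmult N kid v))"
    using assms(1) by (intro keq_kmult) (auto simp: kunitary_def)
  also have "keq N \<dots> (kmult N (kadj v) v)"
    by (intro keq_kmult keq_kid) auto
  also have "keq N \<dots> kid" using assms(2) by (simp add: kunitary_def)
  finally show ?thesis by (simp add: kunitary_def)
qed

text \<open>A Householder reflection, using that the entry \<open>v 0\<close> is real.\<close>

lemma kunitary_first_column:
  assumes v: "(\<Sum>i<N. (cmod (v i))\<^sup>2) = 1" and r: "Im (v 0) = 0" and N: "0 < N"
  obtains u where "kunitary N u" "\<And>i. i < N \<Longrightarrow> u i 0 = v i"
proof -
  \<comment> \<open>\<open>w\<close> points from the first basis vector to \<open>v\<close>. As
    \<open>v 0\<close> is real, its squared length \<open>S\<close> is \<open>2 - 2 * v 0\<close>,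
    and the reflection along \<open>w\<close> exchanges the two vectors; \<open>S = 0\<close> means
    that \<open>v\<close> is the first basis vector itself.\<close>
  define w where "w = (\<lambda>i. v i - kid i 0)"
  define S where "S = (\<Sum>k<N. cnj (w k) * w k)"
  have S: "S = 2 - 2 * v 0"
  proof -
    have rv: "cnj (v 0) = v 0" using r by (simp add: complex_eq_iff)
    have "S = (\<Sum>k<N. cnj (v k) * v k) - (\<Sum>k<N. cnj (v k) * kid k 0) - (\<Sum>k<N. kid k 0 * v k)
        + (\<Sum>k<N. kid k 0 * kid k 0)"
      unfolding S_def w_def sum.distrib[symmetric] sum_subtractf[symmetric]
      by (intro sum.cong refl) (auto simp: kid_def algebra_simps)
    also have "(\<Sum>k<N. cnj (v k) * v k) = complex_of_real (\<Sum>k<N. (cmod (v k))\<^sup>2)"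
      unfolding of_real_sum complex_norm_square by (simp add: mult.commute)
    also have "(\<Sum>k<N. cnj (v k) * kid k 0) = v 0" using N rv
      by (simp add: kid_def if_distrib[of "\<lambda>x. _ * x"] cong: if_cong)
    also have "(\<Sum>k<N. kid k 0 * v k) = v 0" using N
      by (simp add: kid_def if_distrib[of "\<lambda>x. x * _"] cong: if_cong)
    also have "(\<Sum>k<N. kid k 0 * kid k 0) = 1" using N
      by (simp add: kid_def if_distrib[of "\<lambda>x. x * _"] cong: if_cong)
    finally show ?thesis by (simp add: v)
  qed
  show ?thesis
  proof (cases "S = 0")
    case True
    have "complex_of_real (\<Sum>k<N. (cmod (w k))\<^sup>2) = 0"
      using True unfolding S_def of_real_sum complex_norm_square by (simp add: mult.commute)
    then have "(\<Sum>k<N. (cmod (w k))\<^sup>2) = 0" by (simp only: of_real_eq_0_iff)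
    then have "w k = 0" if "k < N" for k using that by (subst (asm) sum_nonneg_eq_0_iff) auto
    then have "kid i 0 = v i" if "i < N" for i using that by (simp add: w_def)
    moreover have "kunitary N kid"
      unfolding kunitary_def using keq_kid(1)[of N "kadj kid"] by (auto simp: keq_def kadj_def kid_def)
    ultimately show ?thesis using that by blast
  next
    case False
    define u where "u = (\<lambda>i j. kid i j - 2 / S * w i * cnj (w j))"
    have cS: "cnj S = S" unfolding S_def by (simp add: mult.commute)
    have "kunitary N u"
      unfolding kunitary_def keq_def
    proof (intro allI impI)
      fix i j assume i: "i < N" and j: "j < N"
      have "kmult N (kadj u) u i j = (\<Sum>k<N. kid k i * kid k j) - (\<Sum>k<N. kid k i * (2/S * w k * cnj (w j)))
          - (\<Sum>k<N. kid k j * (2/S * cnj (w k) * w i)) + (\<Sum>k<N. 4/S^2 * w i * cnj (w j) * (cnj (w k) * w k))"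
        unfolding kmult_def kadj_def u_def sum.distrib[symmetric] sum_subtractf[symmetric]
        by (intro sum.cong refl) (auto simp: kid_def algebra_simps cS power2_eq_square)
      also have "(\<Sum>k<N. 4/S^2 * w i * cnj (w j) * (cnj (w k) * w k)) = 4/S^2 * w i * cnj (w j) * S"
        by (simp add: S_def sum_distrib_left)
      also have "(\<Sum>k<N. kid k i * kid k j) = kid i j" using i by (rule sum_kid)
      also have "(\<Sum>k<N. kid k i * (2/S * w k * cnj (w j))) = 2/S * w i * cnj (w j)" using i by (rule sum_kid)
      also have "(\<Sum>k<N. kid k j * (2/S * cnj (w k) * w i)) = 2/S * cnj (w j) * w i" using j by (rule sum_kid)
      finally show "kmult N (kadj u) u i j = kid i j" using False by (simp add: power2_eq_square)
    qed
    moreover have "u i 0 = v i" if "i < N" for i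
    proof -
      have "cnj (w 0) = v 0 - 1" using r by (simp add: w_def kid_def complex_eq_iff)
      then have "u i 0 = kid i 0 + w i * (2 - 2 * v 0) / S" unfolding u_def by (simp only:) (simp add: field_simps diff_divide_distrib)
      also have "\<dots> = kid i 0 + w i" using False S by simp
      finally show ?thesis by (simp add: w_def)
    qed
    ultimately show ?thesis using that by blast
  qed
qed

lemma eigenvector_exists:
  fixes g :: kernel
  assumes "0 < N"
  obtains v l where "(\<Sum>i<N. (cmod (v i))\<^sup>2) = 1" "Im (v 0) = 0"
    "\<And>i. i < N \<Longrightarrow> (\<Sum>j<N. g i j * v j) = l * v i"
proof -
  let ?A = "mat N N (\<lambda>(i,j). g i j)"
  have "spectrum ?A \<noteq> {}" using assms by (intro spectrum_non_empty[of _ N]) auto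
  then obtain l where "eigenvalue ?A l" by (auto simp: spectrum_def)
  then obtain z where z: "z \<in> carrier_vec N" "z \<noteq> 0\<^sub>v N" "?A *\<^sub>v z = l \<cdot>\<^sub>v z"
    unfolding eigenvalue_def eigenvector_def by auto
  have ez: "(\<Sum>j<N. g i j * z $ j) = l * z $ i" if "i < N" for i
  proof -
    have "(?A *\<^sub>v z) $ i = (l \<cdot>\<^sub>v z) $ i" by (simp add: z(3))
    then show ?thesis using that z(1) by (simp add: scalar_prod_def atLeast0LessThan)
  qed
  obtain i0 where i0: "i0 < N" "z $ i0 \<noteq> 0" using z(1,2)
    by (metis carrier_vecD eq_vecI index_zero_vec(1,2))
  define s where "s = sqrt (\<Sum>i<N. (cmod (z $ i))\<^sup>2)"
  have "(\<Sum>i<N. (cmod (z $ i))\<^sup>2) > 0"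
    using i0 by (intro sum_pos2[of _ i0]) auto
  then have s: "s > 0" "s^2 = (\<Sum>i<N. (cmod (z $ i))\<^sup>2)" by (auto simp: s_def)
  \<comment> \<open>This phase makes entry 0 real, as \<open>kunitary_first_column\<close> requires;
    if the entry is 0, any phase will do.\<close>
  define ph where "ph = (if z $ 0 = 0 then 1 else cnj (z $ 0) / cmod (z $ 0))"
  have ph: "cmod ph = 1" "Im (ph * z $ 0) = 0"
    by (auto simp: ph_def norm_divide mult.commute[of "cnj _"] complex_norm_square[symmetric] simp del: of_real_power)
  define v where "v = (\<lambda>i. ph / of_real s * z $ i)"
  show ?thesis
  proof
    have "(\<Sum>i<N. (cmod (v i))\<^sup>2) = (\<Sum>i<N. (cmod (z $ i))\<^sup>2) / s^2"
      unfolding sum_divide_distrib v_def using ph s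
      by (intro sum.cong refl) (simp add: norm_mult norm_divide power_divide)
    moreover have "\<dots> = 1" using s by (metis divide_self_if less_irrefl power_eq_0_iff)
    ultimately show "(\<Sum>i<N. (cmod (v i))\<^sup>2) = 1" by simp
    have "v 0 = ph * z $ 0 / of_real s" by (simp add: v_def)
    then show "Im (v 0) = 0" using ph(2) by simp
    show "(\<Sum>j<N. g i j * v j) = l * v i" if "i < N" for i
    proof -
      have "(\<Sum>j<N. g i j * v j) = ph / of_real s * (\<Sum>j<N. g i j * z $ j)"
        unfolding sum_distrib_left v_def by (intro sum.cong refl) (simp only: mult_ac)
      then show ?thesis unfolding ez[OF that] v_def by (simp only: mult_ac)
    qed
  qed
qed

definition kherm :: "nat \<Rightarrow> kernel \<Rightarrow> bool" where
  "kherm N g \<longleftrightarrow> keq N (kadj g) g"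

definition kdiag :: "(nat \<Rightarrow> real) \<Rightarrow> kernel" where
  "kdiag l = (\<lambda>i j. if i = j then of_real (l i) else 0)"

text \<open>Deflation: complete a unit eigenvector to a unitary and conjugate by it. The first
  column becomes a multiple of the first basis vector, by hermiticity so does the first row, and the
  induction hypothesis diagonalises the remaining block.\<close>

lemma spectral_theorem:
  assumes "kherm N g"
  shows "\<exists>u l. kunitary N u \<and> keq N g (kmult N u (kmult N (kdiag l) (kadj u)))"
  using assms
proof (induction N arbitrary: g)
  case 0
  then show ?case by (auto simp: kunitary_def keq_def)
next
  case (Suc N)
  let ?M = "Suc N"
  obtain v l0 where v: "(\<Sum>i<?M. (cmod (v i))\<^sup>2) = 1" "Im (v 0) = 0"
    and ev: "\<And>i. i < ?M \<Longrightarrow> (\<Sum>j<?M. g i j * v j) = l0 * v i"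
    using eigenvector_exists[of ?M g] by blast
  obtain u0 where u0: "kunitary ?M u0" and u0v: "\<And>i. i < ?M \<Longrightarrow> u0 i 0 = v i"
    using kunitary_first_column[OF v] by blast
  define h where "h = kmult ?M (kadj u0) (kmult ?M g u0)"
  have hh: "keq ?M (kadj h) h"
    unfolding h_def kadj_kmult kadj_kadj kmult_assoc
    using Suc.prems by (intro keq_kmult) (auto simp: kherm_def)
  have h0: "h i 0 = l0 * kid i 0" if i: "i < ?M" for i
  proof -
    have "h i 0 = (\<Sum>k<?M. kadj u0 i k * (\<Sum>j<?M. g k j * v j))"
      unfolding h_def kmult_def by (intro sum.cong refl) (simp add: u0v)
    also have "\<dots> = (\<Sum>k<?M. kadj u0 i k * (l0 * u0 k 0))"
      by (intro sum.cong refl) (simp only: ev u0v lessThan_iff)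
    also have "\<dots> = l0 * kmult ?M (kadj u0) u0 i 0"
      unfolding kmult_def sum_distrib_left by (intro sum.cong refl) simp
    also have "\<dots> = l0 * kid i 0" using u0 i by (simp add: kunitary_def keq_def)
    finally show ?thesis .
  qed
  have l0: "cnj l0 = l0" using hh h0[of 0] by (auto simp: keq_def kadj_def kid_def)
  have h0': "h 0 i = l0 * kid 0 i" if i: "i < ?M" for i
  proof -
    have "h 0 i = cnj (h i 0)" using hh i by (auto simp: keq_def kadj_def)
    then show ?thesis using h0[OF i] l0 by (simp add: kid_def)
  qed
  define h1 where "h1 = (\<lambda>i j. h (Suc i) (Suc j))"
  have "kherm N h1" using hh by (auto simp: kherm_def keq_def kadj_def h1_def)
  then obtain u1 l1 where u1: "kunitary N u1" and e1: "keq N h1 (kmult N u1 (kmult N (kdiag l1) (kadj u1)))"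
    using Suc.IH by blast
  \<comment> \<open>The direct sum of 1 and the unitary that diagonalises the block.\<close>
  define w :: kernel where "w = (\<lambda>i j. case i of 0 \<Rightarrow> kid 0 j | Suc i' \<Rightarrow> (case j of 0 \<Rightarrow> 0 | Suc j' \<Rightarrow> u1 i' j'))"
  define l where "l = (\<lambda>i. case i of 0 \<Rightarrow> Re l0 | Suc i' \<Rightarrow> l1 i')"
  have w: "w 0 0 = 1" "w 0 (Suc j) = 0" "w (Suc i) 0 = 0" "w (Suc i) (Suc j) = u1 i j" for i j
    by (auto simp: w_def kid_def)
  have dl: "kdiag l 0 0 = l0" "kdiag l 0 (Suc j) = 0" "kdiag l (Suc i) 0 = 0" "kdiag l (Suc i) (Suc j) = kdiag l1 i j" for i j
    using l0 by (auto simp: kdiag_def l_def complex_eq_iff)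
  have wu: "kunitary ?M w"
    unfolding kunitary_def keq_def
  proof (intro allI impI)
    fix i j assume ij: "i < ?M" "j < ?M"
    show "kmult ?M (kadj w) w i j = kid i j"
      using u1 ij unfolding kunitary_def keq_def
      by (cases i; cases j) (auto simp: kmult_def kadj_def kid_def w sum.lessThan_Suc_shift simp del: sum.lessThan_Suc)
  qed
  have hw: "keq ?M h (kmult ?M w (kmult ?M (kdiag l) (kadj w)))"
    unfolding keq_def
  proof (intro allI impI)
    fix i j assume ij: "i < ?M" "j < ?M"
    show "h i j = kmult ?M w (kmult ?M (kdiag l) (kadj w)) i j"
    proof (cases "i = 0 \<or> j = 0")
      case True
      then show ?thesis using h0 h0' ij
        by (cases i; cases j) (auto simp: kmult_def kadj_def kid_def w dl sum.lessThan_Suc_shift simp del: sum.lessThan_Suc)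
    next
      case False
      then obtain i' j' where e: "i = Suc i'" "j = Suc j'" by (cases i; cases j) auto
      then have "h i j = kmult N u1 (kmult N (kdiag l1) (kadj u1)) i' j'"
        using e1 ij by (auto simp: keq_def h1_def)
      then show ?thesis unfolding e
        by (simp add: kmult_def kadj_def w dl sum.lessThan_Suc_shift del: sum.lessThan_Suc)
    qed
  qed
  let ?u = "kmult ?M u0 w"
  note u0r = kunitary_right[OF u0]
  have "keq ?M (kmult ?M (kmult ?M u0 (kadj u0)) (kmult ?M g (kmult ?M u0 (kadj u0)))) (kmult ?M kid (kmult ?M g kid))"
    using u0r by (intro keq_kmult) auto
  then have "keq ?M (kmult ?M (kmult ?M u0 (kadj u0)) (kmult ?M g (kmult ?M u0 (kadj u0)))) g"
    using keq_kid keq_trans by blast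
  then have "keq ?M g (kmult ?M u0 (kmult ?M h (kadj u0)))"
    unfolding h_def kmult_assoc by (rule keq_sym)
  also have "keq ?M \<dots> (kmult ?M u0 (kmult ?M (kmult ?M w (kmult ?M (kdiag l) (kadj w))) (kadj u0)))"
    using hw by (intro keq_kmult) auto
  also have "\<dots> = kmult ?M ?u (kmult ?M (kdiag l) (kadj ?u))"
    by (simp add: kadj_kmult kmult_assoc)
  finally show ?case using kunitary_kmult[OF u0 wu] by blast
qed

section \<open>Absolute values and trace norms\<close>

lemma kdiag_mult:
  "i < N \<Longrightarrow> kmult N (kdiag l) f i j = of_real (l i) * f i j"
  "j < N \<Longrightarrow> kmult N f (kdiag l) i j = f i j * of_real (l j)"
  by (auto simp: kmult_def kdiag_def if_distrib[of "\<lambda>x. x * _"] if_distrib[of "\<lambda>x. _ * x"] cong: if_cong)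

lemma kconj_mult:
  assumes "kunitary N u"
  shows "keq N (kmult N (kmult N u (kmult N d (kadj u))) (kmult N u (kmult N e (kadj u))))
    (kmult N u (kmult N (kmult N d e) (kadj u)))"
proof -
  have "keq N (kmult N u (kmult N d (kmult N (kmult N (kadj u) u) (kmult N e (kadj u)))))
      (kmult N u (kmult N d (kmult N kid (kmult N e (kadj u)))))"
    using assms by (intro keq_kmult) (auto simp: kunitary_def)
  also have "keq N \<dots> (kmult N u (kmult N d (kmult N e (kadj u))))"
    by (intro keq_kmult keq_kid) auto
  finally show ?thesis by (simp add: kmult_assoc)
qed

text \<open>In the order of the complex numbers \<open>0 \<le> z\<close> also says that
  \<open>z\<close> is real; hermiticity is drawn from this.\<close>

definition kpsd :: "nat \<Rightarrow> kernel \<Rightarrow> bool" where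
  "kpsd N b \<longleftrightarrow> (\<forall>v. 0 \<le> (\<Sum>i<N. (\<Sum>j<N. b i j * v j) * cnj (v i)))"

lemma kpsd_cong: "keq N b c \<Longrightarrow> kpsd N b \<longleftrightarrow> kpsd N c"
  unfolding kpsd_def keq_def by simp

text \<open>Polarisation: the form is real at \<open>e_p + t e_q\<close>. The choice
  \<open>t = 1\<close> cancels the imaginary parts of the two off-diagonal entries, and
  \<open>t = \<i>\<close> equates their real parts.\<close>

lemma kpsd_herm:
  assumes "kpsd N b"
  shows "kherm N b"
  unfolding kherm_def keq_def
proof (intro allI impI)
  fix p q assume p: "p < N" and q: "q < N"
  have quad: "0 \<le> b p p + (b p q * t + b q p * cnj t) + b q q * (t * cnj t)" for t
  proof -
    let ?v = "\<lambda>i. kid i p + t * kid i q"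
    have "0 \<le> (\<Sum>i<N. (\<Sum>j<N. b i j * ?v j) * cnj (?v i))"
      using assms[unfolded kpsd_def, rule_format, of ?v] .
    also have "(\<Sum>i<N. (\<Sum>j<N. b i j * ?v j) * cnj (?v i))
        = (\<Sum>i<N. (b i p + t * b i q) * cnj (?v i))"
    proof (intro sum.cong refl)
      fix i
      have "(\<Sum>j<N. b i j * ?v j) = (\<Sum>j<N. kid j p * b i j) + t * (\<Sum>j<N. kid j q * b i j)"
        unfolding sum_distrib_left sum.distrib[symmetric] by (intro sum.cong refl) (simp add: algebra_simps)
      then show "(\<Sum>j<N. b i j * ?v j) * cnj (?v i) = (b i p + t * b i q) * cnj (?v i)"
        using p q by (simp add: sum_kid)
    qed
    also have "\<dots> = (\<Sum>i<N. kid i p * (b i p + t * b i q)) + cnj t * (\<Sum>i<N. kid i q * (b i p + t * b i q))"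
      unfolding sum_distrib_left sum.distrib[symmetric]
      by (intro sum.cong refl) (auto simp: kid_def algebra_simps)
    also have "\<dots> = b p p + (b p q * t + b q p * cnj t) + b q q * (t * cnj t)"
      unfolding sum_kid[OF p] sum_kid[OF q] by (simp add: algebra_simps)
    finally show ?thesis .
  qed
  have r: "Im (b p p) = 0" if "p < N" for p
  proof -
    have "0 \<le> (\<Sum>i<N. (\<Sum>j<N. b i j * kid j p) * cnj (kid i p))"
      using assms[unfolded kpsd_def, rule_format, of "\<lambda>i. kid i p"] .
    also have "\<dots> = (\<Sum>i<N. kid i p * (\<Sum>j<N. kid j p * b i j))"
      by (intro sum.cong refl) (auto simp: kid_def mult.commute)
    also have "\<dots> = b p p" using that by (simp add: sum_kid)
    finally show ?thesis by (simp add: less_eq_complex_def)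
  qed
  have "Im (b p q) + Im (b q p) = 0" using quad[of 1] r[OF p] r[OF q] by (simp add: less_eq_complex_def)
  moreover have "Re (b p q) - Re (b q p) = 0" using quad[of \<i>] r[OF p] r[OF q] by (simp add: less_eq_complex_def)
  ultimately show "kadj b p q = b p q" by (simp add: kadj_def complex_eq_iff)
qed

text \<open>The value of the form at column \<open>a\<close> of \<open>u\<close>, a unit
  eigenvector, is the eigenvalue itself.\<close>

lemma kpsd_diag_nonneg:
  assumes "kpsd N b" "kunitary N u" "keq N b (kmult N u (kmult N (kdiag l) (kadj u)))" and a: "a < N"
  shows "0 \<le> l a"
proof -
  have "0 \<le> (\<Sum>i<N. (\<Sum>j<N. b i j * u j a) * cnj (u i a))"
    using assms(1)[unfolded kpsd_def, rule_format, of "\<lambda>i. u i a"] .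
  also have "\<dots> = kmult N (kadj u) (kmult N b u) a a"
    unfolding kmult_def kadj_def by (simp add: mult.commute)
  also have "\<dots> = kmult N (kadj u) (kmult N (kmult N u (kmult N (kdiag l) (kadj u))) u) a a"
  proof -
    have "keq N (kmult N (kadj u) (kmult N b u)) (kmult N (kadj u) (kmult N (kmult N u (kmult N (kdiag l) (kadj u))) u))"
      using assms(3) by (intro keq_kmult) auto
    then show ?thesis using a by (simp add: keq_def)
  qed
  also have "\<dots> = kmult N (kmult N (kadj u) u) (kmult N (kdiag l) (kmult N (kadj u) u)) a a"
    by (simp add: kmult_assoc)
  also have "\<dots> = kmult N kid (kmult N (kdiag l) kid) a a"
  proof -
    have "keq N (kmult N (kmult N (kadj u) u) (kmult N (kdiag l) (kmult N (kadj u) u))) (kmult N kid (kmult N (kdiag l) kid))"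
      using assms(2) by (intro keq_kmult) (auto simp: kunitary_def)
    then show ?thesis using a by (simp add: keq_def)
  qed
  also have "\<dots> = of_real (l a)" unfolding kmult_kid(2)[OF a] kdiag_mult(1)[OF a] by (simp add: kid_def)
  finally show ?thesis by (simp add: less_eq_complex_def)
qed

text \<open>In eigenbases of \<open>b\<close> and \<open>c\<close>, equality of the squares says that the overlap of two
  eigenvectors vanishes unless the squared eigenvalues agree.\<close>

lemma kpsd_sqrt_unique:
  assumes b: "kpsd N b" and c: "kpsd N c" and sq: "keq N (kmult N b b) (kmult N c c)"
  shows "keq N b c"
proof -
  obtain u l where u: "kunitary N u" and bu: "keq N b (kmult N u (kmult N (kdiag l) (kadj u)))"
    using spectral_theorem[OF kpsd_herm[OF b]] by (elim exE conjE)
  obtain w m where w: "kunitary N w" and cw: "keq N c (kmult N w (kmult N (kdiag m) (kadj w)))"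
    using spectral_theorem[OF kpsd_herm[OF c]] by (elim exE conjE)
  note l0 = kpsd_diag_nonneg[of N b u l, OF b u bu] and m0 = kpsd_diag_nonneg[of N c w m, OF c w cw]
  \<comment> \<open>\<open>M\<close> holds the overlaps of the two eigenbases. Comparing the squares
    in these bases gives \<open>l i * l i = m j * m j\<close> wherever \<open>M i j\<close> is
    nonzero, and nonnegativity removes the squares.\<close>
  define M where "M = kmult N (kadj u) w"
  have k1: "keq N (kmult N (kadj u) (kmult N (kmult N u (kmult N d (kadj u))) w)) (kmult N d M)" for d
  proof -
    have "keq N (kmult N (kadj u) (kmult N (kmult N u (kmult N d (kadj u))) w))
      (kmult N (kmult N (kadj u) u) (kmult N d M))"
      unfolding kmult_assoc M_def by (rule keq_refl)
    also have "keq N \<dots> (kmult N kid (kmult N d M))" using u by (intro keq_kmult) (auto simp: kunitary_def)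
    also have "keq N \<dots> (kmult N d M)" by (rule keq_kid)
    finally show ?thesis .
  qed
  have k2: "keq N (kmult N (kadj u) (kmult N (kmult N w (kmult N d (kadj w))) w)) (kmult N M d)" for d
  proof -
    have "keq N (kmult N (kadj u) (kmult N (kmult N w (kmult N d (kadj w))) w))
      (kmult N M (kmult N d (kmult N (kadj w) w)))"
      unfolding kmult_assoc M_def by (rule keq_refl)
    also have "keq N \<dots> (kmult N M (kmult N d kid))" using w by (intro keq_kmult) (auto simp: kunitary_def)
    also have "keq N \<dots> (kmult N M d)" by (intro keq_kid keq_kmult) auto
    finally show ?thesis .
  qed
  have bb: "keq N (kmult N b b) (kmult N u (kmult N (kmult N (kdiag l) (kdiag l)) (kadj u)))"
    using keq_trans[OF keq_kmult[OF bu bu] kconj_mult[OF u]] .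
  have cc: "keq N (kmult N c c) (kmult N w (kmult N (kmult N (kdiag m) (kdiag m)) (kadj w)))"
    using keq_trans[OF keq_kmult[OF cw cw] kconj_mult[OF w]] .
  have "keq N (kmult N (kmult N (kdiag l) (kdiag l)) M) (kmult N M (kmult N (kdiag m) (kdiag m)))"
  proof -
    have "keq N (kmult N (kmult N (kdiag l) (kdiag l)) M) (kmult N (kadj u) (kmult N (kmult N b b) w))"
      by (rule keq_trans[OF keq_sym[OF k1]]) (intro keq_kmult keq_sym[OF bb] keq_refl)
    also have "keq N \<dots> (kmult N (kadj u) (kmult N (kmult N c c) w))"
      by (rule keq_kmult[OF keq_refl keq_kmult[OF sq keq_refl]])
    also have "keq N \<dots> (kmult N (kadj u) (kmult N (kmult N w (kmult N (kmult N (kdiag m) (kdiag m)) (kadj w))) w))"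
      by (rule keq_kmult[OF keq_refl keq_kmult[OF cc keq_refl]])
    also have "keq N \<dots> (kmult N M (kmult N (kdiag m) (kdiag m)))" by (rule k2)
    finally show ?thesis .
  qed
  then have lm2: "of_real (l i * l i) * M i j = M i j * of_real (m j * m j)" if "i < N" "j < N" for i j
  proof -
    have "kmult N (kmult N (kdiag l) (kdiag l)) M i j = of_real (l i * l i) * M i j"
      unfolding kmult_assoc using that by (simp add: kdiag_mult mult.assoc)
    moreover have "kmult N M (kmult N (kdiag m) (kdiag m)) i j = M i j * of_real (m j * m j)"
      unfolding kmult_assoc[symmetric] using that by (simp add: kdiag_mult mult.assoc)
    ultimately show ?thesis
      using \<open>keq N (kmult N (kmult N (kdiag l) (kdiag l)) M) _\<close> that by (simp only: keq_def)
  qed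
  have lm: "keq N (kmult N (kdiag l) M) (kmult N M (kdiag m))"
    unfolding keq_def
  proof (intro allI impI)
    fix i j assume ij: "i < N" "j < N"
    show "kmult N (kdiag l) M i j = kmult N M (kdiag m) i j"
    proof (cases "M i j = 0")
      case False
      have "M i j * of_real (l i * l i) = M i j * of_real (m j * m j)"
        using lm2[OF ij] by (simp only: mult.commute)
      then have "complex_of_real (l i * l i) = of_real (m j * m j)" using False by (simp only: mult_cancel_left) simp
      then have "l i * l i = m j * m j" by (simp only: of_real_eq_iff)
      then have "l i = m j" using l0[OF ij(1)] m0[OF ij(2)] by (metis power2_eq_square power2_eq_iff_nonneg)
      then show ?thesis using ij by (simp add: kdiag_mult)
    qed (use ij in \<open>simp add: kdiag_mult\<close>)
  qed
  \<comment> \<open>Changing back from the two eigenbases turns the two sides of \<open>lm\<close>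
    into \<open>b\<close> and \<open>c\<close>.\<close>
  have e1: "keq N (kmult N u (kmult N (kmult N (kdiag l) M) (kadj w))) (kmult N u (kmult N (kmult N M (kdiag m)) (kadj w)))"
    by (rule keq_kmult[OF keq_refl keq_kmult[OF lm keq_refl]])
  have e2: "keq N (kmult N u (kmult N (kmult N (kdiag l) M) (kadj w))) b"
  proof -
    have "keq N (kmult N u (kmult N (kmult N (kdiag l) M) (kadj w)))
      (kmult N (kmult N u (kmult N (kdiag l) (kadj u))) (kmult N w (kadj w)))"
      unfolding kmult_assoc M_def by (rule keq_refl)
    also have "keq N \<dots> (kmult N b kid)"
      using keq_sym[OF bu] kunitary_right[OF w] by (intro keq_kmult) auto
    also have "keq N \<dots> b" by (rule keq_kid)
    finally show ?thesis .
  qed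
  have e3: "keq N (kmult N u (kmult N (kmult N M (kdiag m)) (kadj w))) c"
  proof -
    have "keq N (kmult N u (kmult N (kmult N M (kdiag m)) (kadj w)))
      (kmult N (kmult N u (kadj u)) (kmult N w (kmult N (kdiag m) (kadj w))))"
      unfolding kmult_assoc M_def by (rule keq_refl)
    also have "keq N \<dots> (kmult N kid c)"
      using keq_sym[OF cw] kunitary_right[OF u] by (intro keq_kmult) auto
    also have "keq N \<dots> c" by (rule keq_kid)
    finally show ?thesis .
  qed
  show ?thesis by (rule keq_trans[OF keq_sym[OF e2] keq_trans[OF e1 e3]])
qed

section \<open>Absolute values and Schatten norms of hermitian matrices\<close>

abbreviation ker :: "complex mat \<Rightarrow> kernel" where
  "ker A \<equiv> \<lambda>i j. A $$ (i, j)"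

lemma mat_adjoint_dim [simp]: "dim_row (mat_adjoint A) = dim_col A" "dim_col (mat_adjoint A) = dim_row A"
  by (auto simp: mat_adjoint_def)

lemma mat_adjoint_index [simp]:
  "i < dim_col A \<Longrightarrow> j < dim_row A \<Longrightarrow> mat_adjoint A $$ (i, j) = cnj (A $$ (j, i))"
  for A :: "complex mat"
  by (simp add: mat_adjoint_def mat_of_rows_index)

lemma ker_mult:
  "A \<in> carrier_mat N N \<Longrightarrow> B \<in> carrier_mat N N \<Longrightarrow> keq N (ker (A * B)) (kmult N (ker A) (ker B))"
  by (auto simp: keq_def kmult_def scalar_prod_def atLeast0LessThan)

lemma ker_adjoint: "A \<in> carrier_mat N N \<Longrightarrow> keq N (ker (mat_adjoint A)) (kadj (ker A))"
  by (auto simp: keq_def kadj_def)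

lemma ker_eq_iff:
  "A \<in> carrier_mat N N \<Longrightarrow> B \<in> carrier_mat N N \<Longrightarrow> A = B \<longleftrightarrow> keq N (ker A) (ker B)"
  by (auto simp: keq_def intro!: eq_matI)

lemma psd_kpsd: assumes "B \<in> carrier_mat N N" shows "psd B \<longleftrightarrow> kpsd N (ker B)"
proof -
  have e: "(B *\<^sub>v v) \<bullet>c v = (\<Sum>i<N. (\<Sum>j<N. B $$ (i, j) * v $ j) * cnj (v $ i))" if "v \<in> carrier_vec N" for v
    using assms that by (simp add: scalar_prod_def atLeast0LessThan)
  show ?thesis
  proof
    assume l: "psd B"
    show "kpsd N (ker B)" unfolding kpsd_def
    proof
      fix v :: "nat \<Rightarrow> complex"
      have "0 \<le> (B *\<^sub>v vec N v) \<bullet>c vec N v" using l assms by (simp add: psd_def)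
      then show "0 \<le> (\<Sum>i<N. (\<Sum>j<N. ker B i j * v j) * cnj (v i))"
        by (subst (asm) e) auto
    qed
  next
    assume "kpsd N (ker B)"
    then show "psd B" using assms e by (auto simp: psd_def kpsd_def)
  qed
qed

text \<open>\<open>abs_mat\<close> is a definite description. Taking absolute values of the
  eigenvalues provides a witness, and \<open>kpsd_sqrt_unique\<close> shows that it is the only
  one.\<close>

lemma abs_mat_hermitian:
  assumes g: "g \<in> carrier_mat N N" and h: "mat_adjoint g = g"
  obtains u l where "kunitary N u" "keq N (ker g) (kmult N u (kmult N (kdiag l) (kadj u)))"
    "abs_mat g \<in> carrier_mat N N" "abs_mat g * abs_mat g = g * g" "psd (abs_mat g)"
    "keq N (ker (abs_mat g)) (kmult N u (kmult N (kdiag (\<lambda>a. \<bar>l a\<bar>)) (kadj u)))"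
proof -
  have "kherm N (ker g)" using ker_adjoint[OF g] h by (auto simp: kherm_def intro: keq_sym)
  then obtain u l where u: "kunitary N u" and gu: "keq N (ker g) (kmult N u (kmult N (kdiag l) (kadj u)))"
    using spectral_theorem by blast
  let ?b = "kmult N u (kmult N (kdiag (\<lambda>a. \<bar>l a\<bar>)) (kadj u))"
  let ?B = "mat N N (\<lambda>(i, j). ?b i j)"
  have Bc: "?B \<in> carrier_mat N N" by simp
  have kB: "keq N (ker ?B) ?b" by (simp add: keq_def)
  have "kpsd N ?b" unfolding kpsd_def
  proof
    fix v
    have "(\<Sum>i<N. (\<Sum>j<N. ?b i j * v j) * cnj (v i))
        = (\<Sum>i<N. \<Sum>j<N. \<Sum>a<N. (u i a * of_real \<bar>l a\<bar> * cnj (u j a)) * v j * cnj (v i))"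
      unfolding sum_distrib_right
      by (intro sum.cong refl) (simp add: kmult_def[of _ u] kdiag_mult kadj_def sum_distrib_right mult.assoc)
    also have "\<dots> = (\<Sum>i<N. \<Sum>a<N. \<Sum>j<N. (u i a * of_real \<bar>l a\<bar> * cnj (u j a)) * v j * cnj (v i))"
      by (rule sum.cong[OF refl], rule sum.swap)
    also have "\<dots> = (\<Sum>a<N. \<Sum>i<N. \<Sum>j<N. (u i a * of_real \<bar>l a\<bar> * cnj (u j a)) * v j * cnj (v i))"
      by (rule sum.swap)
    also have "\<dots> = (\<Sum>a<N. of_real \<bar>l a\<bar> * ((\<Sum>i<N. u i a * cnj (v i)) * cnj (\<Sum>i<N. u i a * cnj (v i))))"
      unfolding cnj_sum sum_product unfolding sum_distrib_left
      by (intro sum.cong refl) (simp only: mult_ac complex_cnj_mult complex_cnj_cnj)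
    also have "\<dots> = of_real (\<Sum>a<N. \<bar>l a\<bar> * (cmod (\<Sum>i<N. u i a * cnj (v i)))\<^sup>2)"
      unfolding of_real_sum of_real_mult complex_norm_square by simp
    finally show "0 \<le> (\<Sum>i<N. (\<Sum>j<N. ?b i j * v j) * cnj (v i))"
      by (simp only: less_eq_complex_def) (auto intro!: sum_nonneg)
  qed
  then have pB: "psd ?B" using psd_kpsd[OF Bc] kpsd_cong[OF kB] by simp
  have "keq N (ker (?B * ?B)) (kmult N ?b ?b)"
    using keq_trans[OF ker_mult[OF Bc Bc] keq_kmult[OF kB kB]] .
  also have "keq N \<dots> (kmult N u (kmult N (kmult N (kdiag (\<lambda>a. \<bar>l a\<bar>)) (kdiag (\<lambda>a. \<bar>l a\<bar>))) (kadj u)))"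
    by (rule kconj_mult[OF u])
  also have "keq N \<dots> (kmult N u (kmult N (kmult N (kdiag l) (kdiag l)) (kadj u)))"
  proof -
    have "keq N (kmult N (kdiag (\<lambda>a. \<bar>l a\<bar>)) (kdiag (\<lambda>a. \<bar>l a\<bar>))) (kmult N (kdiag l) (kdiag l))"
      by (simp add: keq_def kdiag_mult) (simp add: kdiag_def flip: of_real_mult)
    then show ?thesis by (intro keq_kmult[OF keq_refl keq_kmult[OF _ keq_refl]])
  qed
  also have "keq N \<dots> (kmult N (ker g) (ker g))"
    by (rule keq_sym, rule keq_trans[OF keq_kmult[OF gu gu] kconj_mult[OF u]])
  also have "keq N \<dots> (ker (g * g))" by (rule keq_sym, rule ker_mult[OF g g])
  finally have BB: "?B * ?B = g * g"
    using ker_eq_iff[of "?B * ?B" N "g * g"] g mult_carrier_mat[OF Bc Bc] by simp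
  have "abs_mat g = ?B" unfolding abs_mat_def
  proof (rule the_equality)
    show "?B \<in> carrier_mat (dim_col g) (dim_col g) \<and> psd ?B \<and> ?B * ?B = mat_adjoint g * g"
      using g h pB BB by auto
    fix C assume "C \<in> carrier_mat (dim_col g) (dim_col g) \<and> psd C \<and> C * C = mat_adjoint g * g"
    then have C: "C \<in> carrier_mat N N" "psd C" "C * C = ?B * ?B" using g h BB by auto
    have "keq N (kmult N (ker C) (ker C)) (kmult N (ker ?B) (ker ?B))"
      using keq_trans[OF keq_sym[OF ker_mult[OF C(1) C(1)]]] ker_mult[OF Bc Bc] C(3) by auto
    then have "keq N (ker C) (ker ?B)"
      using kpsd_sqrt_unique[of N "ker C" "ker ?B"] C pB psd_kpsd[OF C(1)] psd_kpsd[OF Bc] by auto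
    then show "C = ?B" using ker_eq_iff[OF C(1) Bc] by simp
  qed
  then have a: "abs_mat g = ?B" .
  show ?thesis by (rule that[OF u gu]) (use BB kB Bc pB a in \<open>simp_all only:\<close>)
qed

lemma trace_kconj:
  assumes "kunitary N u" shows "(\<Sum>i<N. kmult N u (kmult N (kdiag l) (kadj u)) i i) = of_real (\<Sum>a<N. l a)"
proof -
  have "(\<Sum>i<N. kmult N u (kmult N (kdiag l) (kadj u)) i i) = (\<Sum>i<N. \<Sum>a<N. of_real (l a) * (kadj u a i * u i a))"
    by (simp add: kmult_def[of _ u] kdiag_mult mult_ac)
  also have "\<dots> = (\<Sum>a<N. of_real (l a) * kmult N (kadj u) u a a)"
    unfolding kmult_def sum_distrib_left by (rule sum.swap)
  also have "\<dots> = of_real (\<Sum>a<N. l a)"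
    using assms by (simp add: kunitary_def keq_def kid_def)
  finally show ?thesis .
qed

lemma hs_norm_sq_herm:
  assumes "kherm N g" shows "of_real ((hs_norm N g)\<^sup>2) = (\<Sum>i<N. kmult N g g i i)"
proof -
  have "of_real ((hs_norm N g)\<^sup>2) = (\<Sum>i<N. \<Sum>j<N. g i j * cnj (g i j))"
    unfolding hs_norm_sq of_real_sum complex_norm_square ..
  also have "\<dots> = (\<Sum>i<N. kmult N g g i i)"
    unfolding kmult_def using assms by (intro sum.cong refl) (auto simp: kherm_def keq_def kadj_def)
  finally show ?thesis .
qed

lemma kunitary_parseval:
  assumes "kunitary N u" shows "(\<Sum>a<N. (cmod (\<Sum>k<N. z k * u k a))\<^sup>2) = (\<Sum>k<N. (cmod (z k))\<^sup>2)"
proof -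
  have "complex_of_real (\<Sum>a<N. (cmod (\<Sum>k<N. z k * u k a))\<^sup>2)
      = (\<Sum>a<N. \<Sum>k<N. \<Sum>m<N. (z k * u k a) * cnj (z m * u m a))"
    unfolding of_real_sum complex_norm_square by (simp add: sum_product)
  also have "\<dots> = (\<Sum>k<N. \<Sum>a<N. \<Sum>m<N. (z k * u k a) * cnj (z m * u m a))" by (rule sum.swap)
  also have "\<dots> = (\<Sum>k<N. \<Sum>m<N. \<Sum>a<N. (z k * u k a) * cnj (z m * u m a))"
    by (rule sum.cong[OF refl], rule sum.swap)
  also have "\<dots> = (\<Sum>k<N. \<Sum>m<N. z k * cnj (z m) * kmult N u (kadj u) k m)"
    unfolding kmult_def kadj_def sum_distrib_left by (simp add: mult_ac)
  also have "\<dots> = (\<Sum>k<N. \<Sum>m<N. kid m k * (z k * cnj (z m)))"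
    using kunitary_right[OF assms] by (intro sum.cong refl) (auto simp: keq_def kid_def)
  also have "\<dots> = (\<Sum>k<N. z k * cnj (z k))" by (intro sum.cong refl) (simp add: sum_kid)
  also have "\<dots> = of_real (\<Sum>k<N. (cmod (z k))\<^sup>2)"
    unfolding of_real_sum complex_norm_square ..
  finally show ?thesis by (simp only: of_real_eq_iff)
qed

lemma sum_cauchy_schwarz_sq: "(\<Sum>i\<in>I. a i * b i)\<^sup>2 \<le> (\<Sum>i\<in>I. (a i)\<^sup>2) * (\<Sum>i\<in>I. (b i)\<^sup>2)"
  for a b :: "'i \<Rightarrow> real"
proof -
  have "\<bar>\<Sum>i\<in>I. a i * b i\<bar> \<le> L2_set a I * L2_set b I"
    by (rule order_trans[OF sum_abs]) (use L2_set_mult_ineq[of a b I] in \<open>simp add: abs_mult\<close>)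
  then have "(\<Sum>i\<in>I. a i * b i)\<^sup>2 \<le> (L2_set a I * L2_set b I)\<^sup>2"
    by (metis abs_ge_zero power2_abs power_mono)
  then show ?thesis by (simp add: power_mult_distrib L2_set_def sum_nonneg)
qed

text \<open>Cauchy-Schwarz against the unit vector in column \<open>a\<close>: an expectation of
  \<open>f\<close> is at most the length of the image vector.\<close>

lemma expectation_sq_le:
  assumes u: "kunitary N u" and a: "a < N"
  shows "(cmod (\<Sum>i<N. cnj (u i a) * (\<Sum>k<N. f i k * u k a)))\<^sup>2 \<le> (\<Sum>i<N. (cmod (\<Sum>k<N. f i k * u k a))\<^sup>2)"
proof -
  let ?z = "\<lambda>i. \<Sum>k<N. f i k * u k a"
  have "cmod (\<Sum>i<N. cnj (u i a) * ?z i) \<le> (\<Sum>i<N. cmod (u i a) * cmod (?z i))"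
    by (rule order_trans[OF norm_sum]) (simp add: norm_mult)
  then have "(cmod (\<Sum>i<N. cnj (u i a) * ?z i))\<^sup>2 \<le> (\<Sum>i<N. cmod (u i a) * cmod (?z i))\<^sup>2"
    by (rule power_mono) simp
  also have "\<dots> \<le> (\<Sum>i<N. (cmod (u i a))\<^sup>2) * (\<Sum>i<N. (cmod (?z i))\<^sup>2)"
    by (rule sum_cauchy_schwarz_sq)
  also have "complex_of_real (\<Sum>i<N. (cmod (u i a))\<^sup>2) = kmult N (kadj u) u a a"
    unfolding of_real_sum complex_norm_square kmult_def kadj_def by (simp add: mult.commute)
  then have "(\<Sum>i<N. (cmod (u i a))\<^sup>2) = 1"
    using u a by (simp add: kunitary_def keq_def kid_def del: of_real_sum of_real_power) 
  finally show ?thesis by simp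
qed

text \<open>Stands in for the duality of the 4-norm and the 4/3-norm. In an eigenbasis of
  \<open>g\<close> the trace of the product is the sum of \<open>l a * F a\<close>, with
  \<open>F a\<close> the expectation of \<open>f\<close> in eigenvector \<open>a\<close>.
  Cauchy-Schwarz with weights \<open>\<bar>l a\<bar>\<close> splits off the trace norm; a second
  application, to \<open>\<bar>l a\<bar>\<close> and the expectation \<open>H a\<close> of the
  kernel \<open>?h\<close>, leaves the two Hilbert-Schmidt norms.\<close>

lemma trace_duality:
  assumes u: "kunitary N u" and g: "keq N g (kmult N u (kmult N (kdiag l) (kadj u)))" and h: "kherm N g"
  shows "(cmod (\<Sum>i<N. \<Sum>j<N. f j i * g i j))\<^sup>2
    \<le> hs_norm N (kmult N (kadj f) f) * hs_norm N g * (\<Sum>a<N. \<bar>l a\<bar>)"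
proof -
  let ?h = "kmult N (kadj f) f"
  define F where "F = (\<lambda>a. \<Sum>j<N. cnj (u j a) * (\<Sum>i<N. f j i * u i a))"
  define H where "H = (\<lambda>a. \<Sum>j<N. (cmod (\<Sum>i<N. f j i * u i a))\<^sup>2)"
  have H0: "0 \<le> H a" for a by (simp add: H_def sum_nonneg)
  have "(\<Sum>i<N. \<Sum>j<N. f j i * g i j) = (\<Sum>i<N. \<Sum>j<N. \<Sum>a<N. of_real (l a) * (cnj (u j a) * (f j i * u i a)))"
    using g by (intro sum.cong refl)
      (simp add: keq_def kmult_def[of _ u] kdiag_mult kadj_def sum_distrib_left mult_ac)
  also have "\<dots> = (\<Sum>i<N. \<Sum>a<N. \<Sum>j<N. of_real (l a) * (cnj (u j a) * (f j i * u i a)))"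
    by (rule sum.cong[OF refl], rule sum.swap)
  also have "\<dots> = (\<Sum>a<N. \<Sum>i<N. \<Sum>j<N. of_real (l a) * (cnj (u j a) * (f j i * u i a)))" by (rule sum.swap)
  also have "\<dots> = (\<Sum>a<N. \<Sum>j<N. \<Sum>i<N. of_real (l a) * (cnj (u j a) * (f j i * u i a)))"
    by (rule sum.cong[OF refl], rule sum.swap)
  also have "\<dots> = (\<Sum>a<N. of_real (l a) * F a)"
    by (simp add: F_def sum_distrib_left)
  finally have tr: "(\<Sum>i<N. \<Sum>j<N. f j i * g i j) = (\<Sum>a<N. of_real (l a) * F a)" .
  have FH: "(cmod (F a))\<^sup>2 \<le> H a" if "a < N" for a
    unfolding F_def H_def by (rule expectation_sq_le[OF u that])
  have "cmod (\<Sum>a<N. of_real (l a) * F a) \<le> (\<Sum>a<N. sqrt \<bar>l a\<bar> * (sqrt \<bar>l a\<bar> * cmod (F a)))"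
    by (rule order_trans[OF norm_sum]) (simp add: norm_mult mult.assoc[symmetric])
  then have "(cmod (\<Sum>a<N. of_real (l a) * F a))\<^sup>2 \<le> (\<Sum>a<N. sqrt \<bar>l a\<bar> * (sqrt \<bar>l a\<bar> * cmod (F a)))\<^sup>2"
    by (rule power_mono) simp
  also have "\<dots> \<le> (\<Sum>a<N. (sqrt \<bar>l a\<bar>)\<^sup>2) * (\<Sum>a<N. (sqrt \<bar>l a\<bar> * cmod (F a))\<^sup>2)"
    by (rule sum_cauchy_schwarz_sq)
  also have "\<dots> = (\<Sum>a<N. \<bar>l a\<bar>) * (\<Sum>a<N. \<bar>l a\<bar> * (cmod (F a))\<^sup>2)"
    by (simp add: power_mult_distrib)
  also have "\<dots> \<le> (\<Sum>a<N. \<bar>l a\<bar>) * (hs_norm N ?h * hs_norm N g)"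
  proof (rule mult_left_mono)
    have "(\<Sum>a<N. \<bar>l a\<bar> * (cmod (F a))\<^sup>2) \<le> (\<Sum>a<N. \<bar>l a\<bar> * H a)"
      using FH by (intro sum_mono mult_left_mono) auto
    also have "\<dots> \<le> hs_norm N ?h * hs_norm N g"
    proof (rule power2_le_imp_le)
      have "(\<Sum>a<N. \<bar>l a\<bar> * H a)\<^sup>2 \<le> (\<Sum>a<N. \<bar>l a\<bar>\<^sup>2) * (\<Sum>a<N. (H a)\<^sup>2)"
        by (rule sum_cauchy_schwarz_sq)
      also have "(\<Sum>a<N. \<bar>l a\<bar>\<^sup>2) = (hs_norm N g)\<^sup>2"
      proof -
        have "complex_of_real ((hs_norm N g)\<^sup>2) = (\<Sum>i<N. kmult N g g i i)" by (rule hs_norm_sq_herm[OF h])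
        also have "\<dots> = (\<Sum>i<N. kmult N u (kmult N (kdiag (\<lambda>a. (l a)\<^sup>2)) (kadj u)) i i)"
        proof -
          have "keq N (kmult N g g) (kmult N u (kmult N (kmult N (kdiag l) (kdiag l)) (kadj u)))"
            by (rule keq_trans[OF keq_kmult[OF g g] kconj_mult[OF u]])
          also have "keq N \<dots> (kmult N u (kmult N (kdiag (\<lambda>a. (l a)\<^sup>2)) (kadj u)))"
          proof -
            have "keq N (kmult N (kdiag l) (kdiag l)) (kdiag (\<lambda>a. (l a)\<^sup>2))"
              by (simp add: keq_def kdiag_mult) (simp add: kdiag_def power2_eq_square)
            then show ?thesis by (intro keq_kmult[OF keq_refl keq_kmult[OF _ keq_refl]])
          qed
          finally show ?thesis by (simp add: keq_def)
        qed
        also have "\<dots> = of_real (\<Sum>a<N. (l a)\<^sup>2)" by (rule trace_kconj[OF u])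
        finally show ?thesis by (simp only: of_real_eq_iff power2_abs)
      qed
      \<comment> \<open>The \<open>H a\<close> are the diagonal entries of \<open>?h\<close> in the
        orthonormal eigenbasis, so their square sum is at most that of all entries.\<close>
      also have "(\<Sum>a<N. (H a)\<^sup>2) \<le> (hs_norm N ?h)\<^sup>2"
      proof -
        have "(H a)\<^sup>2 \<le> (\<Sum>i<N. (cmod (\<Sum>k<N. ?h i k * u k a))\<^sup>2)" if a: "a < N" for a
        proof -
          have "complex_of_real (H a) = (\<Sum>j<N. \<Sum>i<N. \<Sum>k<N. cnj (f j i * u i a) * (f j k * u k a))"
            unfolding H_def of_real_sum complex_norm_square
            by (rule sum.cong[OF refl], subst mult.commute, simp only: cnj_sum sum_product)
          also have "\<dots> = (\<Sum>i<N. \<Sum>j<N. \<Sum>k<N. cnj (f j i * u i a) * (f j k * u k a))" by (rule sum.swap)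
          also have "\<dots> = (\<Sum>i<N. \<Sum>k<N. \<Sum>j<N. cnj (f j i * u i a) * (f j k * u k a))"
            by (rule sum.cong[OF refl], rule sum.swap)
          also have "\<dots> = (\<Sum>i<N. cnj (u i a) * (\<Sum>k<N. ?h i k * u k a))"
            unfolding kmult_def kadj_def sum_distrib_left sum_distrib_right
            by (intro sum.cong refl) (simp add: mult_ac)
          finally have e: "complex_of_real (H a) = (\<Sum>i<N. cnj (u i a) * (\<Sum>k<N. ?h i k * u k a))" .
          have "(H a)\<^sup>2 = (cmod (complex_of_real (H a)))\<^sup>2" by simp
          also have "\<dots> \<le> (\<Sum>i<N. (cmod (\<Sum>k<N. ?h i k * u k a))\<^sup>2)"
            unfolding e by (rule expectation_sq_le[OF u a])
          finally show ?thesis .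
        qed
        then have "(\<Sum>a<N. (H a)\<^sup>2) \<le> (\<Sum>a<N. \<Sum>i<N. (cmod (\<Sum>k<N. ?h i k * u k a))\<^sup>2)"
          by (intro sum_mono) auto
        also have "\<dots> = (\<Sum>i<N. \<Sum>a<N. (cmod (\<Sum>k<N. ?h i k * u k a))\<^sup>2)" by (rule sum.swap)
        also have "\<dots> = (hs_norm N ?h)\<^sup>2"
          unfolding hs_norm_sq by (intro sum.cong refl kunitary_parseval[OF u])
        finally show ?thesis .
      qed
      finally have "(\<Sum>a<N. \<bar>l a\<bar> * H a)\<^sup>2 \<le> (hs_norm N g)\<^sup>2 * (hs_norm N ?h)\<^sup>2"
        by (simp add: mult_left_mono)
      then show "(\<Sum>a<N. \<bar>l a\<bar> * H a)\<^sup>2 \<le> (hs_norm N ?h * hs_norm N g)\<^sup>2"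
        by (simp only: power_mult_distrib mult.commute)
    qed simp
    finally show "(\<Sum>a<N. \<bar>l a\<bar> * (cmod (F a))\<^sup>2) \<le> hs_norm N ?h * hs_norm N g" .
  qed (simp add: sum_nonneg)
  finally show ?thesis unfolding tr by (simp add: mult_ac)
qed

text \<open>For hermitian \<open>g\<close> the square of \<open>abs_mat g\<close> is
  \<open>g * g\<close>, so its trace is read off without eigenvalues.\<close>

lemma schatten_2:
  assumes g: "g \<in> carrier_mat (2 ^ n) (2 ^ n)" and h: "mat_adjoint g = g"
  shows "schatten_norm n 2 g = hs_norm (2 ^ n) (ker g) / sqrt (2 ^ n)"
proof -
  let ?N = "2 ^ n :: nat"
  obtain u l where "kunitary ?N u" "keq ?N (ker g) (kmult ?N u (kmult ?N (kdiag l) (kadj u)))"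
    and ul: "abs_mat g \<in> carrier_mat ?N ?N" "abs_mat g * abs_mat g = g * g" and "psd (abs_mat g)"
    and "keq ?N (ker (abs_mat g)) (kmult ?N u (kmult ?N (kdiag (\<lambda>a. \<bar>l a\<bar>)) (kadj u)))"
    by (rule abs_mat_hermitian[OF g h])
  have "abs_mat g ^\<^sub>m 2 = g * g" using ul by (simp add: numeral_2_eq_2)
  then have "mtrace (abs_mat g ^\<^sub>m 2) = (\<Sum>i<?N. ker (g * g) i i)"
    using g by (simp add: mtrace_def)
  also have "\<dots> = (\<Sum>i<?N. kmult ?N (ker g) (ker g) i i)" 
    using ker_mult[OF g g] by (simp add: keq_def)
  also have "\<dots> = of_real ((hs_norm ?N (ker g))\<^sup>2)"
    using ker_adjoint[OF g] h by (intro hs_norm_sq_herm[symmetric]) (auto simp: kherm_def intro: keq_sym)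
  finally have "Re (mtrace (abs_mat g ^\<^sub>m 2)) = (hs_norm ?N (ker g))\<^sup>2" by simp
  then show ?thesis
    by (simp add: schatten_norm_def sqrt_def[symmetric] real_sqrt_divide)
qed

lemma schatten_1_duality:
  assumes g: "g \<in> carrier_mat (2 ^ n) (2 ^ n)" and h: "mat_adjoint g = g"
  shows "0 \<le> schatten_norm n 1 g"
    and "(cmod (\<Sum>i<2^n. \<Sum>j<2^n. f j i * g $$ (i, j)))\<^sup>2
      \<le> hs_norm (2 ^ n) (kmult (2 ^ n) (kadj f) f) * hs_norm (2 ^ n) (ker g) * (2 ^ n * schatten_norm n 1 g)"
proof -
  let ?N = "2 ^ n :: nat"
  obtain u l where u: "kunitary ?N u" and gu: "keq ?N (ker g) (kmult ?N u (kmult ?N (kdiag l) (kadj u)))"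
    and c: "abs_mat g \<in> carrier_mat ?N ?N" "abs_mat g * abs_mat g = g * g" and "psd (abs_mat g)"
    and a: "keq ?N (ker (abs_mat g)) (kmult ?N u (kmult ?N (kdiag (\<lambda>a. \<bar>l a\<bar>)) (kadj u)))"
    by (rule abs_mat_hermitian[OF g h])
  have "mtrace (abs_mat g ^\<^sub>m 1) = (\<Sum>i<?N. ker (abs_mat g) i i)"
    using c(1) by (simp add: mtrace_def)
  also have "\<dots> = (\<Sum>i<?N. kmult ?N u (kmult ?N (kdiag (\<lambda>a. \<bar>l a\<bar>)) (kadj u)) i i)"
    using a by (intro sum.cong refl) (auto simp: keq_def)
  also have "\<dots> = of_real (\<Sum>a<?N. \<bar>l a\<bar>)" by (rule trace_kconj[OF u])
  finally have t: "mtrace (abs_mat g ^\<^sub>m 1) = of_real (\<Sum>a<?N. \<bar>l a\<bar>)" .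
  have e: "schatten_norm n 1 g = (\<Sum>a<?N. \<bar>l a\<bar>) / 2 ^ n"
    unfolding schatten_norm_def t by simp
  show "0 \<le> schatten_norm n 1 g" unfolding e by (simp add: sum_nonneg)
  have h': "kherm ?N (ker g)" using ker_adjoint[OF g] h by (auto simp: kherm_def intro: keq_sym)
  show "(cmod (\<Sum>i<2^n. \<Sum>j<2^n. f j i * g $$ (i, j)))\<^sup>2
      \<le> hs_norm (2 ^ n) (kmult (2 ^ n) (kadj f) f) * hs_norm (2 ^ n) (ker g) * (2 ^ n * schatten_norm n 1 g)"
    using trace_duality[OF u gu h', of f] unfolding e by simp
qed

section \<open>Pauli expansions and hypercontractivity\<close>

definition weight :: "pauli list \<Rightarrow> nat" where
  "weight s = length (filter (\<lambda>p. p \<noteq> PI) s)"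

lemma weight_simps [simp]: "weight [] = 0" "weight (p # s) = (if p = PI then weight s else Suc (weight s))"
  by (auto simp: weight_def)

lemma UNIV_pauli: "(UNIV :: pauli set) = {PI, PX, PY, PZ}"
  using pauli.exhaust by auto

lemma strings_Suc: "{s :: pauli list. length s = Suc n} = (\<lambda>(p, s). p # s) ` (UNIV \<times> {s. length s = n})"
  by (auto simp: length_Suc_conv)

lemma strings_card: "finite {s :: pauli list. length s = n} \<and> card {s :: pauli list. length s = n} = 4 ^ n"
proof (induction n)
  case (Suc n)
  have f: "finite (UNIV :: pauli set)" "card (UNIV :: pauli set) = 4" by (simp_all add: UNIV_pauli)
  have "inj_on (\<lambda>(p, s). p # s) (UNIV \<times> {s :: pauli list. length s = n})" by (auto simp: inj_on_def)
  then show ?case unfolding strings_Suc using Suc f by (simp add: card_image card_cartesian_product)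
qed simp

lemmas finite_strings [simp] = strings_card[THEN conjunct1]
lemmas card_strings = strings_card[THEN conjunct2]

lemma sum_strings_Suc:
  "(\<Sum>s | length s = Suc n. f s) = (\<Sum>s | length s = n. f (PI # s) + f (PX # s) + f (PY # s) + f (PZ # s))"
  for f :: "pauli list \<Rightarrow> 'a :: comm_monoid_add"
proof -
  have "(\<Sum>s | length s = Suc n. f s) = (\<Sum>(p, s)\<in>UNIV \<times> {s. length s = n}. f (p # s))"
    unfolding strings_Suc by (subst sum.reindex) (auto simp: inj_on_def case_prod_unfold)
  also have "\<dots> = (\<Sum>p\<in>UNIV. \<Sum>s | length s = n. f (p # s))"
    by (rule sum.cartesian_product[symmetric])
  also have "\<dots> = (\<Sum>s | length s = n. f (PI # s) + f (PX # s) + f (PY # s) + f (PZ # s))"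
    by (simp add: UNIV_pauli sum.distrib add_ac)
  finally show ?thesis .
qed

lemma pauli_mat_carrier [simp]: "pauli_mat p \<in> carrier_mat 2 2"
  by (cases p) (auto simp: mat_of_rows_list_def)

lemma pauli_mat_dim [simp]: "dim_row (pauli_mat p) = 2" "dim_col (pauli_mat p) = 2"
  by (rule carrier_matD[OF pauli_mat_carrier])+

lemma pauli_mat_index [simp]:
  "pauli_mat p $$ (0, 0) = (case p of PI \<Rightarrow> 1 | PX \<Rightarrow> 0 | PY \<Rightarrow> 0 | PZ \<Rightarrow> 1)"
  "pauli_mat p $$ (0, Suc 0) = (case p of PI \<Rightarrow> 0 | PX \<Rightarrow> 1 | PY \<Rightarrow> - \<i> | PZ \<Rightarrow> 0)"
  "pauli_mat p $$ (Suc 0, 0) = (case p of PI \<Rightarrow> 0 | PX \<Rightarrow> 1 | PY \<Rightarrow> \<i> | PZ \<Rightarrow> 0)"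
  "pauli_mat p $$ (Suc 0, Suc 0) = (case p of PI \<Rightarrow> 1 | PX \<Rightarrow> 0 | PY \<Rightarrow> 0 | PZ \<Rightarrow> - 1)"
  by (cases p; simp add: mat_of_rows_list_def)+

declare pauli_mat.simps [simp del]

lemma kron_dim [simp]: "dim_row (kron A B) = dim_row A * dim_row B" "dim_col (kron A B) = dim_col A * dim_col B"
  by (auto simp: kron_def)

lemma pauli_tensor_dim [simp]:
  "dim_row (pauli_tensor s) = 2 ^ length s" "dim_col (pauli_tensor s) = 2 ^ length s"
  by (induction s) auto

abbreviation pker :: "pauli list \<Rightarrow> kernel" where
  "pker s \<equiv> ker (pauli_tensor s)"

lemma pker_Cons:
  assumes l: "length s = n" and ij: "i < 2 ^ n" "j < 2 ^ n" and b: "b < 2" "b' < 2"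
  shows "pker (p # s) (b * 2 ^ n + i) (b' * 2 ^ n + j) = pauli_mat p $$ (b, b') * pker s i j"
proof -
  have "b * 2 ^ n + i < 2 * 2 ^ n" if "i < 2 ^ n" "b < 2" for b i :: nat
  proof -
    have "b = 0 \<or> b = 1" using that by auto
    then show ?thesis using that by auto
  qed
  note bd = this[OF ij(1) b(1)] this[OF ij(2) b(2)]
  show ?thesis using bd ij by (simp add: kron_def l)
qed

lemma pker_Cons_blocks:
  assumes "length s = n" "i < 2 ^ n" "j < 2 ^ n"
  shows "pker (p # s) i j = pauli_mat p $$ (0, 0) * pker s i j"
    "pker (p # s) i (2 ^ n + j) = pauli_mat p $$ (0, Suc 0) * pker s i j"
    "pker (p # s) (2 ^ n + i) j = pauli_mat p $$ (Suc 0, 0) * pker s i j"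
    "pker (p # s) (2 ^ n + i) (2 ^ n + j) = pauli_mat p $$ (Suc 0, Suc 0) * pker s i j"
  using pker_Cons[OF assms, of 0 0] pker_Cons[OF assms, of 0 1] pker_Cons[OF assms, of 1 0]
    pker_Cons[OF assms, of 1 1] by (simp_all del: pauli_mat_index pauli_tensor.simps)

lemma sum_double: "(\<Sum>i<2 * N. f i) = (\<Sum>i<N. f i + f (N + i))"
  for f :: "nat \<Rightarrow> 'a :: comm_monoid_add"
proof -
  have "(\<Sum>i<2 * N. f i) = (\<Sum>i<N. f i) + (\<Sum>i\<in>{N..<2 * N}. f i)"
    by (subst sum.union_disjoint[symmetric]) (auto intro!: sum.cong)
  also have "(\<Sum>i\<in>{N..<2 * N}. f i) = (\<Sum>i<N. f (N + i))"
    by (rule sum.reindex_bij_witness[of _ "\<lambda>i. N + i" "\<lambda>i. i - N"]) auto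
  finally show ?thesis by (simp add: sum.distrib)
qed

text \<open>Induction on the first letter: the four blocks contribute the inner product of two Pauli
  matrices times that of the tails.\<close>

lemma pker_orthogonal:
  "length s = n \<Longrightarrow> length t = n \<Longrightarrow>
    (\<Sum>i<2^n. \<Sum>j<2^n. cnj (pker s i j) * pker t i j) = (if s = t then 2 ^ n else 0)"
proof (induction n arbitrary: s t)
  case 0
  then show ?case by simp
next
  case (Suc n)
  obtain p s' where s: "s = p # s'" "length s' = n" using Suc.prems by (cases s) auto
  obtain q t' where t: "t = q # t'" "length t' = n" using Suc.prems by (cases t) auto
  let ?w = "\<lambda>b b'. cnj (pauli_mat p $$ (b, b')) * pauli_mat q $$ (b, b')"
  have "(\<Sum>i<2^Suc n. \<Sum>j<2^Suc n. cnj (pker s i j) * pker t i j)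
      = (\<Sum>i<2^n. \<Sum>j<2^n. (?w 0 0 + ?w 0 1 + ?w 1 0 + ?w 1 1) * (cnj (pker s' i j) * pker t' i j))"
    unfolding power_Suc sum_double sum.distrib[symmetric]
    by (intro sum.cong refl)
      (simp add: s(1) t(1) pker_Cons_blocks[OF s(2)] pker_Cons_blocks[OF t(2)] distrib_right
        del: pauli_mat_index pauli_tensor.simps)
  also have "\<dots> = (?w 0 0 + ?w 0 1 + ?w 1 0 + ?w 1 1) * (if s' = t' then 2 ^ n else 0)"
    unfolding sum_distrib_left[symmetric] using Suc.IH[OF s(2) t(2)] by simp
  also have "?w 0 0 + ?w 0 1 + ?w 1 0 + ?w 1 1 = (if p = q then 2 else 0)"
    by (cases p; cases q) auto
  finally show ?case using s t by auto
qed

definition psum :: "nat \<Rightarrow> (pauli list \<Rightarrow> complex) \<Rightarrow> kernel" where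
  "psum n c = (\<lambda>i j. \<Sum>s | length s = n. c s * pker s i j)"

lemma pauli_comb_ker: "keq (2 ^ n) (ker (pauli_comb n c)) (psum n c)"
  by (auto simp: keq_def pauli_comb_def psum_def)

lemma psum_inner:
  "(\<Sum>i<2^n. \<Sum>j<2^n. cnj (psum n c i j) * psum n c' i j) = 2 ^ n * (\<Sum>s | length s = n. cnj (c s) * c' s)"
proof -
  let ?S = "{s :: pauli list. length s = n}"
  have "(\<Sum>i<2^n. \<Sum>j<2^n. cnj (psum n c i j) * psum n c' i j)
      = (\<Sum>i<2^n. \<Sum>j<2^n. \<Sum>s\<in>?S. \<Sum>t\<in>?S. cnj (c s) * c' t * (cnj (pker s i j) * pker t i j))"
    unfolding psum_def cnj_sum sum_product by (intro sum.cong refl) simp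
  also have "\<dots> = (\<Sum>i<2^n. \<Sum>s\<in>?S. \<Sum>j<2^n. \<Sum>t\<in>?S. cnj (c s) * c' t * (cnj (pker s i j) * pker t i j))"
    by (rule sum.cong[OF refl], rule sum.swap)
  also have "\<dots> = (\<Sum>s\<in>?S. \<Sum>i<2^n. \<Sum>j<2^n. \<Sum>t\<in>?S. cnj (c s) * c' t * (cnj (pker s i j) * pker t i j))"
    by (rule sum.swap)
  also have "\<dots> = (\<Sum>s\<in>?S. \<Sum>i<2^n. \<Sum>t\<in>?S. \<Sum>j<2^n. cnj (c s) * c' t * (cnj (pker s i j) * pker t i j))"
    by (rule sum.cong[OF refl], rule sum.cong[OF refl], rule sum.swap)
  also have "\<dots> = (\<Sum>s\<in>?S. \<Sum>t\<in>?S. \<Sum>i<2^n. \<Sum>j<2^n. cnj (c s) * c' t * (cnj (pker s i j) * pker t i j))"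
    by (rule sum.cong[OF refl], rule sum.swap)
  also have "\<dots> = (\<Sum>s\<in>?S. \<Sum>t\<in>?S. cnj (c s) * c' t * (if s = t then 2 ^ n else 0))"
    unfolding sum_distrib_left[symmetric] by (intro sum.cong refl) (simp add: pker_orthogonal)
  also have "\<dots> = (\<Sum>s\<in>?S. cnj (c s) * c' s * 2 ^ n)"
    by (intro sum.cong refl) (simp add: if_distrib[of "\<lambda>x. _ * x"] cong: if_cong)
  finally show ?thesis by (simp add: sum_distrib_left mult_ac)
qed

lemma psum_parseval: "(hs_norm (2 ^ n) (psum n c))\<^sup>2 = 2 ^ n * (\<Sum>s | length s = n. (cmod (c s))\<^sup>2)"
proof -
  have "complex_of_real ((hs_norm (2 ^ n) (psum n c))\<^sup>2) = (\<Sum>i<2^n. \<Sum>j<2^n. cnj (psum n c i j) * psum n c i j)"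
    unfolding hs_norm_sq of_real_sum complex_norm_square by (simp add: mult.commute)
  also have "\<dots> = complex_of_real (2 ^ n * (\<Sum>s | length s = n. (cmod (c s))\<^sup>2))"
    unfolding psum_inner of_real_mult of_real_sum complex_norm_square by (simp add: mult.commute)
  finally show ?thesis by (simp only: of_real_eq_iff)
qed

text \<open>The expansion in the first qubit. These equations are the hypotheses of
  \<open>fourth_blocks\<close>; solved for the four components, they give the induction step of
  \<open>psum_complete\<close>.\<close>

lemma psum_blocks:
  assumes "i < 2 ^ n" "j < 2 ^ n"
  shows "psum (Suc n) c i j = psum n (\<lambda>s. c (PI # s)) i j + psum n (\<lambda>s. c (PZ # s)) i j"
    "psum (Suc n) c i (2 ^ n + j) = psum n (\<lambda>s. c (PX # s)) i j - \<i> * psum n (\<lambda>s. c (PY # s)) i j"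
    "psum (Suc n) c (2 ^ n + i) j = psum n (\<lambda>s. c (PX # s)) i j + \<i> * psum n (\<lambda>s. c (PY # s)) i j"
    "psum (Suc n) c (2 ^ n + i) (2 ^ n + j) = psum n (\<lambda>s. c (PI # s)) i j - psum n (\<lambda>s. c (PZ # s)) i j"
  unfolding psum_def sum_strings_Suc sum_distrib_left sum.distrib[symmetric] sum_subtractf[symmetric]
  by (intro sum.cong refl,
      simp add: pker_Cons_blocks[OF _ assms] distrib_right left_diff_distrib del: pauli_tensor.simps)+

lemma psum_complete: "\<exists>c. keq (2 ^ n) g (psum n c)"
proof (induction n arbitrary: g)
  case 0
  have "keq (2 ^ 0) g (psum 0 (\<lambda>_. g 0 0))" by (simp add: keq_def psum_def)
  then show ?case by blast
next
  case (Suc n)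
  define N where "N = (2 :: nat) ^ n"
  obtain a where a: "keq N (\<lambda>i j. (g i j + g (N + i) (N + j)) / 2) (psum n a)" using Suc N_def by blast
  obtain x where x: "keq N (\<lambda>i j. (g i (N + j) + g (N + i) j) / 2) (psum n x)" using Suc N_def by blast
  obtain y where y: "keq N (\<lambda>i j. \<i> * (g i (N + j) - g (N + i) j) / 2) (psum n y)" using Suc N_def by blast
  obtain z where z: "keq N (\<lambda>i j. (g i j - g (N + i) (N + j)) / 2) (psum n z)" using Suc N_def by blast
  define c where "c = (\<lambda>s. case s of [] \<Rightarrow> 0 | p # t \<Rightarrow> (case p of PI \<Rightarrow> a t | PX \<Rightarrow> x t | PY \<Rightarrow> y t | PZ \<Rightarrow> z t))"
  have c: "(\<lambda>s. c (PI # s)) = a" "(\<lambda>s. c (PX # s)) = x" "(\<lambda>s. c (PY # s)) = y" "(\<lambda>s. c (PZ # s)) = z"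
    by (auto simp: c_def)
  have "keq (2 ^ Suc n) g (psum (Suc n) c)"
    unfolding keq_def
  proof (intro allI impI)
    fix i j :: nat assume "i < 2 ^ Suc n" "j < 2 ^ Suc n"
    then have ij: "i < 2 * N" "j < 2 * N" by (auto simp: N_def)
    note b = psum_blocks[where c=c and n=n, unfolded c, folded N_def]
    have k: "(g i j + g (N + i) (N + j)) / 2 = psum n a i j" "(g i (N + j) + g (N + i) j) / 2 = psum n x i j"
      "\<i> * (g i (N + j) - g (N + i) j) / 2 = psum n y i j" "(g i j - g (N + i) (N + j)) / 2 = psum n z i j"
      if "i < N" "j < N" for i j
      using that a x y z by (auto simp: keq_def)
    show "g i j = psum (Suc n) c i j"
    proof (cases "i < N"; cases "j < N")
      assume "i < N" "j < N"
      then show ?thesis by (simp add: b k[symmetric] field_simps)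
    next
      assume h: "i < N" "\<not> j < N"
      then obtain j' where "j = N + j'" "j' < N" using ij by (metis add_less_cancel_left le_Suc_ex linorder_not_le mult_2)
      with h show ?thesis by (simp add: b k[symmetric] field_simps)
    next
      assume h: "\<not> i < N" "j < N"
      then obtain i' where "i = N + i'" "i' < N" using ij by (metis add_less_cancel_left le_Suc_ex linorder_not_le mult_2)
      with h show ?thesis by (simp add: b k[symmetric] field_simps)
    next
      assume h: "\<not> i < N" "\<not> j < N"
      then obtain i' j' where "i = N + i'" "i' < N" "j = N + j'" "j' < N"
        using ij by (metis add_less_cancel_left le_Suc_ex linorder_not_le mult_2)
      then show ?thesis by (simp add: b k[symmetric] field_simps)
    qed
  qed
  then show ?case by blast
qed

section \<open>Fourth norms and hypercontractivity\<close>

text \<open>The square of the unnormalised Schatten 4-norm of \<open>f\<close>, written so that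
  neither absolute values nor roots occur.\<close>

abbreviation fourth :: "nat \<Rightarrow> kernel \<Rightarrow> real" where
  "fourth N f \<equiv> hs_norm N (kmult N (kadj f) f)"

lemma hs_adj_mult_sqrt: "hs_norm N (kmult N (kadj f) g) \<le> sqrt (fourth N f * fourth N g)"
  using hs_norm_adj_mult_le[of N f g] by (simp add: real_le_rsqrt)

text \<open>\<open>h\<close> has the shape of one traceless component in
  \<open>fourth_blocks\<close>. The Hoelder inequality bounds its first two products by
  \<open>p\<close> each and its last two by \<open>q\<close> each.\<close>

lemma hs_norm_cross:
  assumes k: "\<And>i j. i < N \<Longrightarrow> j < N \<Longrightarrow>
    h i j = kmult N (kadj a) x i j + kmult N (kadj x) a i j
      + (\<i> * kmult N (kadj y) z i j - \<i> * kmult N (kadj z) y i j)"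
  shows "(hs_norm N h)\<^sup>2 \<le> 8 * (fourth N a * fourth N x) + 8 * (fourth N y * fourth N z)"
proof -
  define p where "p = sqrt (fourth N a * fourth N x)"
  define q where "q = sqrt (fourth N y * fourth N z)"
  have pq: "p\<^sup>2 = fourth N a * fourth N x" "q\<^sup>2 = fourth N y * fourth N z" by (simp_all add: p_def q_def)
  let ?m = "\<lambda>f g. kmult N (kadj f) g"
  have "hs_norm N h = hs_norm N (\<lambda>i j. (?m a x i j + ?m x a i j) + (\<i> * ?m y z i j + (- \<i>) * ?m z y i j))"
    using k by (intro hs_norm_cong) simp
  also have "\<dots> \<le> hs_norm N (\<lambda>i j. ?m a x i j + ?m x a i j) + hs_norm N (\<lambda>i j. \<i> * ?m y z i j + (- \<i>) * ?m z y i j)"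
    by (rule hs_norm_add)
  also have "hs_norm N (\<lambda>i j. ?m a x i j + ?m x a i j) \<le> hs_norm N (?m a x) + hs_norm N (?m x a)"
    by (rule hs_norm_add)
  also have "hs_norm N (\<lambda>i j. \<i> * ?m y z i j + (- \<i>) * ?m z y i j)
      \<le> hs_norm N (\<lambda>i j. \<i> * ?m y z i j) + hs_norm N (\<lambda>i j. (- \<i>) * ?m z y i j)"
    by (rule hs_norm_add)
  also have "hs_norm N (\<lambda>i j. \<i> * ?m y z i j) = hs_norm N (?m y z)"
    by (rule hs_norm_cong) (simp add: norm_mult)
  also have "hs_norm N (\<lambda>i j. (- \<i>) * ?m z y i j) = hs_norm N (?m z y)"
    by (rule hs_norm_cong) (simp add: norm_mult)
  finally have "hs_norm N h \<le> 2 * p + 2 * q"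
    using hs_adj_mult_sqrt[of N a x] hs_adj_mult_sqrt[of N x a] hs_adj_mult_sqrt[of N y z] hs_adj_mult_sqrt[of N z y]
    by (simp add: p_def q_def mult.commute)
  then have "(hs_norm N h)\<^sup>2 \<le> (2 * p + 2 * q)\<^sup>2" by (rule power_mono) simp
  also have "\<dots> \<le> 8 * p\<^sup>2 + 8 * q\<^sup>2"
    using zero_le_power2[of "p - q"] by (simp add: power2_eq_square algebra_simps)
  finally show ?thesis by (simp add: pq)
qed

text \<open>Expanding \<open>f* f\<close> in Pauli matrices of the first qubit, only the cross terms appear in the three
  traceless components; this gives the two-point inequality behind the induction on \<open>n\<close>.\<close>

lemma fourth_blocks:
  assumes "\<And>i j. i < N \<Longrightarrow> j < N \<Longrightarrow> f i j = a i j + z i j"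
    and "\<And>i j. i < N \<Longrightarrow> j < N \<Longrightarrow> f i (N + j) = x i j - \<i> * y i j"
    and "\<And>i j. i < N \<Longrightarrow> j < N \<Longrightarrow> f (N + i) j = x i j + \<i> * y i j"
    and "\<And>i j. i < N \<Longrightarrow> j < N \<Longrightarrow> f (N + i) (N + j) = a i j - z i j"
  shows "fourth (2 * N) f \<le> sqrt 2 * (fourth N a + 5 * (fourth N x + fourth N y + fourth N z))"
proof -
  let ?m = "\<lambda>f g. kmult N (kadj f) g"
  let ?G = "kmult (2 * N) (kadj f) f"
  define A' where "A' = (\<lambda>i j. (?m a a i j + ?m x x i j) + (?m y y i j + ?m z z i j))"
  define X' where "X' = (\<lambda>i j. ?m a x i j + ?m x a i j + (\<i> * ?m y z i j - \<i> * ?m z y i j))"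
  define Y' where "Y' = (\<lambda>i j. ?m a y i j + ?m y a i j + (\<i> * ?m z x i j - \<i> * ?m x z i j))"
  define Z' where "Z' = (\<lambda>i j. ?m a z i j + ?m z a i j + (\<i> * ?m x y i j - \<i> * ?m y x i j))"
  have g: "?G i j = A' i j + Z' i j" "?G i (N + j) = X' i j - \<i> * Y' i j"
      "?G (N + i) j = X' i j + \<i> * Y' i j" "?G (N + i) (N + j) = A' i j - Z' i j"
    if "i < N" "j < N" for i j
    unfolding kmult_def[of "2 * N"] sum_double A'_def X'_def Y'_def Z'_def unfolding kmult_def kadj_def
      sum_distrib_left sum.distrib[symmetric] sum_subtractf[symmetric]
    by (intro sum.cong refl, simp add: assms that, simp add: algebra_simps)+
  \<comment> \<open>The parallelogram law turns the square sum over the four blocks of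
    \<open>?G\<close> into twice the square sum over its Pauli components.\<close>
  have par: "(cmod (p + q))\<^sup>2 + (cmod (p - q))\<^sup>2 = 2 * (cmod p)\<^sup>2 + 2 * (cmod q)\<^sup>2" for p q
    unfolding cmod_power2 by (simp add: power2_eq_square algebra_simps)
  have "(fourth (2 * N) f)\<^sup>2 = (\<Sum>i<N. \<Sum>j<N. 2 * (cmod (A' i j))\<^sup>2 + 2 * (cmod (X' i j))\<^sup>2
      + 2 * (cmod (Y' i j))\<^sup>2 + 2 * (cmod (Z' i j))\<^sup>2)"
    unfolding hs_norm_sq[of "2 * N"] sum_double sum.distrib[symmetric]
  proof (intro sum.cong refl)
    fix i j assume "i \<in> {..<N}" "j \<in> {..<N}"
    then show "(cmod (?G i j))\<^sup>2 + (cmod (?G i (N + j)))\<^sup>2 + ((cmod (?G (N + i) j))\<^sup>2 + (cmod (?G (N + i) (N + j)))\<^sup>2)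
      = 2 * (cmod (A' i j))\<^sup>2 + 2 * (cmod (X' i j))\<^sup>2 + 2 * (cmod (Y' i j))\<^sup>2 + 2 * (cmod (Z' i j))\<^sup>2"
      using par[of "A' i j" "Z' i j"] par[of "X' i j" "\<i> * Y' i j"] by (simp add: g norm_mult)
  qed
  also have "\<dots> = 2 * ((hs_norm N A')\<^sup>2 + (hs_norm N X')\<^sup>2 + (hs_norm N Y')\<^sup>2 + (hs_norm N Z')\<^sup>2)"
    unfolding hs_norm_sq sum_distrib_left sum.distrib distrib_left ..
  also have "\<dots> \<le> 2 * (fourth N a + 5 * (fourth N x + fourth N y + fourth N z))\<^sup>2"
  proof -
    define \<alpha> \<xi> \<eta> \<zeta> where d: "\<alpha> = fourth N a" "\<xi> = fourth N x" "\<eta> = fourth N y" "\<zeta> = fourth N z"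
    have nn: "0 \<le> \<alpha>" "0 \<le> \<xi>" "0 \<le> \<eta>" "0 \<le> \<zeta>" by (auto simp: d)
    have "hs_norm N A' \<le> \<alpha> + \<xi> + (\<eta> + \<zeta>)"
      unfolding A'_def d by (intro order_trans[OF hs_norm_add] add_mono order_trans[OF hs_norm_add] order_refl)
    then have "(hs_norm N A')\<^sup>2 \<le> (\<alpha> + \<xi> + (\<eta> + \<zeta>))\<^sup>2" by (rule power_mono) simp
    note A = this
    have X: "(hs_norm N X')\<^sup>2 \<le> 8 * (\<alpha> * \<xi>) + 8 * (\<eta> * \<zeta>)"
      unfolding d by (rule hs_norm_cross) (simp add: X'_def)
    have Y: "(hs_norm N Y')\<^sup>2 \<le> 8 * (\<alpha> * \<eta>) + 8 * (\<zeta> * \<xi>)"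
      unfolding d by (rule hs_norm_cross) (simp add: Y'_def)
    have Z: "(hs_norm N Z')\<^sup>2 \<le> 8 * (\<alpha> * \<zeta>) + 8 * (\<xi> * \<eta>)"
      unfolding d by (rule hs_norm_cross) (simp add: Z'_def)
    \<comment> \<open>The constant 5 is decided here: the mixed terms with \<open>\<alpha>\<close>
      have coefficient \<open>2 + 8 = 2 * 5\<close>, and the terms without \<open>\<alpha>\<close>
      leave room.\<close>
    have "(\<alpha> + \<xi> + (\<eta> + \<zeta>))\<^sup>2 + (8 * (\<alpha> * \<xi>) + 8 * (\<eta> * \<zeta>)) + (8 * (\<alpha> * \<eta>) + 8 * (\<zeta> * \<xi>))
        + (8 * (\<alpha> * \<zeta>) + 8 * (\<xi> * \<eta>)) \<le> (\<alpha> + 5 * (\<xi> + \<eta> + \<zeta>))\<^sup>2"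
    proof -
      have "0 \<le> 24 * (\<xi>\<^sup>2 + \<eta>\<^sup>2 + \<zeta>\<^sup>2) + 40 * (\<xi> * \<eta> + \<eta> * \<zeta> + \<zeta> * \<xi>)" using nn by simp
      then show ?thesis by (simp add: power2_eq_square algebra_simps)
    qed
    then have "(hs_norm N A')\<^sup>2 + (hs_norm N X')\<^sup>2 + (hs_norm N Y')\<^sup>2 + (hs_norm N Z')\<^sup>2
        \<le> (\<alpha> + 5 * (\<xi> + \<eta> + \<zeta>))\<^sup>2"
      by (rule order_trans[rotated]) (intro add_mono A X Y Z)
    then show ?thesis unfolding d by (rule mult_left_mono) simp
  qed
  also have "\<dots> = (sqrt 2 * (fourth N a + 5 * (fourth N x + fourth N y + fourth N z)))\<^sup>2"
    by (simp add: power_mult_distrib)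
  finally show ?thesis by (rule power2_le_imp_le) simp
qed

text \<open>Induction through \<open>fourth_blocks\<close>: a first letter other than
  \<open>PI\<close> lowers the degree left to the tail by one, which pays for the factor 5. The
  factor \<open>sqrt (2 ^ n)\<close> is due to the unnormalised norms.\<close>

theorem hypercontractivity:
  "(\<And>s. length s = n \<Longrightarrow> c s \<noteq> 0 \<Longrightarrow> weight s \<le> d) \<Longrightarrow>
    fourth (2 ^ n) (psum n c) \<le> sqrt (2 ^ n) * 5 ^ d * (\<Sum>s | length s = n. (cmod (c s))\<^sup>2)"
proof (induction n arbitrary: c d)
  case 0
  have "fourth 1 (psum 0 c) = (cmod (c []))\<^sup>2"
    by (simp add: hs_norm_def L2_set_def kmult_def kadj_def psum_def norm_mult power2_eq_square lessThan_Suc)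
  moreover have "(cmod (c []))\<^sup>2 \<le> 5 ^ d * (cmod (c []))\<^sup>2"
    using mult_right_mono[of 1 "5 ^ d" "(cmod (c []))\<^sup>2"] by simp
  ultimately show ?case by simp
next
  case (Suc n)
  let ?N = "2 ^ n :: nat"
  let ?c = "\<lambda>p s. c (p # s)"
  define S where "S = (\<lambda>p. \<Sum>s | length s = n. (cmod (c (p # s)))\<^sup>2)"
  have S0: "0 \<le> S p" for p by (auto simp: S_def intro!: sum_nonneg)
  have I: "fourth ?N (psum n (?c PI)) \<le> sqrt (2 ^ n) * 5 ^ d * S PI"
    unfolding S_def by (rule Suc.IH) (use Suc.prems[of "PI # _"] in auto)
  have O: "5 * fourth ?N (psum n (?c p)) \<le> sqrt (2 ^ n) * 5 ^ d * S p" if p: "p \<noteq> PI" for p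
  proof (cases d)
    \<comment> \<open>A nontrivial first letter has positive weight, so in degree 0 these components
      vanish.\<close>
    case 0
    have "c (p # s) = 0" if "length s = n" for s using Suc.prems[of "p # s"] that p 0 by auto
    then have "fourth ?N (psum n (?c p)) \<le> sqrt (2 ^ n) * 5 ^ 0 * 0 \<and> S p = 0"
      using Suc.IH[of "?c p" 0] by (auto simp: S_def)
    then show ?thesis by simp
  next
    case (Suc d')
    have "fourth ?N (psum n (?c p)) \<le> sqrt (2 ^ n) * 5 ^ d' * S p"
      unfolding S_def by (rule Suc.IH) (use Suc.prems[of "p # _"] p Suc in auto)
    then show ?thesis by (simp add: Suc)
  qed
  have "fourth (2 * ?N) (psum (Suc n) c) \<le> sqrt 2 * (fourth ?N (psum n (?c PI))
      + 5 * (fourth ?N (psum n (?c PX)) + fourth ?N (psum n (?c PY)) + fourth ?N (psum n (?c PZ))))"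
    by (rule fourth_blocks) (auto simp: psum_blocks)
  also have "\<dots> \<le> sqrt 2 * (sqrt (2 ^ n) * 5 ^ d * (S PI + S PX + S PY + S PZ))"
    using I O[of PX] O[of PY] O[of PZ] by (intro mult_left_mono) (auto simp: algebra_simps)
  also have "\<dots> = sqrt (2 ^ Suc n) * 5 ^ d * (\<Sum>s | length s = Suc n. (cmod (c s))\<^sup>2)"
    by (simp add: sum_strings_Suc sum.distrib S_def real_sqrt_mult)
  finally show ?case by simp
qed

section \<open>Influences of quantum Boolean functions\<close>

lemma pauli_comb_carrier [simp]: "pauli_comb n c \<in> carrier_mat (2 ^ n) (2 ^ n)"
  by (simp add: pauli_comb_def)

lemma pauli_mat_hermitian: "b < 2 \<Longrightarrow> b' < 2 \<Longrightarrow> pauli_mat p $$ (b', b) = cnj (pauli_mat p $$ (b, b'))"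
proof -
  assume "b < 2" "b' < 2"
  then have "b = 0 \<or> b = Suc 0" "b' = 0 \<or> b' = Suc 0" by auto
  then show ?thesis by (cases p) auto
qed

lemma pker_hermitian: "i < 2 ^ length s \<Longrightarrow> j < 2 ^ length s \<Longrightarrow> pker s j i = cnj (pker s i j)"
proof (induction s arbitrary: i j)
  case (Cons p s)
  let ?N = "2 ^ length s :: nat"
  have "pauli_mat p $$ (j div ?N, i div ?N) = cnj (pauli_mat p $$ (i div ?N, j div ?N))"
    using Cons.prems by (intro pauli_mat_hermitian) (auto simp: less_mult_imp_div_less)
  moreover have "pker s (j mod ?N) (i mod ?N) = cnj (pker s (i mod ?N) (j mod ?N))"
    by (rule Cons.IH) auto
  ultimately show ?case using Cons.prems by (simp add: kron_def)
qed auto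

abbreviation real_comb :: "nat \<Rightarrow> (pauli list \<Rightarrow> real) \<Rightarrow> complex mat" where
  "real_comb n c \<equiv> pauli_comb n (\<lambda>s. complex_of_real (c s))"

lemma psum_real_hermitian:
  assumes "i < 2 ^ n" "j < 2 ^ n"
  shows "psum n (\<lambda>s. complex_of_real (c s)) j i = cnj (psum n (\<lambda>s. complex_of_real (c s)) i j)"
  unfolding psum_def cnj_sum using assms
  by (intro sum.cong refl) (auto simp: pker_hermitian[of i _ j])

lemma real_comb_hermitian: "mat_adjoint (real_comb n c) = real_comb n c"
proof (rule eq_matI)
  fix i j assume "i < dim_row (real_comb n c)" "j < dim_col (real_comb n c)"
  then have ij: "i < 2 ^ n" "j < 2 ^ n" by (auto simp: pauli_comb_def)
  have "ker (real_comb n c) j i = cnj (ker (real_comb n c) i j)"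
    using pauli_comb_ker[of n "\<lambda>s. of_real (c s)"] ij psum_real_hermitian[OF ij, of c] by (simp add: keq_def)
  then show "mat_adjoint (real_comb n c) $$ (i, j) = real_comb n c $$ (i, j)"
    using ij by (simp add: carrier_matD[OF pauli_comb_carrier])
qed (auto simp: pauli_comb_def)

lemma hs_norm_keq: "keq N f g \<Longrightarrow> hs_norm N f = hs_norm N g"
  by (rule hs_norm_cong) (auto simp: keq_def)

lemma hs_norm_real_comb: "hs_norm (2 ^ n) (ker (real_comb n c)) = sqrt (2 ^ n * (\<Sum>s | length s = n. (c s)\<^sup>2))"
proof -
  have "(hs_norm (2 ^ n) (ker (real_comb n c)))\<^sup>2 = 2 ^ n * (\<Sum>s | length s = n. (c s)\<^sup>2)"
    unfolding hs_norm_keq[OF pauli_comb_ker] psum_parseval by simp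
  then show ?thesis by (metis hs_norm_nonneg real_sqrt_unique)
qed

lemma schatten_2_real_comb: "schatten_norm n 2 (real_comb n c) = sqrt (\<Sum>s | length s = n. (c s)\<^sup>2)"
  unfolding schatten_2[OF pauli_comb_carrier real_comb_hermitian] hs_norm_real_comb
  by (simp add: real_sqrt_mult)

text \<open>The operator is tested against its own low-degree part \<open>?f\<close>. The trace of
  the product is \<open>2 ^ n * W\<close>, duality bounds its square, and hypercontractivity bounds
  the fourth norm of \<open>?f\<close> by a multiple of \<open>W\<close>, so that one factor
  \<open>W\<close> cancels.\<close>

lemma low_degree_duality:
  "(\<Sum>s | length s = n \<and> weight s \<le> d. (c s)\<^sup>2)
    \<le> 5 ^ d * sqrt (\<Sum>s | length s = n. (c s)\<^sup>2) * schatten_norm n 1 (real_comb n c)"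
proof -
  let ?N = "2 ^ n :: nat"
  define L where "L = schatten_norm n 1 (real_comb n c)"
  define Q where "Q = (\<Sum>s | length s = n. (c s)\<^sup>2)"
  define c' where "c' = (\<lambda>s. if weight s \<le> d then c s else 0)"
  define W where "W = (\<Sum>s | length s = n \<and> weight s \<le> d. (c s)\<^sup>2)"
  have W: "W = (\<Sum>s | length s = n. (c' s)\<^sup>2)" "W = (\<Sum>s | length s = n. c' s * c s)"
    unfolding W_def c'_def
    by (rule sum.mono_neutral_cong_left; auto simp: power2_eq_square)+
  let ?f = "psum n (\<lambda>s. complex_of_real (c' s))"
  have W0: "0 \<le> W" "0 \<le> Q" by (auto simp: W_def Q_def intro: sum_nonneg)
  have L0: "0 \<le> L" unfolding L_def by (rule schatten_1_duality(1)[OF pauli_comb_carrier real_comb_hermitian])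
  have fo: "fourth ?N ?f \<le> sqrt (2 ^ n) * 5 ^ d * W"
    using hypercontractivity[of n "\<lambda>s. complex_of_real (c' s)" d] unfolding W by (simp add: c'_def split: if_splits)
  have "(\<Sum>i<?N. \<Sum>j<?N. ?f j i * ker (real_comb n c) i j)
      = (\<Sum>i<?N. \<Sum>j<?N. cnj (?f i j) * psum n (\<lambda>s. complex_of_real (c s)) i j)"
  proof (intro sum.cong refl)
    fix i j assume "i \<in> {..<?N}" "j \<in> {..<?N}"
    then have "ker (real_comb n c) i j = psum n (\<lambda>s. complex_of_real (c s)) i j" "?f j i = cnj (?f i j)"
      using pauli_comb_ker[of n "\<lambda>s. of_real (c s)"] psum_real_hermitian[of i n j c'] by (auto simp: keq_def)
    then show "?f j i * ker (real_comb n c) i j = cnj (?f i j) * psum n (\<lambda>s. complex_of_real (c s)) i j"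
      by (simp only:)
  qed
  also have "\<dots> = of_real (2 ^ n * W)" unfolding psum_inner W(2) by simp
  finally have t: "(\<Sum>i<?N. \<Sum>j<?N. ?f j i * ker (real_comb n c) i j) = of_real (2 ^ n * W)" .
  have "(2 ^ n * W)\<^sup>2 \<le> fourth ?N ?f * hs_norm ?N (ker (real_comb n c)) * (2 ^ n * L)"
    using schatten_1_duality(2)[OF pauli_comb_carrier[of n] real_comb_hermitian[of n c], where f = ?f]
    unfolding L_def t norm_of_real power2_abs .
  also have "\<dots> \<le> (sqrt (2 ^ n) * 5 ^ d * W) * sqrt (2 ^ n * Q) * (2 ^ n * L)"
    using fo L0 W0 unfolding hs_norm_real_comb Q_def[symmetric] by (intro mult_right_mono) auto
  also have "\<dots> = (2 ^ n)\<^sup>2 * (W * (5 ^ d * sqrt Q * L))"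
  proof -
    have "sqrt (2 ^ n) * sqrt (2 ^ n) = (2 :: real) ^ n" by simp
    then show ?thesis by (simp add: real_sqrt_mult power2_eq_square algebra_simps)
  qed
  finally have "(2 ^ n)\<^sup>2 * (W * W) \<le> (2 ^ n)\<^sup>2 * (W * (5 ^ d * sqrt Q * L))"
    by (simp only: power_mult_distrib power2_eq_square[of W])
  then have "W * W \<le> W * (5 ^ d * sqrt Q * L)" by (rule mult_left_le_imp_le) simp
  then have "W \<le> 5 ^ d * sqrt Q * L"
    using W0 L0 by (cases "W = 0") auto
  then show ?thesis by (simp add: W_def Q_def L_def)
qed

section \<open>Derivatives in the Pauli basis\<close>

lemma kron_assoc: "kron (kron A B) C = kron A (kron B C)"
proof (rule eq_matI)
  fix i j assume ij: "i < dim_row (kron A (kron B C))" "j < dim_col (kron A (kron B C))"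
  have d: "i div c < a * b" "i mod (b * c) < b * c" "c > 0" if "i < a * (b * c)" for i a b c :: nat
  proof -
    have "0 < b * c" using that by (cases "b * c = 0") auto
    then show "i mod (b * c) < b * c" "c > 0" by auto
    show "i div c < a * b" using that by (simp add: less_mult_imp_div_less mult.assoc)
  qed
  have e: "i div c div b = i div (b * c)" "i div c mod b = i mod (b * c) div c" "i mod (b * c) mod c = i mod c"
    if "c > 0" for i b c :: nat
  proof -
    have "i mod (b * c) = c * (i div c mod b) + i mod c"
      unfolding mult.commute[of b c] by (rule mod_mult2_eq)
    then show "i div c mod b = i mod (b * c) div c" "i mod (b * c) mod c = i mod c" using that by simp_all
    show "i div c div b = i div (b * c)" unfolding mult.commute[of b c] by (rule div_mult2_eq[symmetric])
  qed
  have i: "i < dim_row A * (dim_row B * dim_row C)" and j: "j < dim_col A * (dim_col B * dim_col C)"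
    using ij by auto
  show "kron (kron A B) C $$ (i, j) = kron A (kron B C) $$ (i, j)"
    using d[OF i] d[OF j] i j e[of "dim_row C" i "dim_row B"] e[of "dim_col C" j "dim_col B"]
    by (simp add: kron_def mult.assoc)
qed (auto simp: mult.assoc)

lemma kron_one_left: "kron (1\<^sub>m 1) A = A"
  by (rule eq_matI) (auto simp: kron_def)

lemma pauli_tensor_append: "pauli_tensor (s @ t) = kron (pauli_tensor s) (pauli_tensor t)"
  by (induction s) (auto simp: kron_assoc kron_one_left[simplified])

lemma pauli_tensor_carrier: "length s = m \<Longrightarrow> pauli_tensor s \<in> carrier_mat (2 ^ m) (2 ^ m)"
  by (auto intro: carrier_matI)

lemma pauli_tensor_identity: "pauli_tensor (replicate n PI) = 1\<^sub>m (2 ^ n)"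
proof (induction n)
  case (Suc n)
  have pI: "pauli_mat PI $$ (b, b') = (if b = b' then 1 else 0)" if "b < 2" "b' < 2" for b b'
    using that by (cases b; cases b') auto
  show ?case
  proof (rule eq_matI)
    fix i j assume ij: "i < dim_row (1\<^sub>m (2 ^ Suc n) :: complex mat)" "j < dim_col (1\<^sub>m (2 ^ Suc n) :: complex mat)"
    then have "i div 2 ^ n < 2" "j div 2 ^ n < 2" by (auto simp: less_mult_imp_div_less)
    moreover have "i = j \<longleftrightarrow> i div 2 ^ n = j div 2 ^ n \<and> i mod 2 ^ n = j mod 2 ^ n"
      by (metis div_mult_mod_eq)
    ultimately show "pauli_tensor (replicate (Suc n) PI) $$ (i, j) = 1\<^sub>m (2 ^ Suc n) $$ (i, j)"
      using ij Suc by (simp add: kron_def pI)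
  qed auto
qed auto

lemma power_split_qubit:
  assumes "1 \<le> j" "j \<le> n"
  shows "2 ^ (j - 1) * (2 * 2 ^ (n - j)) = (2 :: nat) ^ n"
proof -
  have "n = (j - 1) + Suc (n - j)" using assms by simp
  then have "(2 :: nat) ^ n = 2 ^ ((j - 1) + Suc (n - j))" by (rule arg_cong)
  then show ?thesis unfolding power_add power_Suc by (rule sym)
qed

text \<open>Cutting the string at letter \<open>j\<close> gives the triple product to which
  \<open>on_qubit_kron\<close> applies; the one-qubit map kills \<open>PI\<close> and fixes the
  three traceless matrices.\<close>

lemma deriv_pauli_tensor:
  assumes s: "length s = n" and j: "1 \<le> j" "j \<le> n"
  shows "deriv_qubit n j (pauli_tensor s) = (if s ! (j - 1) = PI then 0\<^sub>m (2 ^ n) (2 ^ n) else pauli_tensor s)"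
proof -
  let ?T = "\<lambda>X :: complex mat. X - (mtrace X / 2) \<cdot>\<^sub>m 1\<^sub>m 2"
  let ?p = "s ! (j - 1)"
  let ?X = "pauli_tensor (take (j - 1) s)" and ?Z = "pauli_tensor (drop j s)"
  have "s = take (j - 1) s @ ?p # drop j s" using id_take_nth_drop[of "j - 1" s] s j by simp
  then have "pauli_tensor s = pauli_tensor (take (j - 1) s @ ?p # drop j s)" by (rule arg_cong)
  then have e: "pauli_tensor s = kron ?X (kron (pauli_mat ?p) ?Z)"
    by (simp only: pauli_tensor_append pauli_tensor.simps(2))
  have "deriv_qubit n j (pauli_tensor s) = kron ?X (kron (?T (pauli_mat ?p)) ?Z)"
    unfolding e deriv_qubit_def
  proof (rule on_qubit_kron)
    fix c and M :: "complex mat" assume "M \<in> carrier_mat 2 2"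
    then show "?T (c \<cdot>\<^sub>m M) = c \<cdot>\<^sub>m ?T M"
      by (intro eq_matI) (auto simp: mtrace_def sum_distrib_left[symmetric] algebra_simps)
  qed (use s j in \<open>auto intro!: pauli_tensor_carrier\<close>)
  also have "?T (pauli_mat ?p) = (if ?p = PI then 0\<^sub>m 2 2 else pauli_mat ?p)"
  proof (rule eq_matI)
    fix b b' assume "b < dim_row (if ?p = PI then 0\<^sub>m 2 2 else pauli_mat ?p)" "b' < dim_col (if ?p = PI then 0\<^sub>m 2 2 else pauli_mat ?p)"
    then have "b = 0 \<or> b = Suc 0" "b' = 0 \<or> b' = Suc 0" by (auto split: if_splits)
    then show "?T (pauli_mat ?p) $$ (b, b') = (if ?p = PI then 0\<^sub>m 2 2 else pauli_mat ?p) $$ (b, b')"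
      by (cases ?p) (auto simp: mtrace_def numeral_2_eq_2)
  qed auto
  also have "kron ?X (kron (if ?p = PI then 0\<^sub>m 2 2 else pauli_mat ?p) ?Z)
      = (if ?p = PI then 0\<^sub>m (2 ^ n) (2 ^ n) else pauli_tensor s)"
  proof (cases "?p = PI")
    case True
    note n = power_split_qubit[OF j]
    show ?thesis using True s j n
      by (intro eq_matI) (auto simp: kron_def less_mult_imp_div_less)
  qed (simp add: e)
  finally show ?thesis .
qed

lemma set_qubit_less:
  assumes "i < 2 ^ n" "b < 2" "1 \<le> j" "j \<le> n"
  shows "set_qubit n j i b < 2 ^ n"
proof -
  let ?m = "(2 :: nat) ^ (n - j)"
  note n = power_split_qubit[OF assms(3,4), symmetric]
  have "i div (2 * ?m) < 2 ^ (j - 1)" using assms(1) unfolding n by (rule less_mult_imp_div_less)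
  then have "Suc (i div (2 * ?m)) * (2 * ?m) \<le> 2 ^ (j - 1) * (2 * ?m)" by (intro mult_right_mono) auto
  moreover have "b * ?m \<le> 1 * ?m" using assms(2) by (intro mult_right_mono) auto
  moreover have "i mod ?m < ?m" by simp
  moreover have "2 ^ (n - j + 1) = 2 * ?m" by simp
  ultimately show ?thesis unfolding set_qubit_def n by (simp only: mult_1 mult_Suc)
qed

text \<open>The formula is linear in the entries of \<open>A\<close>, which is how
  \<open>deriv_pauli_comb\<close> passes from single strings to sums.\<close>

lemma deriv_entry:
  assumes "i < 2 ^ n" "i' < 2 ^ n"
  shows "deriv_qubit n j A $$ (i, i') = A $$ (set_qubit n j i (get_qubit n j i), set_qubit n j i' (get_qubit n j i'))
    - (A $$ (set_qubit n j i 0, set_qubit n j i' 0) + A $$ (set_qubit n j i 1, set_qubit n j i' 1)) / 2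
      * (if get_qubit n j i = get_qubit n j i' then 1 else 0)"
proof -
  have "get_qubit n j i < 2" "get_qubit n j i' < 2" by (auto simp: get_qubit_def)
  then show ?thesis using assms
    by (auto simp: deriv_qubit_def on_qubit_def mtrace_def numeral_2_eq_2)
qed

lemma deriv_dim [simp]: "dim_row (deriv_qubit n j A) = 2 ^ n" "dim_col (deriv_qubit n j A) = 2 ^ n"
  by (simp_all add: deriv_qubit_def on_qubit_def)

lemma deriv_pauli_comb:
  assumes j: "1 \<le> j" "j \<le> n"
  shows "deriv_qubit n j (pauli_comb n c) = pauli_comb n (\<lambda>s. if s ! (j - 1) = PI then 0 else c s)"
proof (rule eq_matI)
  fix i i' assume "i < dim_row (pauli_comb n (\<lambda>s. if s ! (j - 1) = PI then 0 else c s))"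
    "i' < dim_col (pauli_comb n (\<lambda>s. if s ! (j - 1) = PI then 0 else c s))"
  then have i: "i < 2 ^ n" "i' < 2 ^ n" by (auto simp: pauli_comb_def)
  have g: "get_qubit n j i < 2" "get_qubit n j i' < 2" by (auto simp: get_qubit_def)
  have one_less_2: "(1 :: nat) < 2" by simp
  note sl = set_qubit_less[OF i(1) _ j] set_qubit_less[OF i(2) _ j]
  have pc: "pauli_comb n c $$ (a, b) = (\<Sum>s | length s = n. c s * pker s a b)" if "a < 2 ^ n" "b < 2 ^ n" for a b
    using that by (simp add: pauli_comb_def)
  have lin: "(\<Sum>s\<in>S. c s * X s) - ((\<Sum>s\<in>S. c s * Y s) + (\<Sum>s\<in>S. c s * Z s)) / 2 * e
      = (\<Sum>s\<in>S. c s * (X s - (Y s + Z s) / 2 * e))" for S :: "pauli list set" and X Y Z and e :: complex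
  proof -
    have "(\<Sum>s\<in>S. c s * (X s - (Y s + Z s) / 2 * e)) = (\<Sum>s\<in>S. c s * X s - (c s * Y s + c s * Z s) / 2 * e)"
      by (intro sum.cong refl) (simp add: ring_distribs add_divide_distrib mult.assoc)
    also have "\<dots> = (\<Sum>s\<in>S. c s * X s) - (\<Sum>s\<in>S. c s * Y s + c s * Z s) / 2 * e"
      unfolding sum_subtractf sum_distrib_right[symmetric] sum_divide_distrib[symmetric] ..
    finally show ?thesis unfolding sum.distrib by (rule sym)
  qed
  have "deriv_qubit n j (pauli_comb n c) $$ (i, i') = (\<Sum>s | length s = n. c s * deriv_qubit n j (pauli_tensor s) $$ (i, i'))"
    unfolding deriv_entry[OF i] pc[OF sl(1)[OF g(1)] sl(2)[OF g(2)]]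
      pc[OF sl(1)[of 0] sl(2)[of 0], OF pos2 pos2] pc[OF sl(1)[of 1] sl(2)[of 1], OF one_less_2 one_less_2]
    by (rule lin)
  also have "\<dots> = (\<Sum>s | length s = n. (if s ! (j - 1) = PI then 0 else c s) * pker s i i')"
  proof (rule sum.cong[OF refl])
    fix s :: "pauli list" assume "s \<in> {s. length s = n}"
    then have l: "length s = n" by simp
    show "c s * deriv_qubit n j (pauli_tensor s) $$ (i, i') = (if s ! (j - 1) = PI then 0 else c s) * pker s i i'"
      unfolding deriv_pauli_tensor[OF l j] using i by simp
  qed
  also have "\<dots> = pauli_comb n (\<lambda>s. if s ! (j - 1) = PI then 0 else c s) $$ (i, i')"
    using i by (simp add: pauli_comb_def)
  finally show "deriv_qubit n j (pauli_comb n c) $$ (i, i')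
      = pauli_comb n (\<lambda>s. if s ! (j - 1) = PI then 0 else c s) $$ (i, i')" .
qed (simp_all only: deriv_dim carrier_matD[OF pauli_comb_carrier])

text \<open>By hermiticity the Pauli sum with coefficients \<open>z s - cnj (z s)\<close> vanishes,
  so Parseval makes every \<open>z s\<close> real. The squares sum to 1 since the trace of
  \<open>A * A\<close> is \<open>2 ^ n\<close>.\<close>

lemma quantum_boolean_expansion:
  assumes "quantum_boolean n A"
  obtains c where "A = real_comb n c" "(\<Sum>s | length s = n. (c s)\<^sup>2) = 1"
proof -
  let ?N = "2 ^ n :: nat" and ?S = "{s :: pauli list. length s = n}"
  have A: "A \<in> carrier_mat ?N ?N" "mat_adjoint A = A" "A * A = 1\<^sub>m ?N"
    using assms by (auto simp: quantum_boolean_def)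
  obtain z where z: "keq ?N (ker A) (psum n z)" using psum_complete by blast
  have h: "kherm ?N (ker A)" using ker_adjoint[OF A(1)] A(2) by (auto simp: kherm_def intro: keq_sym)
  have "hs_norm ?N (psum n (\<lambda>s. z s - cnj (z s))) = hs_norm ?N (\<lambda>i j. 0)"
  proof (rule hs_norm_keq)
    show "keq ?N (psum n (\<lambda>s. z s - cnj (z s))) (\<lambda>i j. 0)"
      unfolding keq_def
    proof (intro allI impI)
      fix i j assume ij: "i < ?N" "j < ?N"
      have "psum n (\<lambda>s. cnj (z s)) i j = cnj (psum n z j i)"
        unfolding psum_def cnj_sum using ij by (intro sum.cong refl) (auto simp: pker_hermitian[of i _ j])
      also have "\<dots> = psum n z i j" using z h ij by (auto simp: keq_def kherm_def kadj_def)
      finally show "psum n (\<lambda>s. z s - cnj (z s)) i j = 0"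
        by (simp add: psum_def left_diff_distrib sum_subtractf)
    qed
  qed
  also have "\<dots> = 0" by (simp add: hs_norm_def L2_set_def)
  finally have "(\<Sum>s\<in>?S. (cmod (z s - cnj (z s)))\<^sup>2) = 0" using psum_parseval[of n "\<lambda>s. z s - cnj (z s)"] by simp
  then have "(cmod (z s - cnj (z s)))\<^sup>2 = 0" if "s \<in> ?S" for s
    using that by (subst (asm) sum_nonneg_eq_0_iff) auto
  then have zr: "complex_of_real (Re (z s)) = z s" if "length s = n" for s
    using that by (simp add: complex_eq_iff)
  define c where "c = (\<lambda>s. Re (z s))"
  have zc: "keq ?N (psum n z) (psum n (\<lambda>s. complex_of_real (c s)))"
    unfolding keq_def psum_def c_def by (auto intro!: sum.cong simp: zr)
  have "keq ?N (ker A) (ker (real_comb n c))"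
    by (rule keq_trans[OF z keq_trans[OF zc keq_sym[OF pauli_comb_ker]]])
  then have Ac: "A = real_comb n c" unfolding ker_eq_iff[OF A(1) pauli_comb_carrier] .
  have "complex_of_real ((hs_norm ?N (ker A))\<^sup>2) = (\<Sum>i<?N. kmult ?N (ker A) (ker A) i i)"
    by (rule hs_norm_sq_herm[OF h])
  also have "\<dots> = (\<Sum>i<?N. ker (A * A) i i)"
    using ker_mult[OF A(1) A(1)] by (intro sum.cong refl) (auto simp: keq_def)
  also have "\<dots> = 2 ^ n" unfolding A(3) by simp
  finally have "complex_of_real ((hs_norm ?N (ker A))\<^sup>2) = complex_of_real (2 ^ n)" by simp
  then have "(hs_norm ?N (ker A))\<^sup>2 = 2 ^ n" by (simp only: of_real_eq_iff)
  then have "2 ^ n * (\<Sum>s\<in>?S. (c s)\<^sup>2) = 2 ^ n"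
    unfolding Ac hs_norm_real_comb by (simp add: sum_nonneg)
  then show ?thesis using Ac that by simp
qed

lemma real_comb_deriv:
  assumes "1 \<le> j" "j \<le> n"
  shows "deriv_qubit n j (real_comb n c) = real_comb n (\<lambda>s. if s ! (j - 1) = PI then 0 else c s)"
  unfolding deriv_pauli_comb[OF assms] by (rule arg_cong[where f = "pauli_comb n"]) auto

section \<open>Influences and approximation by juntas\<close>

text \<open>The squared normalised 2-norm of the derivative at qubit \<open>j\<close>, that is, the
  contribution of this qubit to the second influence.\<close>

definition local_var :: "nat \<Rightarrow> (pauli list \<Rightarrow> real) \<Rightarrow> nat \<Rightarrow> real" where
  "local_var n c j = (\<Sum>s | length s = n \<and> s ! (j - 1) \<noteq> PI. (c s)\<^sup>2)"

lemma deriv_sum_sq: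
  "(\<Sum>s | length s = n. (if s ! (j - 1) = PI then 0 else c s)\<^sup>2) = local_var n c j" for c :: "pauli list \<Rightarrow> real"
  unfolding local_var_def by (rule sum.mono_neutral_cong_right) auto

text \<open>Exchanging the sums counts each string once per nontrivial letter. The first form serves
  Cauchy-Schwarz over the qubits, the second Markov's inequality for the weight.\<close>

lemma influence_2:
  "influence n 2 (real_comb n c) = (\<Sum>j = 1..n. local_var n c j)"
  "influence n 2 (real_comb n c) = (\<Sum>s | length s = n. real (weight s) * (c s)\<^sup>2)"
proof -
  show 1: "influence n 2 (real_comb n c) = (\<Sum>j = 1..n. local_var n c j)"
    unfolding influence_def
  proof (rule sum.cong[OF refl])
    fix j assume "j \<in> {1..n}"
    then have j: "1 \<le> j" "j \<le> n" by auto
    show "(schatten_norm n 2 (deriv_qubit n j (real_comb n c)))\<^sup>2 = local_var n c j"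
      unfolding real_comb_deriv[OF j] schatten_2_real_comb deriv_sum_sq
      by (simp add: local_var_def sum_nonneg)
  qed
  have "(\<Sum>j = 1..n. local_var n c j) = (\<Sum>j = 1..n. \<Sum>s | length s = n. (if s ! (j - 1) = PI then 0 else 1) * (c s)\<^sup>2)"
    unfolding deriv_sum_sq[symmetric] by (intro sum.cong refl) auto
  also have "\<dots> = (\<Sum>s | length s = n. (\<Sum>j = 1..n. (if s ! (j - 1) = PI then 0 else 1)) * (c s)\<^sup>2)"
    unfolding sum_distrib_right by (rule sum.swap)
  also have "\<dots> = (\<Sum>s | length s = n. real (weight s) * (c s)\<^sup>2)"
  proof (intro sum.cong refl arg_cong2[where f = "(*)"])
    fix s :: "pauli list" assume "s \<in> {s. length s = n}"
    then have l: "length s = n" by simp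
    have "(\<Sum>j = 1..n. (if s ! (j - 1) = PI then 0 else 1 :: real)) = (\<Sum>i<n. (if s ! i = PI then 0 else 1))"
      by (rule sum.reindex_bij_witness[of _ Suc "\<lambda>j. j - 1"]) auto
    also have "\<dots> = (\<Sum>i | i < n \<and> s ! i \<noteq> PI. 1)"
      by (rule sum.mono_neutral_cong_right) auto
    also have "\<dots> = real (weight s)" unfolding weight_def length_filter_conv_card l by simp
    finally show "(\<Sum>j = 1..n. (if s ! (j - 1) = PI then 0 else 1 :: real)) = real (weight s)" .
  qed
  finally show "influence n 2 (real_comb n c) = (\<Sum>s | length s = n. real (weight s) * (c s)\<^sup>2)"
    unfolding 1 .
qed

definition deriv_L1 :: "nat \<Rightarrow> (pauli list \<Rightarrow> real) \<Rightarrow> nat \<Rightarrow> real" where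
  "deriv_L1 n c j = schatten_norm n 1 (deriv_qubit n j (real_comb n c))"

lemma influence_1: "influence n 1 (real_comb n c) = (\<Sum>j = 1..n. deriv_L1 n c j)"
  by (simp add: influence_def deriv_L1_def)

lemma deriv_L1_nonneg: "1 \<le> j \<Longrightarrow> j \<le> n \<Longrightarrow> 0 \<le> deriv_L1 n c j"
  unfolding deriv_L1_def real_comb_deriv by (rule schatten_1_duality(1)[OF pauli_comb_carrier real_comb_hermitian])

lemma local_var_nonneg: "0 \<le> local_var n c j"
  by (simp add: local_var_def sum_nonneg)

lemma deriv_low_degree:
  assumes "1 \<le> j" "j \<le> n"
  shows "(\<Sum>s | length s = n \<and> weight s \<le> d \<and> s ! (j - 1) \<noteq> PI. (c s)\<^sup>2)
    \<le> 5 ^ d * sqrt (local_var n c j) * deriv_L1 n c j"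
proof -
  let ?c = "\<lambda>s. if s ! (j - 1) = PI then 0 else c s"
  have "(\<Sum>s | length s = n \<and> weight s \<le> d \<and> s ! (j - 1) \<noteq> PI. (c s)\<^sup>2)
      = (\<Sum>s | length s = n \<and> weight s \<le> d. (?c s)\<^sup>2)"
    by (rule sum.mono_neutral_cong_left) auto
  also have "\<dots> \<le> 5 ^ d * sqrt (local_var n c j) * deriv_L1 n c j"
    using low_degree_duality[where n = n and d = d and c = ?c] unfolding deriv_sum_sq deriv_L1_def real_comb_deriv[OF assms] .
  finally show ?thesis .
qed

text \<open>Markov's inequality for the weight, with the squared coefficients as measure.\<close>

lemma high_degree_mass:
  "(\<Sum>s | length s = n \<and> d < weight s. (c s)\<^sup>2) * real (Suc d) \<le> (\<Sum>s | length s = n. real (weight s) * (c s)\<^sup>2)"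
proof -
  have "(\<Sum>s | length s = n \<and> d < weight s. (c s)\<^sup>2) * real (Suc d) = (\<Sum>s | length s = n \<and> d < weight s. real (Suc d) * (c s)\<^sup>2)"
    unfolding sum_distrib_right by (simp add: mult.commute)
  also have "\<dots> \<le> (\<Sum>s | length s = n \<and> d < weight s. real (weight s) * (c s)\<^sup>2)"
    by (intro sum_mono mult_right_mono) auto
  also have "\<dots> \<le> (\<Sum>s | length s = n. real (weight s) * (c s)\<^sup>2)"
    by (rule sum_mono2) auto
  finally show ?thesis .
qed

lemma sum_UN_le:
  fixes f :: "'b \<Rightarrow> real"
  assumes "finite I" "\<And>i. i \<in> I \<Longrightarrow> finite (B i)" "\<And>x. 0 \<le> f x"
  shows "(\<Sum>x\<in>(\<Union>i\<in>I. B i). f x) \<le> (\<Sum>i\<in>I. \<Sum>x\<in>B i. f x)"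
  using assms(1,2)
proof (induction I rule: finite_induct)
  case (insert i I)
  have "(\<Sum>x\<in>(\<Union>i\<in>insert i I. B i). f x) \<le> (\<Sum>x\<in>B i. f x) + (\<Sum>x\<in>(\<Union>i\<in>I. B i). f x)"
    using insert assms(3) by (simp add: sum_Un sum_nonneg)
  then show ?case using insert by simp
qed simp

text \<open>Friedgut's argument: low-degree Fourier mass at a qubit of small \<open>L\<^sup>1\<close> influence is controlled by
  duality with the hypercontractive estimate, and the high-degree mass by the total influence.\<close>

lemma junta_approximation:
  fixes n :: nat and c :: "pauli list \<Rightarrow> real" and \<tau> :: real
  assumes "0 < \<tau>"
  defines "J \<equiv> {j \<in> {1..n}. \<tau> \<le> deriv_L1 n c j}"
    and "I1 \<equiv> influence n 1 (real_comb n c)" and "I2 \<equiv> influence n 2 (real_comb n c)"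
  shows "(\<Sum>s | length s = n \<and> (\<exists>j\<in>{1..n} - J. s ! (j - 1) \<noteq> PI). (c s)\<^sup>2)
      \<le> I2 / real (Suc d) + 5 ^ d * sqrt (\<tau> * I1 * I2)"
    and "real (card J) * \<tau> \<le> I1"
proof -
  let ?a = "deriv_L1 n c" and ?b = "local_var n c"
  have a0: "0 \<le> ?a j" if "j \<in> {1..n}" for j using that deriv_L1_nonneg by auto
  have I1: "I1 = (\<Sum>j = 1..n. ?a j)" unfolding I1_def by (rule influence_1)
  have I2: "I2 = (\<Sum>j = 1..n. ?b j)" "I2 = (\<Sum>s | length s = n. real (weight s) * (c s)\<^sup>2)"
    unfolding I2_def by (rule influence_2)+
  have "real (card J) * \<tau> = (\<Sum>j\<in>J. \<tau>)" by simp
  also have "\<dots> \<le> (\<Sum>j\<in>J. ?a j)" by (rule sum_mono) (auto simp: J_def)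
  also have "\<dots> \<le> I1" unfolding I1 using a0 by (intro sum_mono2) (auto simp: J_def)
  finally show "real (card J) * \<tau> \<le> I1" .
  let ?K = "{1..n} - J"
  let ?L = "\<lambda>j. {s :: pauli list. length s = n \<and> weight s \<le> d \<and> s ! (j - 1) \<noteq> PI}"
  have fin: "finite {s :: pauli list. length s = n \<and> P s}" for P
    by (rule finite_subset[OF _ finite_strings[of n]]) auto
  \<comment> \<open>A string that touches a qubit outside \<open>J\<close> either has weight above
    \<open>d\<close> or is counted among the low-weight strings at that qubit.\<close>
  have "(\<Sum>s | length s = n \<and> (\<exists>j\<in>?K. s ! (j - 1) \<noteq> PI). (c s)\<^sup>2)
      \<le> (\<Sum>s\<in>{s. length s = n \<and> d < weight s} \<union> (\<Union>j\<in>?K. ?L j). (c s)\<^sup>2)"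
    by (rule sum_mono2) (auto simp: fin)
  also have "\<dots> \<le> (\<Sum>s\<in>{s. length s = n \<and> d < weight s}. (c s)\<^sup>2) + (\<Sum>s\<in>(\<Union>j\<in>?K. ?L j). (c s)\<^sup>2)"
    by (subst sum.union_inter[symmetric]) (auto simp: fin intro!: sum_nonneg)
  also have "(\<Sum>s\<in>{s. length s = n \<and> d < weight s}. (c s)\<^sup>2) \<le> I2 / real (Suc d)"
    using high_degree_mass[where n = n and d = d and c = c] unfolding I2(2) by (simp add: pos_le_divide_eq del: of_nat_Suc)
  also have "(\<Sum>s\<in>(\<Union>j\<in>?K. ?L j). (c s)\<^sup>2) \<le> (\<Sum>j\<in>?K. \<Sum>s\<in>?L j. (c s)\<^sup>2)"
    by (rule sum_UN_le) (auto simp: fin)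
  also have "\<dots> \<le> (\<Sum>j\<in>?K. 5 ^ d * (sqrt (?b j) * ?a j))"
    by (rule sum_mono) (use deriv_low_degree in \<open>simp add: mult.assoc\<close>)
  also have "\<dots> = 5 ^ d * (\<Sum>j\<in>?K. ?a j * sqrt (?b j))" by (simp add: sum_distrib_left mult.commute)
  also have "(\<Sum>j\<in>?K. ?a j * sqrt (?b j)) \<le> sqrt (\<tau> * I1 * I2)"
  proof (rule real_le_rsqrt)
    have "(\<Sum>j\<in>?K. ?a j * sqrt (?b j))\<^sup>2 \<le> (\<Sum>j\<in>?K. (?a j)\<^sup>2) * (\<Sum>j\<in>?K. (sqrt (?b j))\<^sup>2)"
      by (rule sum_cauchy_schwarz_sq)
    also have "\<dots> \<le> (\<tau> * I1) * I2"
    proof (rule mult_mono)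
      \<comment> \<open>Outside \<open>J\<close> the trace norm of the derivative is below
        \<open>\<tau>\<close>, so one factor of each square can be traded for
        \<open>\<tau>\<close>.\<close>
      have "(\<Sum>j\<in>?K. (?a j)\<^sup>2) \<le> (\<Sum>j\<in>?K. \<tau> * ?a j)"
        using a0 by (intro sum_mono) (auto simp: J_def power2_eq_square intro!: mult_right_mono)
      also have "\<dots> \<le> (\<Sum>j = 1..n. \<tau> * ?a j)" using a0 assms(1) by (intro sum_mono2) auto
      finally show "(\<Sum>j\<in>?K. (?a j)\<^sup>2) \<le> \<tau> * I1" unfolding I1 sum_distrib_left .
      have "(\<Sum>j\<in>?K. (sqrt (?b j))\<^sup>2) = (\<Sum>j\<in>?K. ?b j)" by (simp add: local_var_nonneg)
      also have "\<dots> \<le> I2" unfolding I2(1) by (intro sum_mono2) (auto simp: local_var_nonneg)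
      finally show "(\<Sum>j\<in>?K. (sqrt (?b j))\<^sup>2) \<le> I2" .
      show "0 \<le> \<tau> * I1" unfolding I1 using a0 assms(1) by (auto intro!: mult_nonneg_nonneg sum_nonneg)
    qed (auto intro!: sum_nonneg simp: local_var_nonneg)
    finally show "(\<Sum>j\<in>?K. ?a j * sqrt (?b j))\<^sup>2 \<le> \<tau> * I1 * I2" .
  qed
  finally show "(\<Sum>s | length s = n \<and> (\<exists>j\<in>{1..n} - J. s ! (j - 1) \<noteq> PI). (c s)\<^sup>2)
      \<le> I2 / real (Suc d) + 5 ^ d * sqrt (\<tau> * I1 * I2)" by simp
qed

lemma card_pauli: "card (UNIV :: pauli set) = 4"
  by (simp add: UNIV_pauli)

text \<open>A string of this kind is determined by its letters at the qubits in
  \<open>J\<close>.\<close>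

lemma card_supported_strings:
  assumes "J \<subseteq> {1..n}"
  shows "card {s :: pauli list. length s = n \<and> (\<forall>j\<in>{1..n} - J. s ! (j - 1) = PI)} \<le> 4 ^ card J"
proof -
  let ?S = "{s :: pauli list. length s = n \<and> (\<forall>j\<in>{1..n} - J. s ! (j - 1) = PI)}"
  let ?f = "\<lambda>s :: pauli list. restrict (\<lambda>j. s ! (j - 1)) J"
  have fJ: "finite J" using assms finite_subset by blast
  have "inj_on ?f ?S"
  proof (rule inj_onI)
    fix s t assume s: "s \<in> ?S" and t: "t \<in> ?S" and e: "?f s = ?f t"
    show "s = t"
    proof (rule nth_equalityI)
      show "length s = length t" using s t by simp
      fix i assume "i < length s"
      then have i: "Suc i \<in> {1..n}" using s by simp
      show "s ! i = t ! i"
      proof (cases "Suc i \<in> J")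
        case True
        then show ?thesis using fun_cong[OF e, of "Suc i"] by simp
      next
        case False
        then have "s ! (Suc i - 1) = PI" "t ! (Suc i - 1) = PI" using s t i by blast+
        then show ?thesis by simp
      qed
    qed
  qed
  moreover have "?f ` ?S \<subseteq> Pi\<^sub>E J (\<lambda>_. UNIV)" by auto
  moreover have "finite (Pi\<^sub>E J (\<lambda>_. UNIV :: pauli set))" using fJ by (intro finite_PiE) (auto simp: UNIV_pauli)
  ultimately have "card ?S \<le> card (Pi\<^sub>E J (\<lambda>_. UNIV :: pauli set))" by (rule card_inj_on_le)
  also have "\<dots> = 4 ^ card J" using fJ by (simp add: card_PiE card_pauli)
  finally show ?thesis .
qed

lemma weight_eq_0: "length s = n \<Longrightarrow> weight s = 0 \<longleftrightarrow> s = replicate n PI"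
  by (induction s arbitrary: n) auto

text \<open>Every string other than the identity has weight at least 1; the left side is the
  variance.\<close>

lemma poincare:
  assumes "(\<Sum>s | length s = n. (c s)\<^sup>2) = 1"
  shows "1 - (c (replicate n PI))\<^sup>2 \<le> influence n 2 (real_comb n c)"
proof -
  let ?S = "{s :: pauli list. length s = n}"
  have "1 - (c (replicate n PI))\<^sup>2 = (\<Sum>s\<in>?S - {replicate n PI}. (c s)\<^sup>2)"
    unfolding assms[symmetric] by (simp add: sum_diff1)
  also have "\<dots> \<le> (\<Sum>s\<in>?S - {replicate n PI}. real (weight s) * (c s)\<^sup>2)"
  proof (rule sum_mono)
    fix s assume s: "s \<in> ?S - {replicate n PI}"
    then have "1 \<le> weight s" using weight_eq_0[of s n] by auto
    then have "1 * (c s)\<^sup>2 \<le> real (weight s) * (c s)\<^sup>2" by (intro mult_right_mono) auto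
    then show "(c s)\<^sup>2 \<le> real (weight s) * (c s)\<^sup>2" by simp
  qed
  also have "\<dots> \<le> (\<Sum>s\<in>?S. real (weight s) * (c s)\<^sup>2)" by (rule sum_mono2) auto
  finally show ?thesis unfolding influence_2(2) .
qed

section \<open>Edge isoperimetry\<close>

text \<open>A hermitian projection equals its adjoint times itself and is thus positive
  semidefinite; by uniqueness of square roots it is its own absolute value.\<close>

lemma schatten_1_projection:
  assumes g: "g \<in> carrier_mat (2 ^ n) (2 ^ n)" and h: "mat_adjoint g = g" and i: "g * g = g"
  shows "schatten_norm n 1 g = Re (\<Sum>i<2^n. g $$ (i, i)) / 2 ^ n"
proof -
  let ?N = "2 ^ n :: nat"
  obtain u l where "kunitary ?N u" "keq ?N (ker g) (kmult ?N u (kmult ?N (kdiag l) (kadj u)))"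
    and c: "abs_mat g \<in> carrier_mat ?N ?N" "abs_mat g * abs_mat g = g * g" and p: "psd (abs_mat g)"
    and "keq ?N (ker (abs_mat g)) (kmult ?N u (kmult ?N (kdiag (\<lambda>a. \<bar>l a\<bar>)) (kadj u)))"
    by (rule abs_mat_hermitian[OF g h])
  have gg: "keq ?N (ker g) (kmult ?N (ker g) (ker g))" using ker_mult[OF g g] unfolding i .
  have gh: "keq ?N (kadj (ker g)) (ker g)" using ker_adjoint[OF g] h by (auto intro: keq_sym)
  have gg': "keq ?N (ker g) (kmult ?N (kadj (ker g)) (ker g))"
    using keq_trans[OF gg keq_kmult[OF keq_sym[OF gh] keq_refl]] .
  have "kpsd ?N (kmult ?N (kadj (ker g)) (ker g))" unfolding kpsd_def
  proof
    fix v
    let ?w = "\<lambda>k. \<Sum>j<?N. g $$ (k, j) * v j"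
    have "(\<Sum>i<?N. (\<Sum>j<?N. kmult ?N (kadj (ker g)) (ker g) i j * v j) * cnj (v i))
        = (\<Sum>i<?N. \<Sum>j<?N. \<Sum>k<?N. cnj (g $$ (k, i)) * g $$ (k, j) * v j * cnj (v i))"
      unfolding kmult_def kadj_def sum_distrib_right ..
    also have "\<dots> = (\<Sum>i<?N. \<Sum>k<?N. \<Sum>j<?N. cnj (g $$ (k, i)) * g $$ (k, j) * v j * cnj (v i))"
      by (rule sum.cong[OF refl], rule sum.swap)
    also have "\<dots> = (\<Sum>k<?N. \<Sum>i<?N. \<Sum>j<?N. cnj (g $$ (k, i)) * g $$ (k, j) * v j * cnj (v i))"
      by (rule sum.swap)
    also have "\<dots> = (\<Sum>k<?N. cnj (?w k) * ?w k)"
      unfolding cnj_sum sum_product by (intro sum.cong refl) (simp add: mult_ac)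
    also have "\<dots> = of_real (\<Sum>k<?N. (cmod (?w k))\<^sup>2)"
      unfolding of_real_sum complex_norm_square by (intro sum.cong refl mult.commute)
    finally show "0 \<le> (\<Sum>i<?N. (\<Sum>j<?N. kmult ?N (kadj (ker g)) (ker g) i j * v j) * cnj (v i))"
      by (simp only: less_eq_complex_def) (auto intro!: sum_nonneg)
  qed
  then have k1: "kpsd ?N (ker g)" using kpsd_cong[OF gg'] by simp
  have k2: "kpsd ?N (ker (abs_mat g))" using psd_kpsd[OF c(1)] p by simp
  have k3: "keq ?N (kmult ?N (ker (abs_mat g)) (ker (abs_mat g))) (kmult ?N (ker g) (ker g))"
  proof -
    have "keq ?N (ker (g * g)) (kmult ?N (ker (abs_mat g)) (ker (abs_mat g)))"
      using ker_mult[OF c(1) c(1)] unfolding c(2) .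
    then show ?thesis by (rule keq_trans[OF keq_sym ker_mult[OF g g]])
  qed
  have "keq ?N (ker (abs_mat g)) (ker g)" by (rule kpsd_sqrt_unique[OF k2 k1 k3])
  then have "abs_mat g = g" unfolding ker_eq_iff[OF c(1) g] .
  then have "mtrace (abs_mat g ^\<^sub>m 1) = (\<Sum>i<?N. g $$ (i, i))" using g by (simp add: mtrace_def)
  then show ?thesis unfolding schatten_norm_def by simp
qed

text \<open>The level inequality for the spectral projection \<open>(1 - \<theta> A) / 2\<close> of normalised trace \<open>p \<le> 1/2\<close>.\<close>

lemma edge_isoperimetry:
  assumes "quantum_boolean n (real_comb n c)" and one: "(\<Sum>s | length s = n. (c s)\<^sup>2) = 1"
  defines "p \<equiv> (1 - \<bar>c (replicate n PI)\<bar>) / 2"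
  shows "4 * real (Suc d) * (p - 5 ^ d * sqrt p * p) \<le> influence n 2 (real_comb n c)"
proof -
  let ?N = "2 ^ n :: nat" and ?S = "{s :: pauli list. length s = n}" and ?o = "replicate n PI"
  let ?A = "real_comb n c"
  \<comment> \<open>The sign that gives the projection \<open>?P\<close> the smaller trace of the
    two spectral projections.\<close>
  define \<theta> :: real where "\<theta> = (if 0 \<le> c ?o then 1 else - 1)"
  have \<theta>: "\<theta> * \<theta> = 1" "\<theta> * c ?o = \<bar>c ?o\<bar>" by (auto simp: \<theta>_def)
  define q where "q = (\<lambda>s. ((if s = ?o then 1 else 0) - \<theta> * c s) / 2)"
  let ?P = "real_comb n q"
  have A: "?A * ?A = 1\<^sub>m ?N" using assms(1) by (simp add: quantum_boolean_def)
  have Pe: "ker ?P i j = (kid i j - of_real \<theta> * ker ?A i j) / 2" if "i < ?N" "j < ?N" for i j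
  proof -
    have "ker ?P i j = (\<Sum>s\<in>?S. ((if s = ?o then pker s i j else 0) - of_real \<theta> * (of_real (c s) * pker s i j)) / 2)"
    proof -
      have "of_real (q s) * pker s i j = ((if s = ?o then pker s i j else 0) - of_real \<theta> * (of_real (c s) * pker s i j)) / 2" for s
        by (cases "s = ?o") (simp_all add: q_def left_diff_distrib mult.assoc)
      moreover have "ker ?P i j = (\<Sum>s\<in>?S. of_real (q s) * pker s i j)" using that by (simp add: pauli_comb_def)
      ultimately show ?thesis by (simp only:)
    qed
    also have "\<dots> = ((\<Sum>s\<in>?S. if s = ?o then pker s i j else 0) - of_real \<theta> * (\<Sum>s\<in>?S. of_real (c s) * pker s i j)) / 2"
      unfolding sum_distrib_left sum_subtractf[symmetric] sum_divide_distrib ..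
    also have "(\<Sum>s\<in>?S. if s = ?o then pker s i j else 0) = pker ?o i j" by (simp add: sum.delta)
    also have "pker ?o i j = kid i j" using that by (simp add: pauli_tensor_identity kid_def)
    finally show ?thesis using that by (simp add: pauli_comb_def)
  qed
  have PP: "?P * ?P = ?P"
  proof -
    have "keq ?N (kmult ?N (ker ?P) (ker ?P)) (ker ?P)"
      unfolding keq_def
    proof (intro allI impI)
      fix i j assume ij: "i < ?N" "j < ?N"
      have "kmult ?N (ker ?P) (ker ?P) i j
          = (\<Sum>k<?N. (kid k i * kid k j - of_real \<theta> * (kid k i * ker ?A k j) - of_real \<theta> * (kid k j * ker ?A i k)
              + of_real (\<theta> * \<theta>) * (ker ?A i k * ker ?A k j)) / 4)"
        unfolding kmult_def
      proof (rule sum.cong[OF refl])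
        fix k assume "k \<in> {..<?N}"
        then have k: "k < ?N" by simp
        have "kid i k = kid k i" by (simp add: kid_def)
        then show "ker ?P i k * ker ?P k j = (kid k i * kid k j - of_real \<theta> * (kid k i * ker ?A k j)
            - of_real \<theta> * (kid k j * ker ?A i k) + of_real (\<theta> * \<theta>) * (ker ?A i k * ker ?A k j)) / 4"
          unfolding Pe[OF ij(1) k] Pe[OF k ij(2)] of_real_mult by (simp add: algebra_simps)
      qed
      also have "\<dots> = ((\<Sum>k<?N. kid k i * kid k j) - of_real \<theta> * (\<Sum>k<?N. kid k i * ker ?A k j)
          - of_real \<theta> * (\<Sum>k<?N. kid k j * ker ?A i k) + kmult ?N (ker ?A) (ker ?A) i j) / 4"
        unfolding \<theta>(1) of_real_1 mult_1 kmult_def sum_distrib_left sum_subtractf[symmetric] sum.distrib[symmetric]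
          sum_divide_distrib ..
      also have "kmult ?N (ker ?A) (ker ?A) i j = kid i j"
        using ker_mult[OF pauli_comb_carrier pauli_comb_carrier, of n "\<lambda>s. of_real (c s)" "\<lambda>s. of_real (c s)"] ij
        unfolding A by (simp add: keq_def kid_def)
      also have "((\<Sum>k<?N. kid k i * kid k j) - of_real \<theta> * (\<Sum>k<?N. kid k i * ker ?A k j)
          - of_real \<theta> * (\<Sum>k<?N. kid k j * ker ?A i k) + kid i j) / 4 = ker ?P i j"
        unfolding sum_kid[OF ij(1)] sum_kid[OF ij(2)] Pe[OF ij] by (simp add: field_simps)
      finally show "kmult ?N (ker ?P) (ker ?P) i j = ker ?P i j" .
    qed
    then show ?thesis
      unfolding ker_eq_iff[OF mult_carrier_mat[OF pauli_comb_carrier pauli_comb_carrier] pauli_comb_carrier]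
      by (rule keq_trans[OF ker_mult[OF pauli_comb_carrier pauli_comb_carrier]])
  qed
  have q0: "q ?o = p" unfolding q_def p_def \<theta>(2) by simp
  have qs: "(q s)\<^sup>2 = (c s)\<^sup>2 / 4" if "s \<noteq> ?o" for s
    using that \<theta>(1) by (simp add: q_def power_divide power_mult_distrib power2_eq_square)
  \<comment> \<open>The squared 2-norm of a projection is its normalised trace, and so is its trace
    norm. Hence \<open>low_degree_duality\<close> bounds the low-degree part of \<open>p\<close> by
    a multiple of \<open>sqrt p * p\<close>, which is small against \<open>p\<close>.\<close>
  have sq: "(\<Sum>s\<in>?S. (q s)\<^sup>2) = p"
  proof -
    have "(\<Sum>s\<in>?S. (q s)\<^sup>2) = p\<^sup>2 + (\<Sum>s\<in>?S - {?o}. (q s)\<^sup>2)"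
      by (subst sum.remove[of _ ?o]) (auto simp: q0)
    also have "(\<Sum>s\<in>?S - {?o}. (q s)\<^sup>2) = (\<Sum>s\<in>?S - {?o}. (c s)\<^sup>2) / 4"
      unfolding sum_divide_distrib by (intro sum.cong refl) (auto simp: qs)
    also have "(\<Sum>s\<in>?S - {?o}. (c s)\<^sup>2) = 1 - \<bar>c ?o\<bar>\<^sup>2"
      unfolding one[symmetric] by (simp add: sum_diff1)
    finally show ?thesis unfolding p_def by (simp add: power2_eq_square field_simps)
  qed
  have "schatten_norm n 1 ?P = Re (\<Sum>i<2^n. ?P $$ (i, i)) / 2 ^ n"
    by (rule schatten_1_projection[OF pauli_comb_carrier real_comb_hermitian PP])
  also have "(\<Sum>i<2^n. ?P $$ (i, i)) = of_real ((hs_norm ?N (ker ?P))\<^sup>2)"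
  proof -
    have "kherm ?N (ker ?P)"
      using ker_adjoint[OF pauli_comb_carrier, of n "\<lambda>s. of_real (q s)"] real_comb_hermitian[of n q]
      by (auto simp: kherm_def intro: keq_sym)
    then have "of_real ((hs_norm ?N (ker ?P))\<^sup>2) = (\<Sum>i<?N. kmult ?N (ker ?P) (ker ?P) i i)" by (rule hs_norm_sq_herm)
    also have "\<dots> = (\<Sum>i<?N. ker (?P * ?P) i i)"
      using ker_mult[OF pauli_comb_carrier pauli_comb_carrier, of n "\<lambda>s. of_real (q s)" "\<lambda>s. of_real (q s)"]
      by (intro sum.cong refl) (auto simp: keq_def)
    finally show ?thesis unfolding PP by (rule sym)
  qed
  finally have L1: "schatten_norm n 1 ?P = p"
    unfolding hs_norm_real_comb sq using sq sum_nonneg[of ?S "\<lambda>s. (q s)\<^sup>2"] by simp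
  have low: "(\<Sum>s | length s = n \<and> weight s \<le> d. (q s)\<^sup>2) \<le> 5 ^ d * sqrt p * p"
    using low_degree_duality[where n = n and d = d and c = q] unfolding sq L1 .
  have "p = (\<Sum>s | length s = n \<and> weight s \<le> d. (q s)\<^sup>2) + (\<Sum>s | length s = n \<and> d < weight s. (q s)\<^sup>2)"
  proof -
    have fin: "finite {s :: pauli list. length s = n \<and> R s}" for R
      by (rule finite_subset[OF _ finite_strings[of n]]) auto
    have "(\<Sum>s\<in>?S. (q s)\<^sup>2)
        = (\<Sum>s\<in>{s. length s = n \<and> weight s \<le> d} \<union> {s. length s = n \<and> d < weight s}. (q s)\<^sup>2)"
      by (rule sum.cong) auto
    also have "\<dots> = (\<Sum>s | length s = n \<and> weight s \<le> d. (q s)\<^sup>2)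
        + (\<Sum>s | length s = n \<and> d < weight s. (q s)\<^sup>2)"
      by (rule sum.union_disjoint[OF fin fin]) auto
    finally have "(\<Sum>s\<in>?S. (q s)\<^sup>2) = (\<Sum>s | length s = n \<and> weight s \<le> d. (q s)\<^sup>2)
        + (\<Sum>s | length s = n \<and> d < weight s. (q s)\<^sup>2)" .
    then show ?thesis unfolding sq .
  qed
  then have "p - 5 ^ d * sqrt p * p \<le> (\<Sum>s | length s = n \<and> d < weight s. (q s)\<^sup>2)" using low by linarith
  then have "(p - 5 ^ d * sqrt p * p) * real (Suc d) \<le> (\<Sum>s | length s = n \<and> d < weight s. (q s)\<^sup>2) * real (Suc d)"
    by (rule mult_right_mono) simp
  also have "\<dots> \<le> (\<Sum>s\<in>?S. real (weight s) * (q s)\<^sup>2)" by (rule high_degree_mass)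
  \<comment> \<open>The coefficients of \<open>?P\<close> are half those of \<open>?A\<close> in
    modulus, except at the identity, which has weight 0; this is the origin of the factor 4.\<close>
  also have "\<dots> = (\<Sum>s\<in>?S. real (weight s) * (c s)\<^sup>2) / 4"
    unfolding sum_divide_distrib
  proof (rule sum.cong[OF refl])
    fix s assume "s \<in> ?S"
    then have "weight s = 0 \<longleftrightarrow> s = ?o" by (intro weight_eq_0) simp
    then show "real (weight s) * (q s)\<^sup>2 = real (weight s) * (c s)\<^sup>2 / 4"
      by (cases "s = ?o") (auto simp: qs)
  qed
  finally have "(p - 5 ^ d * sqrt p * p) * real (Suc d) \<le> (\<Sum>s\<in>?S. real (weight s) * (c s)\<^sup>2) / 4" .
  moreover have "4 * real (Suc d) * (p - 5 ^ d * sqrt p * p) = 4 * ((p - 5 ^ d * sqrt p * p) * real (Suc d))"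
    by (simp only: mult.assoc mult.commute mult.left_commute)
  ultimately show ?thesis unfolding influence_2(2) by linarith
qed

section \<open>Concentration of the Pauli spectrum\<close>

text \<open>Convexity: the left side is the tangent of \<open>t * ln t\<close> of slope
  \<open>m\<close>, touching at \<open>exp (m - 1)\<close>.\<close>

lemma mult_ln_ge: "0 < t \<Longrightarrow> m * t - exp (m - 1) \<le> t * ln t" for t m :: real
proof -
  assume t: "0 < t"
  have "ln (exp (m - 1) / t) \<le> exp (m - 1) / t - 1" using t by (intro ln_le_minus_one) simp
  then have "m - 1 - ln t \<le> exp (m - 1) / t - 1" using t by (simp add: ln_div)
  then have "t * (m - 1 - ln t) \<le> t * (exp (m - 1) / t - 1)" using t by (intro mult_left_mono) auto
  then show ?thesis using t by (simp add: algebra_simps)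
qed

lemma exp_1_le_3: "exp 1 \<le> (3 :: real)"
  using exp_le by simp

lemma ln_25_le: "25 \<le> exp (4 :: real)"
proof -
  have "(5 / 2) ^ 4 \<le> (exp 1 :: real) ^ 4"
    using exp_lower_Taylor_quadratic[of 1] by (intro power_mono) auto
  then show ?thesis by (simp add: exp_of_nat_mult[symmetric] power_divide)
qed

text \<open>\<open>25 ^ d\<close> is the square of the hypercontractive constant; as an exponential
  it can be compared with \<open>k_bound\<close>.\<close>

lemma power_25_le: "25 ^ d \<le> exp (4 * real d)"
proof -
  have "(25 :: real) ^ d \<le> exp 4 ^ d" by (rule power_mono[OF ln_25_le]) simp
  then show ?thesis by (simp add: exp_of_nat_mult[symmetric] mult.commute)
qed

text \<open>The exponent of the second formula is \<open>6 * (4 * x * ln (4 * x))\<close>, to which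
  \<open>mult_ln_ge\<close> applies with free slope \<open>m\<close>; for influence at least 1 the
  first formula dominates the second. So one bound, exponential in \<open>x\<close> at a rate of
  choice, covers both branches.\<close>

lemma k_bound_ge:
  fixes \<epsilon> x m :: real and A :: "complex mat" and n :: nat
  defines "I1 \<equiv> influence n 1 A" and "I2 \<equiv> influence n 2 A"
  assumes I2: "0 < I2" and e: "0 < \<epsilon>" and x: "x = I2 / \<epsilon>\<^sup>2"
  shows "I1\<^sup>2 / I2 * exp (24 * m * x - 6 * exp (m - 1)) \<le> k_bound n \<epsilon> A"
proof -
  have x0: "0 < x" using I2 e x by simp
  have sx: "2 * sqrt I2 / \<epsilon> = sqrt (4 * x)" using e I2 unfolding x by (simp add: real_sqrt_mult real_sqrt_divide)
  have lx: "ln (2 * sqrt I2 / \<epsilon>) = ln (4 * x) / 2" unfolding sx using x0 by (simp add: ln_sqrt)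
  have "m * (4 * x) - exp (m - 1) \<le> 4 * x * ln (4 * x)" by (rule mult_ln_ge) (use x0 in simp)
  then have E: "24 * m * x - 6 * exp (m - 1) \<le> 48 * x * (ln (4 * x) / 2)" by simp
  have q: "0 \<le> I1\<^sup>2 / I2" using I2 by simp
  have x48: "48 * I2 / \<epsilon>\<^sup>2 = 48 * x" by (simp add: x)
  show ?thesis
  proof (cases "1 \<le> I2")
    case True
    have "sqrt I2 * 1 \<le> sqrt I2 * sqrt I2" using True by (intro mult_left_mono) auto
    then have "sqrt I2 \<le> I2" using I2 by simp
    then have "ln (2 * sqrt I2 / \<epsilon>) \<le> ln (2 * I2 / \<epsilon>)" using e I2 by (simp add: divide_right_mono)
    then have "48 * x * (ln (4 * x) / 2) \<le> 48 * x * ln (2 * I2 / \<epsilon>)" unfolding lx using x0 by (intro mult_left_mono) auto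
    then have "exp (24 * m * x - 6 * exp (m - 1)) \<le> exp (48 * I2 / \<epsilon>\<^sup>2 * ln (2 * I2 / \<epsilon>))"
      using E unfolding x48 by simp
    moreover have "I1\<^sup>2 / I2 \<le> I1\<^sup>2" using True I2 mult_left_mono[of 1 I2 "I1\<^sup>2"] by (simp add: divide_le_eq)
    ultimately have "I1\<^sup>2 / I2 * exp (24 * m * x - 6 * exp (m - 1)) \<le> I1\<^sup>2 * exp (48 * I2 / \<epsilon>\<^sup>2 * ln (2 * I2 / \<epsilon>))"
      using q by (intro mult_mono) auto
    then show ?thesis using True by (simp add: k_bound_def Let_def I1_def I2_def)
  next
    case False
    have "exp (24 * m * x - 6 * exp (m - 1)) \<le> exp (48 * I2 / \<epsilon>\<^sup>2 * ln (2 * sqrt I2 / \<epsilon>))"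
      using E unfolding x48 lx by simp
    then have "I1\<^sup>2 / I2 * exp (24 * m * x - 6 * exp (m - 1)) \<le> I1\<^sup>2 / I2 * exp (48 * I2 / \<epsilon>\<^sup>2 * ln (2 * sqrt I2 / \<epsilon>))"
      using q by (rule mult_left_mono)
    then show ?thesis using False by (simp add: k_bound_def Let_def I1_def I2_def)
  qed
qed

text \<open>If \<open>p\<close> is of order \<open>\<epsilon>\<^sup>2\<close>, the Poincare
  inequality bounds the right side below only by a constant, and edge isoperimetry has to supply the
  logarithm. If \<open>p\<close> is at least \<open>\<epsilon> / 16\<close>, Poincare alone gives
  the stronger order \<open>1 / \<epsilon>\<close>.\<close>

lemma ln_inverse_precision_le:
  fixes \<epsilon> :: real
  assumes qb: "quantum_boolean n (real_comb n c)" and one: "(\<Sum>s | length s = n. (c s)\<^sup>2) = 1"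
    and e: "0 < \<epsilon>" "\<epsilon> < 1" and V: "\<epsilon>\<^sup>2 / 4 < 1 - (c (replicate n PI))\<^sup>2"
  shows "ln (1 / \<epsilon>) \<le> 32 * (influence n 2 (real_comb n c) / \<epsilon>\<^sup>2)"
proof -
  define I2 where "I2 = influence n 2 (real_comb n c)"
  define a where "a = \<bar>c (replicate n PI)\<bar>"
  define p where "p = (1 - a) / 2"
  have a: "0 \<le> a" "(c (replicate n PI))\<^sup>2 = a\<^sup>2" by (auto simp: a_def)
  have "a\<^sup>2 < 1" using V e unfolding a(2) by (smt (verit) zero_le_power2 divide_nonneg_nonneg)
  then have a1: "a < 1" using a(1) by (simp add: power_less_one_iff)
  have VI: "1 - a\<^sup>2 \<le> I2" using poincare[OF one] by (simp add: I2_def a(2))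
  have V1: "1 - a\<^sup>2 = 2 * p * (1 + a)" by (simp add: p_def power2_eq_square algebra_simps)
  have p0: "0 < p" using a1 by (simp add: p_def)
  have "2 * p * (1 + a) \<le> 2 * p * 2" using p0 a1 by (intro mult_left_mono) auto
  then have pe: "\<epsilon>\<^sup>2 / 16 < p" using V V1 unfolding a(2) by linarith
  have "2 * p * 1 \<le> 2 * p * (1 + a)" using p0 a(1) by (intro mult_left_mono) auto
  then have pI: "2 * p \<le> I2" using VI V1 by linarith
  have l: "ln (1 / \<epsilon>) \<le> 1 / \<epsilon>" using e ln_le_minus_one[of "1 / \<epsilon>"] by simp
  show ?thesis
  proof (cases "\<epsilon> / 16 \<le> p")
    case True
    then have "\<epsilon> / 8 / \<epsilon>\<^sup>2 \<le> I2 / \<epsilon>\<^sup>2" using pI by (intro divide_right_mono) auto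
    moreover have "\<epsilon> / 8 / \<epsilon>\<^sup>2 = 1 / (8 * \<epsilon>)" using e by (simp add: power2_eq_square)
    moreover have "32 * (1 / (8 * \<epsilon>)) = 4 * (1 / \<epsilon>)" by simp
    moreover have "0 < 1 / \<epsilon>" using e by simp
    ultimately show ?thesis using l unfolding I2_def[symmetric] by linarith
  next
    case False
    \<comment> \<open>For this \<open>d\<close>, \<open>25 ^ d \<le> 1 / \<epsilon>\<close>, hence
      \<open>5 ^ d * sqrt p \<le> 1 / 2\<close> and at least half of \<open>p\<close> survives in
      \<open>edge_isoperimetry\<close>.\<close>
    define d where "d = nat \<lfloor>ln (1 / \<epsilon>) / 4\<rfloor>"
    have l0: "0 \<le> ln (1 / \<epsilon>)" using e by simp
    then have "real d = of_int \<lfloor>ln (1 / \<epsilon>) / 4\<rfloor>" unfolding d_def by simp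
    then have d: "real d \<le> ln (1 / \<epsilon>) / 4" "ln (1 / \<epsilon>) / 4 \<le> real (Suc d)" by linarith+
    have "exp (4 * real d) \<le> exp (ln (1 / \<epsilon>))" using d(1) by (subst exp_le_cancel_iff) linarith
    then have "25 ^ d \<le> exp (ln (1 / \<epsilon>))" using power_25_le[of d] by linarith
    then have "25 ^ d \<le> 1 / \<epsilon>" using e by simp
    then have "25 ^ d * p \<le> 1 / \<epsilon> * (\<epsilon> / 16)" using False p0 e by (intro mult_mono) auto
    then have "25 ^ d * p \<le> 1 / 16" using e by simp
    then have "sqrt (25 ^ d * p) \<le> sqrt (1 / 16)" by (rule real_sqrt_le_mono)
    moreover have "sqrt (25 ^ d * p) = 5 ^ d * sqrt p"
      using real_sqrt_power[of 25 d] by (simp add: real_sqrt_mult)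
    moreover have "sqrt (1 / 16) \<le> (1 / 2 :: real)" by (rule real_le_lsqrt) (auto simp: power2_eq_square)
    ultimately have "5 ^ d * sqrt p \<le> 1 / 2" by linarith
    then have "5 ^ d * sqrt p * p \<le> 1 / 2 * p" using p0 by (intro mult_right_mono) auto
    then have "4 * real (Suc d) * (p / 2) \<le> 4 * real (Suc d) * (p - 5 ^ d * sqrt p * p)"
      by (intro mult_left_mono) auto
    also have "\<dots> \<le> I2" using edge_isoperimetry[OF qb one, of d] unfolding I2_def p_def a_def .
    finally have "4 * real (Suc d) * (p / 2) \<le> I2" .
    moreover have "4 * real (Suc d) * (p / 2) = 2 * real (Suc d) * p" by simp
    ultimately have "2 * real (Suc d) * p \<le> I2" by linarith
    moreover have "2 * real (Suc d) * (\<epsilon>\<^sup>2 / 16) \<le> 2 * real (Suc d) * p" using pe by (intro mult_left_mono) auto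
    moreover have "2 * real (Suc d) * (\<epsilon>\<^sup>2 / 16) = real (Suc d) / 8 * \<epsilon>\<^sup>2" by simp
    ultimately have "real (Suc d) / 8 * \<epsilon>\<^sup>2 \<le> I2" by linarith
    then have "real (Suc d) / 8 \<le> I2 / \<epsilon>\<^sup>2" using e by (simp add: pos_le_divide_eq del: of_nat_Suc)
    then have "32 * (real (Suc d) / 8) \<le> 32 * (I2 / \<epsilon>\<^sup>2)" by (rule mult_left_mono) simp
    then have "4 * real (Suc d) \<le> 32 * (I2 / \<epsilon>\<^sup>2)" by simp
    moreover have "4 * (ln (1 / \<epsilon>) / 4) \<le> 4 * real (Suc d)" using d(2) by (rule mult_left_mono) simp
    then have "ln (1 / \<epsilon>) \<le> 4 * real (Suc d)" by simp
    ultimately show ?thesis unfolding I2_def[symmetric] by (rule order_trans[rotated])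
  qed
qed

text \<open>The junta of the concentration argument is non-empty when the variance exceeds \<open>\<epsilon>\<^sup>2 / 4\<close>, which bounds
  \<open>k_bound\<close> from below in terms of \<open>x\<close> alone, and hence by isoperimetry in terms of the precision.\<close>

lemma spectral_concentration:
  fixes \<epsilon> :: real and n :: nat and c :: "pauli list \<Rightarrow> real"
  assumes qb: "quantum_boolean n (real_comb n c)" and one: "(\<Sum>s | length s = n. (c s)\<^sup>2) = 1"
    and e: "0 < \<epsilon>" "\<epsilon> < 1" and V: "\<epsilon>\<^sup>2 / 4 < 1 - (c (replicate n PI))\<^sup>2"
  defines "K \<equiv> k_bound n \<epsilon> (real_comb n c)"
  shows "\<exists>S \<subseteq> {s. length s = n}. real (card S) \<le> 4 powr (64 * exp 22 * K)
      \<and> (\<Sum>s\<in>{s. length s = n} - S. (c s)\<^sup>2) \<le> \<epsilon>\<^sup>2 / 4"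
    and "ln (1 / \<epsilon>) \<le> 64 * exp 58 * K"
proof -
  let ?S = "{s :: pauli list. length s = n}"
  define I1 where "I1 = influence n 1 (real_comb n c)"
  define I2 where "I2 = influence n 2 (real_comb n c)"
  define x where "x = I2 / \<epsilon>\<^sup>2"
  have I2: "0 < I2" using poincare[OF one] V e unfolding I2_def by (smt (verit) zero_le_power2 divide_nonneg_nonneg)
  have x0: "0 < x" using I2 e by (simp add: x_def)
  have I1: "0 \<le> I1" unfolding I1_def influence_1 by (intro sum_nonneg deriv_L1_nonneg) auto
  \<comment> \<open>A degree at which the high-degree error \<open>I2 / real (Suc d)\<close> is at
    most \<open>\<epsilon>\<^sup>2 / 8\<close>, half of the budget.\<close>
  define d where "d = nat \<lceil>8 * x\<rceil>"
  have d: "8 * x \<le> real d" "real d \<le> 8 * x + 1" unfolding d_def using x0 by linarith+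
  define D where "D = (25 :: real) ^ d"
  have D: "0 < D" "D \<le> exp (32 * x + 4)" "(5 ^ d)\<^sup>2 = D"
  proof -
    have "exp (4 * real d) \<le> exp (32 * x + 4)" using d(2) by (subst exp_le_cancel_iff) linarith
    then show "D \<le> exp (32 * x + 4)" using power_25_le[of d] unfolding D_def by linarith
    show "(5 ^ d)\<^sup>2 = D" unfolding D_def by (simp add: power2_eq_square power_mult_distrib[symmetric])
  qed (simp add: D_def)
  \<comment> \<open>Solves \<open>5 ^ d * sqrt (\<tau> * I1 * I2) = \<epsilon>\<^sup>2 / 8\<close>,
    the other half of the budget. For \<open>I1 = 0\<close> the left side vanishes and any positive
    value will do.\<close>
  define \<tau> where "\<tau> = (if I1 = 0 then 1 else \<epsilon> ^ 4 / (64 * D * I1 * I2))"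
  have \<tau>: "0 < \<tau>" using I1 I2 D e by (auto simp: \<tau>_def)
  define J where "J = {j \<in> {1..n}. \<tau> \<le> deriv_L1 n c j}"
  have "sqrt (\<tau> * I1 * I2) * 5 ^ d \<le> \<epsilon>\<^sup>2 / 8"
  proof (cases "I1 = 0")
    case False
    have "\<tau> * I1 * I2 * D = (\<epsilon>\<^sup>2 / 8)\<^sup>2" using False I2 D(1) by (simp add: \<tau>_def power2_eq_square field_simps power4_eq_xxxx)
    then have "sqrt (\<tau> * I1 * I2 * D) = \<epsilon>\<^sup>2 / 8" by simp
    then show ?thesis by (simp add: real_sqrt_mult D(3)[symmetric])
  qed simp
  moreover have "I2 / real (Suc d) \<le> \<epsilon>\<^sup>2 / 8"
  proof -
    have "I2 / real (Suc d) \<le> I2 / (8 * x)" using d x0 I2 by (intro divide_left_mono) auto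
    also have "\<dots> = \<epsilon>\<^sup>2 / 8" using I2 e by (simp add: x_def)
    finally show ?thesis .
  qed
  ultimately have out: "(\<Sum>s | length s = n \<and> (\<exists>j\<in>{1..n} - J. s ! (j - 1) \<noteq> PI). (c s)\<^sup>2) \<le> \<epsilon>\<^sup>2 / 4"
    using junta_approximation(1)[OF \<tau>, where n = n and c = c and d = d] unfolding J_def I1_def I2_def
    by (simp add: mult.commute)
  have Jt: "real (card J) * \<tau> \<le> I1"
    using junta_approximation(2)[OF \<tau>, where n = n and c = c] unfolding J_def I1_def .
  define S where "S = {s :: pauli list. length s = n \<and> (\<forall>j\<in>{1..n} - J. s ! (j - 1) = PI)}"
  have SS: "?S - S = {s. length s = n \<and> (\<exists>j\<in>{1..n} - J. s ! (j - 1) \<noteq> PI)}" by (auto simp: S_def)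
  have cS: "real (card S) \<le> 4 ^ card J"
  proof -
    have "card S \<le> 4 ^ card J" unfolding S_def by (rule card_supported_strings) (auto simp: J_def)
    then have "real (card S) \<le> real (4 ^ card J)" by (simp only: of_nat_le_iff)
    then show ?thesis by simp
  qed
  \<comment> \<open>An empty junta would leave only the identity string in \<open>S\<close>; the
    mass outside \<open>S\<close> would then be the variance, contrary to \<open>V\<close>.\<close>
  have "J \<noteq> {}"
  proof
    assume "J = {}"
    then have "S \<subseteq> {replicate n PI}"
    proof (intro subsetI)
      fix s assume "s \<in> S" "J = {}"
      then have s: "length s = n" "\<forall>j\<in>{1..n}. s ! (j - 1) = PI" by (auto simp: S_def)
      have "s ! i = PI" if "i < n" for i using s(2)[rule_format, of "Suc i"] that by simp
      then show "s \<in> {replicate n PI}" using s(1) by (auto intro!: nth_equalityI)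
    qed
    then have "(\<Sum>s\<in>?S - {replicate n PI}. (c s)\<^sup>2) \<le> (\<Sum>s\<in>?S - S. (c s)\<^sup>2)" by (intro sum_mono2) auto
    also have "\<dots> \<le> \<epsilon>\<^sup>2 / 4" unfolding SS by (rule out)
    also have "(\<Sum>s\<in>?S - {replicate n PI}. (c s)\<^sup>2) = 1 - (c (replicate n PI))\<^sup>2"
      unfolding one[symmetric] by (simp add: sum_diff1)
    finally show False using V by simp
  qed
  moreover have "finite J" by (simp add: J_def)
  ultimately have J1: "1 \<le> real (card J)" by (simp add: Suc_le_eq card_gt_0_iff)
  have "0 < real (card J) * \<tau>" using J1 \<tau> by (intro mult_pos_pos) linarith+
  then have I1: "0 < I1" using Jt by linarith
  define R where "R = I1\<^sup>2 / I2"
  have R: "0 < R" using I1 I2 by (simp add: R_def)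
  have "x\<^sup>2 \<le> exp (2 * x)"
  proof -
    have "x \<le> exp x" using exp_ge_add_one_self[of x] by linarith
    then have "x\<^sup>2 \<le> (exp x)\<^sup>2" using x0 by (intro power_mono) auto
    then show ?thesis by (simp add: exp_double)
  qed
  then have "D * x\<^sup>2 \<le> exp (32 * x + 4) * exp (2 * x)" using D by (intro mult_mono) auto
  then have Dx: "D * x\<^sup>2 \<le> exp (34 * x + 4)" by (simp add: exp_add[symmetric])
  have "real (card J) \<le> I1 / \<tau>" using Jt \<tau> by (simp add: pos_le_divide_eq)
  also have "\<dots> = 64 * (D * x\<^sup>2) * R"
    using I1 I2 e D by (simp add: \<tau>_def x_def R_def power2_eq_square field_simps power4_eq_xxxx)
  also have "\<dots> \<le> 64 * exp (34 * x + 4) * R" using Dx R by simp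
  finally have JR: "real (card J) \<le> 64 * exp (34 * x + 4) * R" .
  have KR: "R * exp (24 * m * x - 6 * exp (m - 1)) \<le> K" for m
    unfolding R_def K_def I1_def I2_def by (rule k_bound_ge) (use I2 e in \<open>auto simp: I2_def x_def\<close>)
  \<comment> \<open>Slope 2: the rate 48 dominates 34, and \<open>22 = 4 + 6 * 3\<close> compensates
    the constants because \<open>exp 1 \<le> 3\<close>.\<close>
  have "64 * exp (34 * x + 4) * R \<le> 64 * exp 22 * (R * exp (24 * 2 * x - 6 * exp (2 - 1)))"
  proof -
    have "exp (34 * x + 4) \<le> exp (22 + (24 * 2 * x - 6 * exp (2 - 1)))" using x0 exp_1_le_3 by simp
    then show ?thesis using R by (simp add: exp_add mult_ac)
  qed
  also have "\<dots> \<le> 64 * exp 22 * K" using KR[of 2] by (intro mult_left_mono) auto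
  finally have JK: "real (card J) \<le> 64 * exp 22 * K" using JR by linarith
  show "\<exists>S \<subseteq> {s. length s = n}. real (card S) \<le> 4 powr (64 * exp 22 * K)
      \<and> (\<Sum>s\<in>{s. length s = n} - S. (c s)\<^sup>2) \<le> \<epsilon>\<^sup>2 / 4"
  proof (intro exI[of _ S] conjI)
    show "S \<subseteq> ?S" by (auto simp: S_def)
    have "4 ^ card J = 4 powr real (card J)" by (simp add: powr_realpow)
    also have "\<dots> \<le> 4 powr (64 * exp 22 * K)" using JK by (intro powr_mono) auto
    finally show "real (card S) \<le> 4 powr (64 * exp 22 * K)" using cS by linarith
    show "(\<Sum>s\<in>?S - S. (c s)\<^sup>2) \<le> \<epsilon>\<^sup>2 / 4" unfolding SS by (rule out)
  qed
  have e2: "exp (3 - 1) \<le> (9 :: real)"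
  proof -
    have "exp (2 * 1) = (exp 1 :: real)\<^sup>2" by (rule exp_double)
    also have "\<dots> \<le> 3\<^sup>2" using exp_1_le_3 by (intro power_mono) auto
    finally show ?thesis by simp
  qed
  \<comment> \<open>As the junta has an element, \<open>64 * exp (34 * x + 4) * R\<close> is at
    least 1 and may be multiplied in. The rate becomes \<open>38 + 34 = 24 * 3\<close>, hence slope
    3, and \<open>58 = 4 + 6 * 9\<close> covers the constants.\<close>
  have "32 * x \<le> exp (38 * x)" using exp_ge_add_one_self[of "38 * x"] x0 by linarith
  also have "\<dots> \<le> exp (38 * x) * (64 * exp (34 * x + 4) * R)" using JR J1 by simp
  also have "\<dots> = 64 * exp (72 * x + 4) * R" by (simp add: exp_add[symmetric] mult.assoc[symmetric] mult.commute[of _ 64])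
  also have "\<dots> \<le> 64 * exp 58 * (R * exp (24 * 3 * x - 6 * exp (3 - 1)))"
  proof -
    have "exp (72 * x + 4) \<le> exp (58 + (24 * 3 * x - 6 * exp (3 - 1)))" using e2 by simp
    then show ?thesis using R by (simp add: exp_add mult_ac)
  qed
  also have "\<dots> \<le> 64 * exp 58 * K" using KR[of 3] by (intro mult_left_mono) auto
  finally have "32 * x \<le> 64 * exp 58 * K" .
  then show "ln (1 / \<epsilon>) \<le> 64 * exp 58 * K"
    using ln_inverse_precision_le[OF qb one e V] unfolding x_def I2_def by linarith
qed

section \<open>States prepared by query algorithms\<close>

text \<open>A family of states \<open>\<Psi> A\<close>, given by amplitudes, that is prepared with \<open>T\<close> queries to \<open>A\<close>.\<close>

definition reach :: "nat \<Rightarrow> nat \<Rightarrow> nat \<Rightarrow> (complex mat \<Rightarrow> nat \<Rightarrow> complex) \<Rightarrow> bool" where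
  "reach n w T \<Psi> \<longleftrightarrow> (\<exists>alg. work_dim alg = w \<and> num_queries alg = T \<and> valid_alg n alg \<and>
     (\<forall>A\<in>carrier_mat (2 ^ n) (2 ^ n). \<forall>i<w * (2 * 2 ^ n). run_alg n alg A T $ i = \<Psi> A i))"

abbreviation kmat :: "nat \<Rightarrow> kernel \<Rightarrow> complex mat" where
  "kmat d K \<equiv> mat d d (\<lambda>(i, j). K i j)"

lemma unitary_kmat: "kunitary d K \<Longrightarrow> unitary_mat d (kmat d K)"
  unfolding unitary_mat_def
proof (intro conjI)
  assume u: "kunitary d K"
  show "mat_adjoint (kmat d K) * kmat d K = 1\<^sub>m d"
  proof (rule eq_matI)
    fix i j assume "i < dim_row (1\<^sub>m d :: complex mat)" "j < dim_col (1\<^sub>m d :: complex mat)"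
    then have ij: "i < d" "j < d" by auto
    have "(mat_adjoint (kmat d K) * kmat d K) $$ (i, j) = kmult d (kadj K) K i j"
      using ij by (simp add: scalar_prod_def kmult_def kadj_def atLeast0LessThan)
    then show "(mat_adjoint (kmat d K) * kmat d K) $$ (i, j) = 1\<^sub>m d $$ (i, j)"
      using u ij by (simp add: kunitary_def keq_def kid_def)
  qed auto
qed simp

lemma unitary_mat_kernel: "unitary_mat d U \<Longrightarrow> kunitary d (ker U)"
proof -
  assume "unitary_mat d U"
  then have U: "U \<in> carrier_mat d d" "mat_adjoint U * U = 1\<^sub>m d" by (auto simp: unitary_mat_def)
  have "(mat_adjoint U * U) $$ (i, j) = kmult d (kadj (ker U)) (ker U) i j" if "i < d" "j < d" for i j
    using U(1) that by (auto simp: scalar_prod_def kmult_def kadj_def atLeast0LessThan)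
  then show ?thesis unfolding U(2) kunitary_def keq_def kid_def by (metis index_one_mat(1))
qed

lemma unitary_mat_mult: "unitary_mat d U \<Longrightarrow> unitary_mat d V \<Longrightarrow> unitary_mat d (U * V)"
proof -
  assume u: "unitary_mat d U" and v: "unitary_mat d V"
  then have c: "U \<in> carrier_mat d d" "V \<in> carrier_mat d d" by (auto simp: unitary_mat_def)
  have "kunitary d (kmult d (ker U) (ker V))"
    using unitary_mat_kernel[OF u] unitary_mat_kernel[OF v] by (rule kunitary_kmult)
  then have "unitary_mat d (kmat d (kmult d (ker U) (ker V)))" by (rule unitary_kmat)
  also have "kmat d (kmult d (ker U) (ker V)) = U * V"
    using c by (intro eq_matI) (auto simp: kmult_def scalar_prod_def atLeast0LessThan)
  finally show ?thesis .
qed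

lemma run_alg_cong:
  assumes "work_dim alg = work_dim alg'" "\<And>t. t \<le> T \<Longrightarrow> gate alg t = gate alg' t"
  shows "run_alg n alg A T = run_alg n alg' A T"
  using assms(2)
proof (induction T)
  case 0
  then show ?case using assms(1) by (simp add: total_dim_def)
next
  case (Suc T)
  then show ?case using assms(1) by (simp add: query_def)
qed

lemma query_dim [simp]:
  assumes "A \<in> carrier_mat (2 ^ n) (2 ^ n)"
  shows "query n alg A \<in> carrier_mat (total_dim n alg) (total_dim n alg)"
  using assms by (auto simp: query_def controlled_def kron_def total_dim_def)

lemma run_alg_dim:
  assumes "valid_alg n alg" "A \<in> carrier_mat (2 ^ n) (2 ^ n)" "t \<le> num_queries alg"
  shows "run_alg n alg A t \<in> carrier_vec (total_dim n alg)"
  using assms(3)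
proof (induction t)
  case 0
  have "gate alg 0 \<in> carrier_mat (total_dim n alg) (total_dim n alg)"
    using assms(1) by (auto simp: valid_alg_def unitary_mat_def)
  then show ?case by simp
next
  case (Suc t)
  have "gate alg (Suc t) \<in> carrier_mat (total_dim n alg) (total_dim n alg)"
    using assms(1) Suc by (auto simp: valid_alg_def unitary_mat_def)
  then show ?case using query_dim[OF assms(2), of alg] Suc by simp
qed

lemma kid_unitary: "kunitary d kid"
  unfolding kunitary_def using keq_kid(1)[of d "kadj kid"] by (auto simp: keq_def kadj_def kid_def)

lemma reach_init:
  assumes "kunitary (w * (2 * 2 ^ n)) K" "0 < w"
  shows "reach n w 0 (\<lambda>A i. K i 0)"
proof -
  let ?d = "w * (2 * 2 ^ n)"
  define alg where "alg = \<lparr>work_dim = w, num_queries = 0, gate = (\<lambda>_. kmat ?d K), announce = (\<lambda>_ _. 0)\<rparr>"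
  have td: "total_dim n alg = ?d" by (simp add: alg_def total_dim_def)
  have "valid_alg n alg" unfolding valid_alg_def td using assms unitary_kmat by (simp add: alg_def)
  moreover have "run_alg n alg A 0 $ i = K i 0" if "i < ?d" for A i
  proof -
    have "(kmat ?d K *\<^sub>v unit_vec ?d 0) $ i = (\<Sum>j<?d. K i j * (if j = 0 then 1 else 0))"
      using that by (auto simp: scalar_prod_def unit_vec_def atLeast0LessThan intro!: sum.cong)
    also have "\<dots> = (\<Sum>j<?d. kid j 0 * K i j)" by (intro sum.cong) (auto simp: kid_def)
    also have "\<dots> = K i 0" by (rule sum_kid) (use assms in simp)
    finally show ?thesis by (simp add: td) (simp add: alg_def)
  qed
  ultimately show ?thesis unfolding reach_def by (intro exI[of _ alg]) (auto simp: alg_def)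
qed

text \<open>The unitary is absorbed into the last gate, so it costs no query.\<close>

lemma reach_unitary:
  assumes "reach n w T \<Psi>" and K: "kunitary (w * (2 * 2 ^ n)) K"
  shows "reach n w T (\<lambda>A i. \<Sum>j<w * (2 * 2 ^ n). K i j * \<Psi> A j)"
proof -
  let ?d = "w * (2 * 2 ^ n)"
  obtain alg where alg: "work_dim alg = w" "num_queries alg = T" "valid_alg n alg"
    and run: "\<And>A i. A \<in> carrier_mat (2 ^ n) (2 ^ n) \<Longrightarrow> i < ?d \<Longrightarrow> run_alg n alg A T $ i = \<Psi> A i"
    using assms(1) unfolding reach_def by auto
  define alg' where "alg' = alg\<lparr>gate := (gate alg)(T := kmat ?d K * gate alg T)\<rparr>"
  have td: "total_dim n alg = ?d" "total_dim n alg' = ?d" by (simp_all add: alg'_def total_dim_def alg)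
  have uK: "unitary_mat ?d (kmat ?d K)" by (rule unitary_kmat[OF K])
  have G: "unitary_mat ?d (gate alg t)" if "t \<le> T" for t using alg that by (auto simp: valid_alg_def td)
  then have Gc: "gate alg T \<in> carrier_mat ?d ?d" by (auto simp: unitary_mat_def)
  have v: "valid_alg n alg'"
    using alg G unitary_mat_mult[OF uK G] by (auto simp: valid_alg_def td) (auto simp: alg'_def)
  have r: "run_alg n alg' A T = kmat ?d K *\<^sub>v run_alg n alg A T" if A: "A \<in> carrier_mat (2 ^ n) (2 ^ n)" for A
  proof (cases T)
    case 0
    have "(kmat ?d K * gate alg T) *\<^sub>v unit_vec ?d 0 = kmat ?d K *\<^sub>v (gate alg T *\<^sub>v unit_vec ?d 0)"
      by (rule assoc_mult_mat_vec) (use Gc in auto)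
    then show ?thesis unfolding 0 by (simp add: td) (simp add: alg'_def 0)
  next
    case (Suc t)
    have e: "run_alg n alg' A t = run_alg n alg A t" by (rule run_alg_cong) (auto simp: alg'_def Suc)
    let ?v = "query n alg A *\<^sub>v run_alg n alg A t"
    have "run_alg n alg A t \<in> carrier_vec ?d" using run_alg_dim[OF alg(3) A, of t] alg Suc td by simp
    then have vc: "?v \<in> carrier_vec ?d" using query_dim[OF A, of alg] td by auto
    have "(kmat ?d K * gate alg T) *\<^sub>v ?v = kmat ?d K *\<^sub>v (gate alg T *\<^sub>v ?v)"
      by (rule assoc_mult_mat_vec) (use Gc vc in auto)
    moreover have "query n alg' A = query n alg A" by (simp add: query_def alg'_def)
    ultimately show ?thesis unfolding Suc by (simp add: e) (simp add: alg'_def Suc)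
  qed
  have "run_alg n alg' A T $ i = (\<Sum>j<?d. K i j * \<Psi> A j)" if A: "A \<in> carrier_mat (2 ^ n) (2 ^ n)" and i: "i < ?d" for A i
  proof -
    have "run_alg n alg A T \<in> carrier_vec ?d" using run_alg_dim[OF alg(3) A, of T] alg td by simp
    then show ?thesis unfolding r[OF A] using i run[OF A]
      by (auto simp: scalar_prod_def atLeast0LessThan intro!: sum.cong)
  qed
  then show ?thesis unfolding reach_def using v alg by (intro exI[of _ alg']) (auto simp: alg'_def)
qed

lemma sum_mult_split: "(\<Sum>j<w * M. f j) = (\<Sum>h<w. \<Sum>q<M. f (h * M + q))"
  for f :: "nat \<Rightarrow> 'a :: comm_monoid_add"
proof (induction w)
  case (Suc w)
  have "(\<Sum>j<Suc w * M. f j) = (\<Sum>j\<in>{..<w * M} \<union> {w * M..<w * M + M}. f j)"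
    by (rule sum.cong) auto
  also have "\<dots> = (\<Sum>j<w * M. f j) + (\<Sum>j\<in>{w * M..<w * M + M}. f j)"
    by (rule sum.union_disjoint) auto
  also have "(\<Sum>j\<in>{w * M..<w * M + M}. f j) = (\<Sum>q<M. f (w * M + q))"
    by (rule sum.reindex_bij_witness[of _ "\<lambda>q. w * M + q" "\<lambda>j. j - w * M"]) auto
  finally show ?case using Suc by simp
qed simp

lemma div_mod_less_mult:
  fixes i w M :: nat
  assumes "i < w * M" shows "i div M < w" "i mod M < M" "0 < M"
proof -
  show M: "0 < M" using assms by (cases M) auto
  show "i div M < w" using assms by (simp add: less_mult_imp_div_less)
  show "i mod M < M" using M by simp
qed

text \<open>The new query is followed by an identity gate. It acts on the low-order digit modulo
  \<open>2 * 2 ^ n\<close>, which holds the control qubit and the query register.\<close>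

lemma reach_query:
  assumes "reach n w T \<Psi>" "0 < w"
  shows "reach n w (Suc T) (\<lambda>A i. \<Sum>q<2 * 2 ^ n. controlled n A $$ (i mod (2 * 2 ^ n), q) * \<Psi> A (i div (2 * 2 ^ n) * (2 * 2 ^ n) + q))"
proof -
  let ?M = "2 * 2 ^ n :: nat"
  let ?d = "w * ?M"
  obtain alg where alg: "work_dim alg = w" "num_queries alg = T" "valid_alg n alg"
    and run: "\<And>A i. A \<in> carrier_mat (2 ^ n) (2 ^ n) \<Longrightarrow> i < ?d \<Longrightarrow> run_alg n alg A T $ i = \<Psi> A i"
    using assms(1) unfolding reach_def by auto
  define alg' where "alg' = alg\<lparr>gate := (gate alg)(Suc T := 1\<^sub>m ?d), num_queries := Suc T\<rparr>"
  have td: "total_dim n alg = ?d" "total_dim n alg' = ?d" by (simp_all add: alg'_def total_dim_def alg)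
  have "kmat ?d kid = 1\<^sub>m ?d" by (rule eq_matI) (auto simp: kid_def)
  then have u1: "unitary_mat ?d (1\<^sub>m ?d)" using unitary_kmat[OF kid_unitary, of ?d] by simp
  have v: "valid_alg n alg'"
    using alg u1 by (auto simp: valid_alg_def td) (auto simp: alg'_def le_Suc_eq)
  have "run_alg n alg' A (Suc T) $ i
      = (\<Sum>q<?M. controlled n A $$ (i mod ?M, q) * \<Psi> A (i div ?M * ?M + q))"
    if A: "A \<in> carrier_mat (2 ^ n) (2 ^ n)" and i: "i < ?d" for A i
  proof -
    have e: "run_alg n alg' A T = run_alg n alg A T" by (rule run_alg_cong) (auto simp: alg'_def)
    let ?v = "run_alg n alg A T"
    have vc: "?v \<in> carrier_vec ?d" using run_alg_dim[OF alg(3) A, of T] alg td by simp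
    have qc: "query n alg' A \<in> carrier_mat ?d ?d" using query_dim[OF A, of alg'] td by simp
    have cd: "dim_row (controlled n A) = ?M" "dim_col (controlled n A) = ?M"
      using A by (auto simp: controlled_def)
    have wd: "work_dim alg' = w" by (simp add: alg'_def alg)
    note im = div_mod_less_mult[OF i]
    have "run_alg n alg' A (Suc T) $ i = (query n alg' A *\<^sub>v ?v) $ i"
    proof -
      have "query n alg' A *\<^sub>v ?v \<in> carrier_vec ?d" using qc vc by auto
      then show ?thesis by (simp add: e) (simp add: alg'_def)
    qed
    also have "\<dots> = (\<Sum>j<?d. query n alg' A $$ (i, j) * ?v $ j)"
      using qc vc i by (auto simp: scalar_prod_def atLeast0LessThan intro!: sum.cong)
    also have "\<dots> = (\<Sum>h<w. \<Sum>q<?M. query n alg' A $$ (i, h * ?M + q) * ?v $ (h * ?M + q))"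
      by (rule sum_mult_split)
    also have "\<dots> = (\<Sum>h<w. \<Sum>q<?M. (if i div ?M = h then 1 else 0) * (controlled n A $$ (i mod ?M, q) * \<Psi> A (h * ?M + q)))"
    proof (intro sum.cong refl)
      fix h q assume "h \<in> {..<w}" "q \<in> {..<?M}"
      then have hq: "h < w" "q < ?M" by auto
      then have "Suc h * ?M \<le> w * ?M" by (intro mult_right_mono) auto
      then have lt: "h * ?M + q < ?d" using hq by simp
      have dm: "(h * ?M + q) div ?M = h" "(h * ?M + q) mod ?M = q" using hq by auto
      have "query n alg' A $$ (i, h * ?M + q) = (if i div ?M = h then 1 else 0) * controlled n A $$ (i mod ?M, q)"
        using i lt im(1) hq(1) dm unfolding query_def kron_def wd cd by simp
      then show "query n alg' A $$ (i, h * ?M + q) * ?v $ (h * ?M + q)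
          = (if i div ?M = h then 1 else 0) * (controlled n A $$ (i mod ?M, q) * \<Psi> A (h * ?M + q))"
        using run[OF A lt] by simp
    qed
    also have "\<dots> = (\<Sum>h<w. kid h (i div ?M) * (\<Sum>q<?M. controlled n A $$ (i mod ?M, q) * \<Psi> A (h * ?M + q)))"
      unfolding sum_distrib_left by (intro sum.cong refl) (auto simp: kid_def)
    also have "\<dots> = (\<Sum>q<?M. controlled n A $$ (i mod ?M, q) * \<Psi> A (i div ?M * ?M + q))"
      by (rule sum_kid[OF im(1)])
    finally show ?thesis .
  qed
  then show ?thesis unfolding reach_def using v alg by (intro exI[of _ alg']) (auto simp: alg'_def)
qed

lemma reach_cong:
  assumes "reach n w T \<Psi>"
    and "\<And>A i. A \<in> carrier_mat (2 ^ n) (2 ^ n) \<Longrightarrow> i < w * (2 * 2 ^ n) \<Longrightarrow> \<Psi> A i = \<Psi>' A i"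
  shows "reach n w T \<Psi>'"
  using assms unfolding reach_def by (metis (no_types, lifting))

text \<open>Block-diagonal unitaries; the low digit acts as the control.\<close>

lemma kunitary_tensor:
  assumes "\<And>b. b < M \<Longrightarrow> kunitary w (H b)" and "kunitary M K"
  shows "kunitary (w * M) (\<lambda>i j. H (j mod M) (i div M) (j div M) * K (i mod M) (j mod M))"
  unfolding kunitary_def keq_def
proof (intro allI impI)
  fix i j assume i: "i < w * M" and j: "j < w * M"
  note im = div_mod_less_mult[OF i] and jm = div_mod_less_mult[OF j]
  let ?U = "\<lambda>i j. H (j mod M) (i div M) (j div M) * K (i mod M) (j mod M)"
  let ?Hs = "\<Sum>h<w. cnj (H (i mod M) h (i div M)) * H (j mod M) h (j div M)"
  have "kmult (w * M) (kadj ?U) ?U i j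
      = (\<Sum>h<w. \<Sum>q<M. (cnj (H (i mod M) h (i div M)) * H (j mod M) h (j div M)) * (cnj (K q (i mod M)) * K q (j mod M)))"
    unfolding kmult_def kadj_def sum_mult_split by (intro sum.cong refl) simp
  also have "\<dots> = ?Hs * kmult M (kadj K) K (i mod M) (j mod M)"
    unfolding kmult_def kadj_def sum_product ..
  also have "\<dots> = ?Hs * kid (i mod M) (j mod M)"
    using assms(2) im(2) jm(2) by (simp add: kunitary_def keq_def)
  also have "\<dots> = kid i j"
  proof (cases "i mod M = j mod M")
    case True
    have "?Hs = kmult w (kadj (H (j mod M))) (H (j mod M)) (i div M) (j div M)"
      unfolding True kmult_def kadj_def ..
    also have "\<dots> = kid (i div M) (j div M)"
      using assms(1)[OF jm(2)] im(1) jm(1) by (simp add: kunitary_def keq_def)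
    finally have Hs: "?Hs = kid (i div M) (j div M)" .
    have "i = j \<longleftrightarrow> i div M = j div M" using True by (metis div_mult_mod_eq)
    then show ?thesis unfolding Hs using True by (simp add: kid_def)
  next
    case False
    then have "i \<noteq> j" by auto
    then show ?thesis using False by (simp add: kid_def)
  qed
  finally show "kmult (w * M) (kadj ?U) ?U i j = kid i j" .
qed

text \<open>The space may be factored at any place, so the low-order factor can contain part of the
  work register.\<close>

lemma reach_low:
  assumes r: "reach n w T \<Psi>" and d: "w * (2 * 2 ^ n) = v * M" and K: "kunitary M K"
  shows "reach n w T (\<lambda>A i. \<Sum>q<M. K (i mod M) q * \<Psi> A (i div M * M + q))"
proof -
  have u: "kunitary (w * (2 * 2 ^ n)) (\<lambda>i j. kid (i div M) (j div M) * K (i mod M) (j mod M))"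
    unfolding d using kunitary_tensor[of M v "\<lambda>_. kid" K] K kid_unitary by simp
  show ?thesis
  proof (rule reach_cong[OF reach_unitary[OF r u]])
    fix A i assume "i < w * (2 * 2 ^ n)"
    then have i: "i < v * M" unfolding d .
    have "(\<Sum>j<w * (2 * 2 ^ n). kid (i div M) (j div M) * K (i mod M) (j mod M) * \<Psi> A j)
        = (\<Sum>h<v. kid h (i div M) * (\<Sum>q<M. K (i mod M) q * \<Psi> A (h * M + q)))"
      unfolding d sum_mult_split sum_distrib_left by (intro sum.cong refl) (auto simp: kid_def)
    also have "\<dots> = (\<Sum>q<M. K (i mod M) q * \<Psi> A (i div M * M + q))"
      by (rule sum_kid[OF div_mod_less_mult(1)[OF i]])
    finally show "(\<Sum>j<w * (2 * 2 ^ n). kid (i div M) (j div M) * K (i mod M) (j mod M) * \<Psi> A j)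
        = (\<Sum>q<M. K (i mod M) q * \<Psi> A (i div M * M + q))" .
  qed
qed

lemma reach_high:
  assumes r: "reach n w T \<Psi>" and d: "w * (2 * 2 ^ n) = v * M" and K: "kunitary v K"
  shows "reach n w T (\<lambda>A i. \<Sum>h<v. K (i div M) h * \<Psi> A (h * M + i mod M))"
proof -
  have u: "kunitary (w * (2 * 2 ^ n)) (\<lambda>i j. K (i div M) (j div M) * kid (i mod M) (j mod M))"
    unfolding d using kunitary_tensor[of M v "\<lambda>_. K" kid] K kid_unitary by simp
  show ?thesis
  proof (rule reach_cong[OF reach_unitary[OF r u]])
    fix A i assume "i < w * (2 * 2 ^ n)"
    then have i: "i < v * M" unfolding d .
    have "(\<Sum>j<w * (2 * 2 ^ n). K (i div M) (j div M) * kid (i mod M) (j mod M) * \<Psi> A j)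
        = (\<Sum>h<v. \<Sum>q<M. kid q (i mod M) * (K (i div M) h * \<Psi> A (h * M + q)))"
      unfolding d sum_mult_split by (intro sum.cong refl) (auto simp: kid_def)
    also have "\<dots> = (\<Sum>h<v. K (i div M) h * \<Psi> A (h * M + i mod M))"
      by (intro sum.cong refl sum_kid div_mod_less_mult(2)[OF i])
    finally show "(\<Sum>j<w * (2 * 2 ^ n). K (i div M) (j div M) * kid (i mod M) (j mod M) * \<Psi> A j)
        = (\<Sum>h<v. K (i div M) h * \<Psi> A (h * M + i mod M))" .
  qed
qed

section \<open>Permutation gates and many copies of a state\<close>

text \<open>A relocation that is prescribed only on the basis states carrying amplitude becomes a
  permutation, and hence a gate.\<close>

lemma extend_injection:
  fixes f :: "nat \<Rightarrow> nat"
  assumes "a \<le> n" "inj_on f {..<a}" "f ` {..<a} \<subseteq> {..<n}"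
  obtains p where "bij_betw p {..<n} {..<n}" "\<And>i. i < a \<Longrightarrow> p i = f i"
proof -
  have c: "card ({..<n} - {..<a}) = card ({..<n} - f ` {..<a})"
    using assms card_image[OF assms(2)] by (simp add: card_Diff_subset)
  have "\<exists>g. bij_betw g ({..<n} - {..<a}) ({..<n} - f ` {..<a})"
    by (rule finite_same_card_bij[OF _ _ c]) auto
  then obtain g where g: "bij_betw g ({..<n} - {..<a}) ({..<n} - f ` {..<a})" ..
  define p where "p = (\<lambda>i. if i < a then f i else g i)"
  have 1: "bij_betw p {..<a} (f ` {..<a})"
    using assms(2) by (subst bij_betw_cong[of _ _ f]) (auto simp: p_def bij_betw_def)
  have 2: "bij_betw p ({..<n} - {..<a}) ({..<n} - f ` {..<a})"
    using g by (subst bij_betw_cong[of _ _ g]) (auto simp: p_def)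
  have "bij_betw p ({..<a} \<union> ({..<n} - {..<a})) (f ` {..<a} \<union> ({..<n} - f ` {..<a}))"
    by (rule bij_betw_combine[OF 1 2]) auto
  moreover have "{..<a} \<union> ({..<n} - {..<a}) = {..<n}" "f ` {..<a} \<union> ({..<n} - f ` {..<a}) = {..<n}"
    using assms by auto
  ultimately have "bij_betw p {..<n} {..<n}" by simp
  then show ?thesis using that by (simp add: p_def)
qed

lemma kunitary_permutation:
  assumes p: "bij_betw p {..<n} {..<n}"
  shows "kunitary n (\<lambda>i j. kid i (p j))"
  unfolding kunitary_def keq_def
proof (intro allI impI)
  fix i j assume ij: "i < n" "j < n"
  have pi: "p i < n" "p j < n" using ij p by (auto simp: bij_betw_def)
  have "kmult n (kadj (\<lambda>i j. kid i (p j))) (\<lambda>i j. kid i (p j)) i j = (\<Sum>k<n. kid k (p i) * kid k (p j))"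
    unfolding kmult_def kadj_def by (intro sum.cong refl) (simp add: kid_def)
  also have "\<dots> = kid (p i) (p j)" by (rule sum_kid[OF pi(1)])
  also have "\<dots> = kid i j" using p ij by (auto simp: kid_def bij_betw_def inj_on_def)
  finally show "kmult n (kadj (\<lambda>i j. kid i (p j))) (\<lambda>i j. kid i (p j)) i j = kid i j" .
qed

text \<open>Tensor powers of a vector, an operator and a distribution on \<open>{..<d}\<close>, indexed by the base \<open>d\<close> digits.\<close>

primrec tpow :: "nat \<Rightarrow> (nat \<Rightarrow> 'a :: comm_semiring_1) \<Rightarrow> nat \<Rightarrow> nat \<Rightarrow> 'a" where
  "tpow d f 0 h = (if h = 0 then 1 else 0)"
| "tpow d f (Suc t) h = tpow d f t (h div d) * f (h mod d)"

primrec kpow :: "nat \<Rightarrow> kernel \<Rightarrow> nat \<Rightarrow> kernel" where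
  "kpow d U 0 i j = 1"
| "kpow d U (Suc t) i j = kpow d U t (i div d) (j div d) * U (i mod d) (j mod d)"

lemma tpow_zero: "0 < d \<Longrightarrow> d ^ t \<le> h \<Longrightarrow> tpow d f t h = 0"
proof (induction t arbitrary: h)
  case (Suc t)
  then have "d ^ t \<le> h div d" by (simp add: less_eq_div_iff_mult_less_eq mult.commute)
  then show ?case using Suc by simp
qed auto

lemma sum_tpow: "(\<Sum>h<d ^ t. tpow d f t h) = (\<Sum>u<d. f u) ^ t"
proof (induction t)
  case (Suc t)
  have "(\<Sum>h<d ^ Suc t. tpow d f (Suc t) h) = (\<Sum>h<d ^ t. \<Sum>q<d. tpow d f t h * f q)"
    unfolding power_Suc mult.commute[of d] sum_mult_split by (intro sum.cong refl) simp
  also have "\<dots> = (\<Sum>u<d. f u) ^ Suc t"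
    unfolding sum_product[symmetric] Suc by (simp add: mult.commute)
  finally show ?case .
qed simp

lemma tpow_times: "tpow d f t h * tpow d g t h = tpow d (\<lambda>u. f u * g u) t h"
proof (induction t arbitrary: h)
  case (Suc t)
  have "tpow d f (Suc t) h * tpow d g (Suc t) h
      = (tpow d f t (h div d) * tpow d g t (h div d)) * (f (h mod d) * g (h mod d))"
    by (simp add: mult_ac)
  then show ?case unfolding Suc by simp
qed simp

lemma tpow_cong: "0 < d \<Longrightarrow> (\<And>u. u < d \<Longrightarrow> f u = g u) \<Longrightarrow> tpow d f t h = tpow d g t h"
  by (induction t arbitrary: h) simp_all

lemma cmod_tpow: "(cmod (tpow d f t h))\<^sup>2 = tpow d (\<lambda>u. (cmod (f u))\<^sup>2) t h"
  by (induction t arbitrary: h) (simp_all add: norm_mult power_mult_distrib)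

lemma tpow_nonneg: "(\<And>u. 0 \<le> f u) \<Longrightarrow> 0 \<le> tpow d f t h" for f :: "nat \<Rightarrow> real"
  by (induction t arbitrary: h) simp_all

lemma tpow_add: "0 < d \<Longrightarrow> tpow d f (l + t) h = tpow d f t (h div d ^ l) * tpow d f l (h mod d ^ l)"
proof (induction l arbitrary: h)
  case (Suc l)
  have "h mod (d * d ^ l) = d * (h div d mod d ^ l) + h mod d" by (rule mod_mult2_eq)
  then have m: "h mod d ^ Suc l div d = h div d mod d ^ l" "h mod d ^ Suc l mod d = h mod d"
    using Suc.prems by simp_all
  have dd: "h div d ^ Suc l = h div d div d ^ l" by (simp add: div_mult2_eq)
  show ?case using Suc.IH[OF Suc.prems, of "h div d"] by (simp only: add_Suc tpow.simps(2) m dd mult.assoc)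
qed simp

text \<open>Reading the digits in groups of \<open>l\<close> turns \<open>l * k\<close> copies into
  \<open>k\<close> units of \<open>l\<close> copies without moving an index.\<close>

lemma tpow_tpow: "0 < d \<Longrightarrow> tpow d f (l * k) h = tpow (d ^ l) (tpow d f l) k h"
proof (induction k arbitrary: h)
  case (Suc k)
  have "tpow d f (l * Suc k) h = tpow d f (l + l * k) h" by simp
  also have "\<dots> = tpow d f (l * k) (h div d ^ l) * tpow d f l (h mod d ^ l)" by (rule tpow_add[OF Suc.prems])
  finally show ?case using Suc by simp
qed simp

lemma kunitary_kpow: "kunitary d U \<Longrightarrow> kunitary (d ^ t) (kpow d U t)"
proof (induction t)
  case 0
  then show ?case by (simp add: kunitary_def keq_def kmult_def kadj_def kid_def)
next
  case (Suc t)
  then show ?case using kunitary_tensor[of d "d ^ t" "\<lambda>_. kpow d U t" U] by (simp add: mult.commute)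
qed

lemma kpow_tpow:
  "i < d ^ t \<Longrightarrow> (\<Sum>j<d ^ t. kpow d U t i j * tpow d \<psi> t j) = tpow d (\<lambda>i. \<Sum>j<d. U i j * \<psi> j) t i"
proof (induction t arbitrary: i)
  case (Suc t)
  then have "i < d ^ t * d" by (simp add: mult.commute)
  note im = div_mod_less_mult[OF this]
  have "(\<Sum>j<d ^ Suc t. kpow d U (Suc t) i j * tpow d \<psi> (Suc t) j)
      = (\<Sum>h<d ^ t. \<Sum>q<d. (kpow d U t (i div d) h * tpow d \<psi> t h) * (U (i mod d) q * \<psi> q))"
    unfolding power_Suc mult.commute[of d] sum_mult_split by (intro sum.cong refl) (simp add: mult_ac)
  also have "\<dots> = tpow d (\<lambda>i. \<Sum>j<d. U i j * \<psi> j) (Suc t) i"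
    unfolding sum_product[symmetric] Suc.IH[OF im(1)] by simp
  finally show ?case .
qed simp

text \<open>The copies are made one after the other in the low-order register of dimension
  \<open>D\<close>, which consists of an ancilla, the control and the query register. A round
  prepares, queries and rotates there, then shifts the result into the higher digits; this returns
  the low register to its first basis state for the next round.\<close>

lemma multi_copy:
  fixes n m :: nat
  defines "M \<equiv> 2 * 2 ^ n"
  defines "D \<equiv> 2 ^ n * M"
  assumes K0: "kunitary D K0" and KB: "kunitary D KB"
    and \<psi>: "\<And>A r. A \<in> carrier_mat (2 ^ n) (2 ^ n) \<Longrightarrow> r < D \<Longrightarrow>
      \<psi> A r = (\<Sum>r'<D. KB r r' * (\<Sum>q<M. controlled n A $$ (r' mod M, q) * K0 (r' div M * M + q) 0))"
  shows "t \<le> m \<Longrightarrow> reach n (D ^ m * 2 ^ n) t (\<lambda>A i. if i mod D = 0 then tpow D (\<psi> A) t (i div D) else 0)"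
proof (induction t)
  case 0
  have w: "0 < D ^ m * 2 ^ n" by (simp add: D_def M_def)
  have D: "0 < D" by (simp add: D_def M_def)
  show ?case
  proof (rule reach_cong[OF reach_init[OF kid_unitary w]])
    fix A i
    have "i = 0 \<longleftrightarrow> i mod D = 0 \<and> i div D = 0" by (metis div_0 mod_0 div_mult_mod_eq mult_0 add_0)
    then show "kid i 0 = (if i mod D = 0 then tpow D (\<psi> A) 0 (i div D) else 0)" by (auto simp: kid_def)
  qed
next
  case (Suc t)
  let ?w = "D ^ m * 2 ^ n"
  have D: "0 < D" and M: "0 < M" by (simp_all add: D_def M_def)
  have dim: "?w * (2 * 2 ^ n) = D ^ m * D" by (simp add: D_def M_def mult_ac)
  note r0 = Suc.IH[OF Suc_leD[OF Suc.prems]]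
  have r1: "reach n ?w t (\<lambda>A i. K0 (i mod D) 0 * tpow D (\<psi> A) t (i div D))"
  proof (rule reach_cong[OF reach_low[OF r0 dim K0]])
    fix A i
    have "(\<Sum>q<D. K0 (i mod D) q * (if (i div D * D + q) mod D = 0 then tpow D (\<psi> A) t ((i div D * D + q) div D) else 0))
        = (\<Sum>q<D. kid q 0 * (K0 (i mod D) q * tpow D (\<psi> A) t (i div D)))"
      by (intro sum.cong refl) (auto simp: kid_def)
    also have "\<dots> = K0 (i mod D) 0 * tpow D (\<psi> A) t (i div D)" by (rule sum_kid[OF D])
    finally show "(\<Sum>q<D. K0 (i mod D) q * (if (i div D * D + q) mod D = 0 then tpow D (\<psi> A) t ((i div D * D + q) div D) else 0))
        = K0 (i mod D) 0 * tpow D (\<psi> A) t (i div D)" .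
  qed
  define X where "X = (\<lambda>A r. \<Sum>q<M. controlled n A $$ (r mod M, q) * K0 (r div M * M + q) 0)"
  have w: "0 < ?w" by (simp add: D_def M_def)
  have r2: "reach n ?w (Suc t) (\<lambda>A i. X A (i mod D) * tpow D (\<psi> A) t (i div D))"
  proof (rule reach_cong[OF reach_query[OF r1 w]])
    fix A i
    have a: "i mod D div M * M + q < D" "(i div M * M + q) = i div D * D + (i mod D div M * M + q)"
      "i mod M = i mod D mod M" if q: "q < M" for q
    proof -
      have "i mod D < 2 ^ n * M" using D unfolding D_def[symmetric] by simp
      then have "i mod D div M < 2 ^ n" by (rule less_mult_imp_div_less)
      then have "Suc (i mod D div M) * M \<le> 2 ^ n * M" by (intro mult_right_mono) auto
      then show "i mod D div M * M + q < D" using q unfolding D_def by simp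
      have "i div M = (i div D * D + i mod D) div M" by simp
      also have "\<dots> = (i div D * 2 ^ n * M + i mod D) div M" by (simp add: D_def mult.assoc)
      also have "\<dots> = i div D * 2 ^ n + i mod D div M" using M by simp
      finally show "(i div M * M + q) = i div D * D + (i mod D div M * M + q)"
        by (simp add: D_def algebra_simps)
      show "i mod M = i mod D mod M" unfolding D_def by (simp add: mod_mod_cancel)
    qed
    have dm: "(i div M * M + q) mod D = i mod D div M * M + q" "(i div M * M + q) div D = i div D" if "q < M" for q
      unfolding a(2)[OF that] using a(1)[OF that] D by simp_all
    show "(\<Sum>q<2 * 2 ^ n. controlled n A $$ (i mod (2 * 2 ^ n), q) *
        (K0 ((i div (2 * 2 ^ n) * (2 * 2 ^ n) + q) mod D) 0 * tpow D (\<psi> A) t ((i div (2 * 2 ^ n) * (2 * 2 ^ n) + q) div D)))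
      = X A (i mod D) * tpow D (\<psi> A) t (i div D)"
      unfolding M_def[symmetric] X_def sum_distrib_right
    proof (intro sum.cong refl)
      fix q assume "q \<in> {..<M}"
      then have q: "q < M" by simp
      show "controlled n A $$ (i mod M, q) * (K0 ((i div M * M + q) mod D) 0 * tpow D (\<psi> A) t ((i div M * M + q) div D))
        = controlled n A $$ (i mod D mod M, q) * K0 (i mod D div M * M + q) 0 * tpow D (\<psi> A) t (i div D)"
        unfolding dm[OF q] a(3)[OF q] mult.assoc ..
    qed
  qed
  have r3: "reach n ?w (Suc t) (\<lambda>A i. tpow D (\<psi> A) (Suc t) i)"
  proof (rule reach_cong[OF reach_low[OF r2 dim KB]])
    fix A :: "complex mat" and i assume A: "A \<in> carrier_mat (2 ^ n) (2 ^ n)"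
    have "(\<Sum>q<D. KB (i mod D) q * (X A ((i div D * D + q) mod D) * tpow D (\<psi> A) t ((i div D * D + q) div D)))
      = (\<Sum>q<D. KB (i mod D) q * X A q) * tpow D (\<psi> A) t (i div D)"
      unfolding sum_distrib_right by (intro sum.cong refl) (simp add: mult.assoc)
    also have "\<dots> = \<psi> A (i mod D) * tpow D (\<psi> A) t (i div D)" using \<psi>[OF A, of "i mod D"] D by (simp add: X_def)
    finally show "(\<Sum>q<D. KB (i mod D) q * (X A ((i div D * D + q) mod D) * tpow D (\<psi> A) t ((i div D * D + q) div D)))
      = tpow D (\<psi> A) (Suc t) i" by (simp add: mult.commute)
  qed
  have dim': "D ^ Suc m = D ^ m * D" by simp
  \<comment> \<open>Multiplication by \<open>D\<close> shifts the digits by one place. It is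
    prescribed below \<open>D ^ Suc t\<close>, where the state is supported, and extended
    arbitrarily to a permutation.\<close>
  have e1: "D ^ Suc t \<le> D ^ Suc m" using D Suc.prems by (intro power_increasing) auto
  have e2: "inj_on (\<lambda>i. i * D) {..<D ^ Suc t}" using D by (auto simp: inj_on_def)
  have e3: "(\<lambda>i. i * D) ` {..<D ^ Suc t} \<subseteq> {..<D ^ Suc m}"
  proof
    fix j assume "j \<in> (\<lambda>i. i * D) ` {..<D ^ Suc t}"
    then obtain i where i: "j = i * D" "i < D ^ Suc t" by auto
    have "D ^ Suc t \<le> D ^ m" using D Suc.prems by (intro power_increasing) auto
    then have "i * D < D ^ m * D" using i(2) D by (intro mult_strict_right_mono) auto
    then show "j \<in> {..<D ^ Suc m}" using i by (simp add: mult.commute)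
  qed
  obtain p where p: "bij_betw p {..<D ^ Suc m} {..<D ^ Suc m}" and pf: "\<And>i. i < D ^ Suc t \<Longrightarrow> p i = i * D"
    by (rule extend_injection[OF e1 e2 e3], rule that, assumption, simp)
  have up: "kunitary (?w * (2 * 2 ^ n)) (\<lambda>i j. kid i (p j))"
    unfolding dim dim'[symmetric] by (rule kunitary_permutation[OF p])
  show ?case
  proof (rule reach_cong[OF reach_unitary[OF r3 up]])
    fix A i assume "i < ?w * (2 * 2 ^ n)"
    then have i: "i < D ^ Suc m" unfolding dim dim' .
    then obtain j where j: "j < D ^ Suc m" "i = p j" using p by (auto simp: bij_betw_def)
    let ?T = "\<lambda>j. tpow D (\<psi> A) (Suc t) j"
    have inj: "p k = p j \<longleftrightarrow> k = j" if "k < D ^ Suc m" for k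
      using p j(1) that by (auto simp: bij_betw_def inj_on_def)
    have "(\<Sum>k<?w * (2 * 2 ^ n). kid i (p k) * ?T k) = (\<Sum>k<D ^ Suc m. kid k j * ?T k)"
      unfolding dim dim'[symmetric]
    proof (rule sum.cong[OF refl])
      fix k assume "k \<in> {..<D ^ Suc m}"
      then have "i = p k \<longleftrightarrow> k = j" using inj[of k] unfolding j(2) by auto
      then show "kid i (p k) * ?T k = kid k j * ?T k" by (simp add: kid_def)
    qed
    also have "\<dots> = ?T j" by (rule sum_kid[OF j(1)])
    also have "\<dots> = (if i mod D = 0 then ?T (i div D) else 0)"
    proof (cases "j < D ^ Suc t")
      case True
      then have "i = j * D" using pf j(2) by simp
      then have "i mod D = 0" "i div D = j" using D by simp_all
      then show ?thesis by simp
    next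
      case False
      \<comment> \<open>The index \<open>i\<close> comes from a \<open>j\<close> without amplitude.
        Were \<open>i div D\<close> inside the support, injectivity would identify it with
        \<open>j\<close>.\<close>
      have "?T (i div D) = 0" if "i mod D = 0"
      proof (cases "i div D < D ^ Suc t")
        case True
        have "D ^ Suc t \<le> D ^ Suc m" using D Suc.prems by (intro power_increasing) auto
        then have "p (i div D) = p j \<longleftrightarrow> i div D = j" using True by (intro inj) linarith
        moreover have "p (i div D) = i" using pf[OF True] that by auto
        ultimately have "i div D = j" unfolding j(2)[symmetric] by (rule iffD1)
        then show ?thesis using True False by (simp only:)
      next
        case False
        then show ?thesis by (intro tpow_zero[OF D]) linarith
      qed
      moreover have "?T j = 0" using False by (intro tpow_zero[OF D]) linarith
      ultimately show ?thesis by (simp del: tpow.simps)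
    qed
    finally show "(\<Sum>k<?w * (2 * 2 ^ n). kid i (p k) * ?T k) = (if i mod D = 0 then ?T (i div D) else 0)" .
  qed
qed

text \<open>Applying the controlled query to half of a maximally entangled state and changing to the Bell basis
  produces the Pauli coefficients as amplitudes, next to the reference branch of the idle control qubit.\<close>

definition bell_amp :: "nat \<Rightarrow> complex mat \<Rightarrow> bool \<times> pauli list \<Rightarrow> complex" where
  "bell_amp n A = (\<lambda>(b, s). (if b then (\<Sum>i<2^n. \<Sum>j<2^n. cnj (pker s i j) * A $$ (i, j)) / 2 ^ n
     else if s = replicate n PI then 1 else 0) / sqrt 2)"

lemma sum_ancilla_split:
  "(\<Sum>r<N * (2 * N). f r) = (\<Sum>a<N. \<Sum>i<N. f (a * (2 * N) + i) + f (a * (2 * N) + (N + i)))"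
  for f :: "nat \<Rightarrow> 'a :: comm_monoid_add"
  unfolding sum_mult_split[where w = N and M = "2 * N"] sum_double ..

lemma controlled_index:
  assumes "A \<in> carrier_mat (2 ^ n) (2 ^ n)" "i < 2 ^ n" "j < 2 ^ n"
  shows "controlled n A $$ (i, j) = kid i j" "controlled n A $$ (i, 2 ^ n + j) = 0"
    "controlled n A $$ (2 ^ n + i, j) = 0" "controlled n A $$ (2 ^ n + i, 2 ^ n + j) = A $$ (i, j)"
  using assms by (auto simp: controlled_def kid_def)

text \<open>With \<open>N = 2 ^ n\<close>, an index below \<open>D\<close> reads
  \<open>a * (2 * N) + b * N + i\<close> for ancilla \<open>a\<close>, control \<open>b\<close> and
  query register \<open>i\<close>. \<open>K0\<close> prepares an even superposition of the control
  beside a maximally entangled pair of \<open>a\<close> and \<open>i\<close>; the rows of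
  \<open>KB\<close> are the conjugated Pauli strings, scaled to unit vectors, in either branch of
  the control.\<close>

lemma bell_measurement:
  fixes n :: nat
  defines "M \<equiv> 2 * 2 ^ n"
  defines "D \<equiv> 2 ^ n * M"
  obtains K0 KB e where "kunitary D K0" "kunitary D KB"
    "bij_betw e {..<D} (UNIV \<times> {s. length s = n})"
    "\<And>A r. A \<in> carrier_mat (2 ^ n) (2 ^ n) \<Longrightarrow> r < D \<Longrightarrow>
      bell_amp n A (e r) = (\<Sum>r'<D. KB r r' * (\<Sum>q<M. controlled n A $$ (r' mod M, q) * K0 (r' div M * M + q) 0))"
proof -
  let ?N = "2 ^ n :: nat"
  have N0: "0 < ?N" by simp
  have D2: "D = ?N * (2 * ?N)" by (simp add: D_def M_def)
  have D0: "0 < D" by (simp add: D2)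
  define R where "R = sqrt (2 * 2 ^ n)"
  have R: "R > 0" "R * R = 2 * 2 ^ n" by (simp_all add: R_def)
  define \<phi> :: "nat \<Rightarrow> complex" where "\<phi> = (\<lambda>r. if r mod (2 * ?N) mod ?N = r div (2 * ?N) then 1 / of_real R else 0)"
  have \<phi>: "\<phi> (a * (2 * ?N) + i) = kid i a / of_real R" "\<phi> (a * (2 * ?N) + (?N + i)) = kid i a / of_real R" if "i < ?N" for a i
    using that by (auto simp: \<phi>_def kid_def)
  have "(\<Sum>r<D. (cmod (\<phi> r))\<^sup>2) = (\<Sum>a<?N. \<Sum>i<?N. (if i = a then 2 / (R * R) else 0))"
    unfolding D2 sum_ancilla_split using R(1)
    by (intro sum.cong refl) (simp add: \<phi> kid_def norm_divide power2_eq_square)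
  also have "\<dots> = 1" unfolding R(2) by simp
  finally have \<phi>n: "(\<Sum>r<D. (cmod (\<phi> r))\<^sup>2) = 1" .
  have "Im (\<phi> 0) = 0" by (simp add: \<phi>_def)
  then obtain K0 where K0: "kunitary D K0" and K0c: "\<And>r. r < D \<Longrightarrow> K0 r 0 = \<phi> r"
    using kunitary_first_column[OF \<phi>n _ D0] by blast
  have "card (UNIV \<times> {s :: pauli list. length s = n} :: (bool \<times> pauli list) set) = D"
    by (simp add: card_cartesian_product card_strings D2 power_mult_distrib[symmetric] power_add[symmetric])
  then have "\<exists>e. bij_betw e {..<D} (UNIV \<times> {s :: pauli list. length s = n} :: (bool \<times> pauli list) set)"
    by (intro finite_same_card_bij) simp_all
  then obtain e where e: "bij_betw e {..<D} (UNIV \<times> {s :: pauli list. length s = n} :: (bool \<times> pauli list) set)" ..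
  define S where "S = sqrt (2 ^ n)"
  have S: "S > 0" "S * S = 2 ^ n" by (simp_all add: S_def)
  define KB :: kernel where "KB = (\<lambda>r r'. let (b, s) = e r in
      if (?N \<le> r' mod (2 * ?N)) = b then cnj (pker s (r' mod (2 * ?N) mod ?N) (r' div (2 * ?N))) / of_real S else 0)"
  have KB: "KB r (a * (2 * ?N) + i) = (if fst (e r) then 0 else cnj (pker (snd (e r)) i a) / of_real S)"
    "KB r (a * (2 * ?N) + (?N + i)) = (if fst (e r) then cnj (pker (snd (e r)) i a) / of_real S else 0)"
    if "i < ?N" for r a i
    using that by (auto simp: KB_def case_prod_unfold Let_def)
  have es: "length (snd (e r)) = n" if "r < D" for r
  proof -
    have "e r \<in> UNIV \<times> {s. length s = n}" using bij_betwE[OF e] that by blast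
    then show ?thesis by (auto simp: mem_Times_iff)
  qed
  \<comment> \<open>The rows of \<open>KB\<close> are orthonormal because the Pauli strings are
    orthogonal; unitarity of \<open>KB\<close> itself follows in finite dimension.\<close>
  have "kunitary D (kadj KB)"
    unfolding kunitary_def kadj_kadj keq_def
  proof (intro allI impI)
    fix r r' assume r: "r < D" "r' < D"
    have "kmult D KB (kadj KB) r r'
        = (\<Sum>a<?N. \<Sum>i<?N. (if fst (e r) = fst (e r') then 1 / of_real (S * S) else 0)
            * (cnj (pker (snd (e r)) i a) * pker (snd (e r')) i a))"
      unfolding kmult_def kadj_def D2 sum_ancilla_split by (intro sum.cong refl) (simp add: KB)
    also have "\<dots> = (if fst (e r) = fst (e r') then 1 / of_real (S * S) else 0)
        * (\<Sum>i<?N. \<Sum>a<?N. cnj (pker (snd (e r)) i a) * pker (snd (e r')) i a)"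
      unfolding sum_distrib_left by (rule sum.swap)
    also have "\<dots> = (if e r = e r' then 1 else 0)"
      unfolding pker_orthogonal[OF es[OF r(1)] es[OF r(2)]] S(2) by (auto simp: prod_eq_iff)
    also have "\<dots> = kid r r'"
      using e r by (auto simp: kid_def bij_betw_def inj_on_def)
    finally show "kmult D KB (kadj KB) r r' = kid r r'" .
  qed
  then have uKB: "kunitary D KB" using kunitary_right[of D "kadj KB"] by (simp add: kunitary_def)
  have amp: "bell_amp n A (e r) = (\<Sum>r'<D. KB r r' * (\<Sum>q<M. controlled n A $$ (r' mod M, q) * K0 (r' div M * M + q) 0))"
    if A: "A \<in> carrier_mat ?N ?N" and r: "r < D" for A r
  proof -
    obtain b s where bs: "e r = (b, s)" by force
    have ls: "length s = n" using es[OF r] bs by simp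
    let ?\<chi> = "\<lambda>r'. \<Sum>q<M. controlled n A $$ (r' mod M, q) * K0 (r' div M * M + q) 0"
    have lt: "a * (2 * ?N) + q < D" if "a < ?N" "q < 2 * ?N" for a q
    proof -
      have "Suc a * (2 * ?N) \<le> ?N * (2 * ?N)" using that by (intro mult_right_mono) auto
      then show ?thesis using that unfolding D2 by simp
    qed
    have \<chi>: "?\<chi> (a * (2 * ?N) + i) = kid i a / of_real R" "?\<chi> (a * (2 * ?N) + (?N + i)) = A $$ (i, a) / of_real R"
      if a: "a < ?N" and i: "i < ?N" for a i
    proof -
      have k: "K0 (a * (2 * ?N) + i') 0 = kid i' a / of_real R" "K0 (a * (2 * ?N) + (?N + i')) 0 = kid i' a / of_real R"
        if "i' < ?N" for i' using that a by (simp_all add: K0c lt \<phi>)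
      have "?\<chi> (a * (2 * ?N) + i) = (\<Sum>i'<?N. kid i' i * (kid i' a / of_real R))"
        unfolding M_def sum_double using i
        by (intro sum.cong refl) (auto simp: controlled_index[OF A] k kid_def)
      also have "\<dots> = kid i a / of_real R" by (rule sum_kid[OF i])
      finally show "?\<chi> (a * (2 * ?N) + i) = kid i a / of_real R" .
      have "?\<chi> (a * (2 * ?N) + (?N + i)) = (\<Sum>i'<?N. kid i' a * (A $$ (i, i') / of_real R))"
        unfolding M_def sum_double using i
        by (intro sum.cong refl) (auto simp: controlled_index[OF A] k kid_def)
      also have "\<dots> = A $$ (i, a) / of_real R" by (rule sum_kid[OF a])
      finally show "?\<chi> (a * (2 * ?N) + (?N + i)) = A $$ (i, a) / of_real R" .
    qed
    have RS: "complex_of_real S * complex_of_real R = 2 ^ n * complex_of_real (sqrt 2)"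
    proof -
      have "S * R = 2 ^ n * sqrt 2" unfolding R_def using S(2) by (simp add: S_def[symmetric] real_sqrt_mult)
      then show ?thesis by (metis of_real_mult of_real_numeral of_real_power)
    qed
    have "(\<Sum>r'<D. KB r r' * ?\<chi> r') = (\<Sum>a<?N. \<Sum>i<?N. (cnj (pker s i a) * (if b then A $$ (i, a) else kid i a))
        / (complex_of_real S * complex_of_real R))"
      unfolding D2 sum_ancilla_split by (intro sum.cong refl) (simp add: KB \<chi> bs)
    also have "\<dots> = (\<Sum>i<?N. \<Sum>a<?N. cnj (pker s i a) * (if b then A $$ (i, a) else kid i a)) / (2 ^ n * complex_of_real (sqrt 2))"
      unfolding sum_divide_distrib RS by (rule sum.swap)
    also have "\<dots> = bell_amp n A (e r)"
    proof (cases b)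
      case True
      then show ?thesis by (simp add: bell_amp_def bs)
    next
      case False
      have "(\<Sum>i<?N. \<Sum>a<?N. cnj (pker s i a) * kid i a)
          = (\<Sum>i<?N. \<Sum>a<?N. cnj (pker s i a) * pker (replicate n PI) i a)"
        by (intro sum.cong refl) (simp add: pauli_tensor_identity kid_def)
      also have "\<dots> = (if s = replicate n PI then 2 ^ n else 0)" by (rule pker_orthogonal[OF ls]) simp
      finally show ?thesis using False by (simp add: bell_amp_def bs)
    qed
    finally show ?thesis by (rule sym)
  qed
  show ?thesis by (rule that[OF K0 uKB e amp])
qed

section \<open>Product distributions\<close>

primrec digs :: "nat \<Rightarrow> nat \<Rightarrow> nat \<Rightarrow> nat list" where
  "digs d 0 h = []"
| "digs d (Suc k) h = (h mod d) # digs d k (h div d)"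

lemma length_digs [simp]: "length (digs d k h) = k"
  by (induction k arbitrary: h) auto

lemma sum_tpow_Suc:
  "(\<Sum>h<d ^ Suc k. tpow d p (Suc k) h * g h) = (\<Sum>h<d ^ k. \<Sum>q<d. tpow d p k h * p q * g (h * d + q))"
  unfolding power_Suc mult.commute[of d] sum_mult_split by (intro sum.cong refl) simp

lemma tpow_indicator:
  "h < d ^ k \<Longrightarrow> tpow d (\<lambda>u. if Q u then 0 else 1) k h = (if \<forall>u\<in>set (digs d k h). \<not> Q u then 1 else 0)"
proof (induction k arbitrary: h)
  case (Suc k)
  then have "h < d ^ k * d" by (simp add: mult.commute)
  then have "h div d < d ^ k" by (rule div_mod_less_mult)
  then show ?case using Suc.IH by auto
qed simp

text \<open>Independence: the indicator that all digits avoid \<open>Q\<close> is itself a tensor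
  power.\<close>

lemma prob_all_digits:
  "(\<Sum>h<d ^ k. tpow d p k h * (if \<forall>u\<in>set (digs d k h). \<not> Q u then 1 else 0)) = (\<Sum>u<d. p u * (if Q u then 0 else 1)) ^ k"
proof -
  have "(\<Sum>h<d ^ k. tpow d p k h * (if \<forall>u\<in>set (digs d k h). \<not> Q u then 1 else 0))
      = (\<Sum>h<d ^ k. tpow d (\<lambda>u. p u * (if Q u then 0 else 1)) k h)"
    by (rule sum.cong[OF refl]) (simp only: tpow_indicator[symmetric] lessThan_iff tpow_times)
  then show ?thesis by (simp only: sum_tpow)
qed

text \<open>Union bound over \<open>k\<close> samples.\<close>

lemma prob_some_digit_le:
  fixes p :: "nat \<Rightarrow> real"
  assumes p0: "\<And>u. 0 \<le> p u" and p1: "(\<Sum>u<d. p u) = 1"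
  shows "(\<Sum>h<d ^ k. tpow d p k h * (if \<exists>u\<in>set (digs d k h). B u then 1 else 0))
    \<le> real k * (\<Sum>u<d. p u * (if B u then 1 else 0))"
proof (induction k)
  case (Suc k)
  have d0: "0 < d" using p1 by (cases d) auto
  let ?I = "\<lambda>h. if \<exists>u\<in>set (digs d k h). B u then 1 else 0 :: real"
  let ?b = "\<lambda>q. if B q then 1 else 0 :: real"
  have t1: "(\<Sum>h<d ^ k. tpow d p k h) = 1" by (simp add: sum_tpow p1)
  have "(\<Sum>h<d ^ Suc k. tpow d p (Suc k) h * (if \<exists>u\<in>set (digs d (Suc k) h). B u then 1 else 0))
      \<le> (\<Sum>h<d ^ k. \<Sum>q<d. tpow d p k h * (p q * ?b q) + (tpow d p k h * ?I h) * p q)"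
    unfolding sum_tpow_Suc
  proof (intro sum_mono)
    fix h q assume "q \<in> {..<d}"
    then have q: "(h * d + q) mod d = q" "(h * d + q) div d = h" by auto
    have "(if \<exists>u\<in>set (digs d (Suc k) (h * d + q)). B u then 1 else 0) \<le> ?b q + ?I h"
      unfolding digs.simps q by auto
    then have "(tpow d p k h * p q) * (if \<exists>u\<in>set (digs d (Suc k) (h * d + q)). B u then 1 else 0)
        \<le> (tpow d p k h * p q) * (?b q + ?I h)"
      using p0 tpow_nonneg[OF p0] by (intro mult_left_mono) auto
    then show "tpow d p k h * p q * (if \<exists>u\<in>set (digs d (Suc k) (h * d + q)). B u then 1 else 0)
        \<le> tpow d p k h * (p q * ?b q) + (tpow d p k h * ?I h) * p q"
      by (simp only: algebra_simps)
  qed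
  also have "\<dots> = (\<Sum>q<d. p q * ?b q) + (\<Sum>h<d ^ k. tpow d p k h * ?I h)"
    unfolding sum.distrib sum_product[symmetric] t1 p1 by simp
  also have "\<dots> \<le> real (Suc k) * (\<Sum>u<d. p u * ?b u)" using Suc by (simp add: distrib_right)
  finally show ?case .
qed simp

section \<open>Large deviations of sample means\<close>

lemma exp_le_quadratic: "\<bar>y\<bar> \<le> 1 \<Longrightarrow> exp y \<le> 1 + y + y\<^sup>2" for y :: real
proof (cases "0 \<le> y")
  case False
  assume "\<bar>y\<bar> \<le> 1"
  define z where "z = - y"
  have z: "0 \<le> z" using False by (simp add: z_def)
  \<comment> \<open>The second factor is at most \<open>exp z\<close> by Taylor, so the first one is
    at least \<open>exp (- z)\<close>.\<close>
  have "1 \<le> (1 - z + z\<^sup>2) * (1 + z + z\<^sup>2 / 2)"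
  proof -
    have "(1 - z + z\<^sup>2) * (1 + z + z\<^sup>2 / 2) = 1 + z\<^sup>2 / 2 + z ^ 3 / 2 + z ^ 4 / 2"
      by (simp add: power2_eq_square power3_eq_cube power4_eq_xxxx field_simps)
    then show ?thesis using z by simp
  qed
  also have "\<dots> \<le> (1 - z + z\<^sup>2) * exp z"
  proof (rule mult_left_mono)
    show "1 + z + z\<^sup>2 / 2 \<le> exp z" using exp_lower_Taylor_quadratic[OF z] by simp
    have "0 \<le> (z - 1 / 2)\<^sup>2 + 3 / 4" by simp
    then show "0 \<le> 1 - z + z\<^sup>2" by (simp add: power2_eq_square algebra_simps)
  qed
  finally have "exp (- z) \<le> 1 - z + z\<^sup>2" by (simp add: exp_minus field_simps)
  then show ?thesis by (simp add: z_def)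
qed (use exp_bound in auto)

lemma tpow_exp: "h < d ^ k \<Longrightarrow> tpow d (\<lambda>u. exp (f u)) k h = exp (\<Sum>u\<leftarrow>digs d k h. f u)" for f :: "nat \<Rightarrow> real"
proof (induction k arbitrary: h)
  case (Suc k)
  then have "h < d ^ k * d" by (simp add: mult.commute)
  then have "h div d < d ^ k" by (rule div_mod_less_mult)
  then show ?case using Suc.IH by (simp add: exp_add mult.commute)
qed simp

text \<open>Exponential moments with parameter \<open>l = \<eta> / 8\<close>. Deviations from the
  mean are at most 2, so \<open>exp_le_quadratic\<close> applies and bounds the moment of one sample
  by \<open>exp (4 * l\<^sup>2)\<close>; per sample the exponents add up to
  \<open>- \<eta>\<^sup>2 / 8 + \<eta>\<^sup>2 / 16\<close>.\<close>

lemma chernoff_upper: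
  fixes p X :: "nat \<Rightarrow> real"
  assumes p0: "\<And>u. 0 \<le> p u" and p1: "(\<Sum>u<d. p u) = 1" and a: "(\<Sum>u<d. p u * X u) = a"
    and X: "\<And>u. \<bar>X u\<bar> \<le> 1" and \<eta>: "0 < \<eta>" "\<eta> \<le> 1"
  shows "(\<Sum>h<d ^ k. tpow d p k h * (if real k * \<eta> \<le> (\<Sum>u\<leftarrow>digs d k h. X u - a) then 1 else 0)) \<le> exp (- (real k * \<eta>\<^sup>2 / 16))"
proof -
  define l where "l = \<eta> / 8"
  have l: "0 < l" "l \<le> 1 / 8" using \<eta> by (auto simp: l_def)
  have "\<bar>a\<bar> \<le> (\<Sum>u<d. p u * 1)"
    unfolding a[symmetric] using X p0 by (intro order_trans[OF sum_abs] sum_mono) (simp add: abs_mult mult_left_le)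
  then have a1: "\<bar>a\<bar> \<le> 1" by (simp add: p1)
  have Xa: "\<bar>X u - a\<bar> \<le> 2" for u using X[of u] a1 by linarith
  have "(\<Sum>u<d. p u * exp (l * (X u - a))) \<le> (\<Sum>u<d. p u * (1 + l * (X u - a) + 4 * l\<^sup>2))"
  proof (intro sum_mono mult_left_mono p0)
    fix u
    have "\<bar>l * (X u - a)\<bar> \<le> 1 / 8 * 2" unfolding abs_mult using l Xa by (intro mult_mono) auto
    then have "exp (l * (X u - a)) \<le> 1 + l * (X u - a) + (l * (X u - a))\<^sup>2" by (intro exp_le_quadratic) linarith
    moreover have "(X u - a)\<^sup>2 \<le> 2\<^sup>2" using power_mono[OF Xa[of u] abs_ge_zero, of 2] unfolding power2_abs .
    then have "l\<^sup>2 * (X u - a)\<^sup>2 \<le> l\<^sup>2 * 4" by (intro mult_left_mono) simp_all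
    ultimately show "exp (l * (X u - a)) \<le> 1 + l * (X u - a) + 4 * l\<^sup>2" by (simp add: power_mult_distrib)
  qed
  also have "\<dots> = (\<Sum>u<d. p u) * (1 + 4 * l\<^sup>2) + l * ((\<Sum>u<d. p u * X u) - (\<Sum>u<d. p u) * a)"
    unfolding sum_distrib_right sum_subtractf[symmetric] sum_distrib_left sum.distrib[symmetric]
    by (intro sum.cong refl) (simp add: algebra_simps)
  also have "\<dots> = 1 + 4 * l\<^sup>2" unfolding p1 a by simp
  also have "\<dots> \<le> exp (4 * l\<^sup>2)" by (rule exp_ge_add_one_self)
  finally have mgf: "(\<Sum>u<d. p u * exp (l * (X u - a))) \<le> exp (4 * l\<^sup>2)" .
  have "(\<Sum>h<d ^ k. tpow d p k h * (if real k * \<eta> \<le> (\<Sum>u\<leftarrow>digs d k h. X u - a) then 1 else 0))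
      \<le> (\<Sum>h<d ^ k. tpow d p k h * (exp (- (l * (real k * \<eta>))) * exp (\<Sum>u\<leftarrow>digs d k h. l * (X u - a))))"
  proof (intro sum_mono mult_left_mono tpow_nonneg p0)
    fix h
    have e: "(\<Sum>u\<leftarrow>digs d k h. l * (X u - a)) = l * (\<Sum>u\<leftarrow>digs d k h. X u - a)" by (simp add: sum_list_const_mult)
    have "1 \<le> exp (- (l * (real k * \<eta>)) + l * (\<Sum>u\<leftarrow>digs d k h. X u - a))"
      if "real k * \<eta> \<le> (\<Sum>u\<leftarrow>digs d k h. X u - a)"
      using mult_left_mono[OF that, of l] l by simp
    then show "(if real k * \<eta> \<le> (\<Sum>u\<leftarrow>digs d k h. X u - a) then 1 else 0)
        \<le> exp (- (l * (real k * \<eta>))) * exp (\<Sum>u\<leftarrow>digs d k h. l * (X u - a))"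
      unfolding e exp_add[symmetric] by auto
  qed
  also have "\<dots> = exp (- (l * (real k * \<eta>))) * (\<Sum>h<d ^ k. tpow d (\<lambda>u. p u * exp (l * (X u - a))) k h)"
    unfolding sum_distrib_left
    by (intro sum.cong refl) (simp add: tpow_exp[symmetric] tpow_times[symmetric] mult_ac)
  also have "\<dots> \<le> exp (- (l * (real k * \<eta>))) * exp (4 * l\<^sup>2) ^ k"
    unfolding sum_tpow using mgf p0 by (intro mult_left_mono power_mono) (auto intro!: sum_nonneg)
  also have "\<dots> = exp (- (real k * \<eta>\<^sup>2 / 16))"
    by (simp add: exp_of_nat_mult[symmetric] exp_add[symmetric] l_def power2_eq_square field_simps)
  finally show ?thesis .
qed

lemma chernoff:
  fixes p X :: "nat \<Rightarrow> real"
  assumes p0: "\<And>u. 0 \<le> p u" and p1: "(\<Sum>u<d. p u) = 1" and a: "(\<Sum>u<d. p u * X u) = a"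
    and X: "\<And>u. \<bar>X u\<bar> \<le> 1" and \<eta>: "0 < \<eta>" "\<eta> \<le> 1" and k: "0 < k"
  shows "(\<Sum>h<d ^ k. tpow d p k h * (if \<eta> < \<bar>(\<Sum>u\<leftarrow>digs d k h. X u) / real k - a\<bar> then 1 else 0))
    \<le> 2 * exp (- (real k * \<eta>\<^sup>2 / 16))"
proof -
  let ?U = "\<lambda>h. if real k * \<eta> \<le> (\<Sum>u\<leftarrow>digs d k h. X u - a) then 1 else 0 :: real"
  let ?L = "\<lambda>h. if real k * \<eta> \<le> (\<Sum>u\<leftarrow>digs d k h. - X u - (- a)) then 1 else 0 :: real"
  have "(\<Sum>h<d ^ k. tpow d p k h * (if \<eta> < \<bar>(\<Sum>u\<leftarrow>digs d k h. X u) / real k - a\<bar> then 1 else 0))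
      \<le> (\<Sum>h<d ^ k. tpow d p k h * (?U h + ?L h))"
  proof (intro sum_mono mult_left_mono tpow_nonneg p0)
    fix h
    define S where "S = (\<Sum>u\<leftarrow>digs d k h. X u)"
    have u: "(\<Sum>u\<leftarrow>digs d k h. X u - a) = S - real k * a"
      by (simp add: S_def sum_list_subtractf sum_list_triv)
    have l: "(\<Sum>u\<leftarrow>digs d k h. - X u - (- a)) = real k * a - S"
      by (simp add: S_def sum_list_subtractf sum_list_triv uminus_sum_list_map[symmetric] o_def
          sum_list_addf)
    have "real k * \<eta> \<le> S - real k * a \<or> real k * \<eta> \<le> real k * a - S" if "\<eta> < \<bar>S / real k - a\<bar>"
    proof -
      have "real k * \<eta> \<le> real k * \<bar>S / real k - a\<bar>" using that by (intro mult_left_mono) auto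
      also have "\<dots> = \<bar>S - real k * a\<bar>" using k by (simp add: abs_mult_pos' right_diff_distrib)
      finally show ?thesis by linarith
    qed
    then show "(if \<eta> < \<bar>(\<Sum>u\<leftarrow>digs d k h. X u) / real k - a\<bar> then 1 else 0) \<le> ?U h + ?L h"
      unfolding u l S_def[symmetric] by auto
  qed
  also have "\<dots> = (\<Sum>h<d ^ k. tpow d p k h * ?U h) + (\<Sum>h<d ^ k. tpow d p k h * ?L h)"
    by (simp only: distrib_left sum.distrib)
  also have "\<dots> \<le> exp (- (real k * \<eta>\<^sup>2 / 16)) + exp (- (real k * \<eta>\<^sup>2 / 16))"
  proof (rule add_mono)
    show "(\<Sum>h<d ^ k. tpow d p k h * ?U h) \<le> exp (- (real k * \<eta>\<^sup>2 / 16))"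
      by (rule chernoff_upper[OF p0 p1 a X \<eta>])
    show "(\<Sum>h<d ^ k. tpow d p k h * ?L h) \<le> exp (- (real k * \<eta>\<^sup>2 / 16))"
      by (rule chernoff_upper[OF p0 p1 _ _ \<eta>]) (use a X in \<open>auto simp: sum_negf\<close>)
  qed
  finally show ?thesis by simp
qed

section \<open>The learner\<close>

text \<open>A Hadamard gate on the plane of two basis vectors. From amplitudes
  \<open>1 / sqrt 2\<close> at \<open>z\<close> and \<open>c / sqrt 2\<close> at \<open>y\<close> it
  produces outcome probabilities \<open>((1 + c) / 2)\<^sup>2\<close> and
  \<open>((1 - c) / 2)\<^sup>2\<close>, whose difference is \<open>c\<close>; this is how the sign
  becomes visible.\<close>

definition hadamard_on :: "nat \<Rightarrow> nat \<Rightarrow> kernel" where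
  "hadamard_on z y = (\<lambda>i j. if j = z then (kid i z + kid i y) / of_real (sqrt 2)
     else if j = y then (kid i z - kid i y) / of_real (sqrt 2) else kid i j)"

lemma sqrt2_sq: "complex_of_real (sqrt 2) * complex_of_real (sqrt 2) = 2"
  by (simp flip: of_real_mult)

lemma hadamard_unitary:
  assumes "z < d" "y < d" "z \<noteq> y"
  shows "kunitary d (hadamard_on z y)"
  unfolding kunitary_def keq_def
proof (intro allI impI)
  fix i j assume ij: "i < d" "j < d"
  let ?U = "hadamard_on z y"
  have e: "kmult d (kadj ?U) ?U i j = (if i = z then (?U z j + ?U y j) / of_real (sqrt 2)
      else if i = y then (?U z j - ?U y j) / of_real (sqrt 2) else ?U i j)"
  proof -
    have c: "cnj (kid k l) = kid k l" for k l by (simp add: kid_def)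
    have "(\<Sum>k<d. cnj (?U k i) * ?U k j) = (if i = z then ((\<Sum>k<d. kid k z * ?U k j) + (\<Sum>k<d. kid k y * ?U k j)) / of_real (sqrt 2)
      else if i = y then ((\<Sum>k<d. kid k z * ?U k j) - (\<Sum>k<d. kid k y * ?U k j)) / of_real (sqrt 2) else (\<Sum>k<d. kid k i * ?U k j))"
      unfolding sum.distrib[symmetric] sum_subtractf[symmetric] sum_divide_distrib
      by (auto simp: hadamard_on_def[of z y] c distrib_right left_diff_distrib intro!: sum.cong)
    then show ?thesis unfolding sum_kid[OF assms(1)] sum_kid[OF assms(2)] sum_kid[OF ij(1)] kmult_def kadj_def .
  qed
  show "kmult d (kadj ?U) ?U i j = kid i j"
    unfolding e using assms(3) sqrt2_sq by (auto simp: hadamard_on_def kid_def field_simps)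
qed

lemma hadamard_apply:
  assumes "z < d" "y < d" "z \<noteq> y" "i < d"
  shows "(\<Sum>j<d. hadamard_on z y i j * v j) = (if i = z then (v z + v y) / of_real (sqrt 2)
    else if i = y then (v z - v y) / of_real (sqrt 2) else v i)"
proof -
  have "(\<Sum>j<d. hadamard_on z y i j * v j)
      = (if i = z then ((\<Sum>j<d. kid j z * v j) + (\<Sum>j<d. kid j y * v j)) / of_real (sqrt 2)
    else if i = y then ((\<Sum>j<d. kid j z * v j) - (\<Sum>j<d. kid j y * v j)) / of_real (sqrt 2) else (\<Sum>j<d. kid j i * v j))"
    unfolding sum.distrib[symmetric] sum_subtractf[symmetric] sum_divide_distrib
    using assms(3) by (auto simp: hadamard_on_def kid_def intro!: sum.cong)
  then show ?thesis unfolding sum_kid[OF assms(1)] sum_kid[OF assms(2)] sum_kid[OF assms(4)] .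
qed

lemma bell_amp_real_comb:
  assumes "length s = n"
  shows "bell_amp n (real_comb n c) (b, s)
    = of_real ((if b then c s else if s = replicate n PI then 1 else 0) / sqrt 2)"
proof -
  have "(\<Sum>i<2^n. \<Sum>j<2^n. cnj (pker s i j) * real_comb n c $$ (i, j))
      = (\<Sum>i<2^n. \<Sum>j<2^n. cnj (psum n (\<lambda>t. if t = s then 1 else 0) i j) * psum n (\<lambda>t. complex_of_real (c t)) i j)"
  proof (intro sum.cong refl)
    fix i j :: nat assume "i \<in> {..<2 ^ n}" "j \<in> {..<2 ^ n}"
    then have "real_comb n c $$ (i, j) = psum n (\<lambda>t. complex_of_real (c t)) i j"
      using pauli_comb_ker[of n "\<lambda>t. complex_of_real (c t)"] by (simp add: keq_def)
    moreover have "psum n (\<lambda>t. if t = s then 1 else 0) i j = (\<Sum>t | length t = n. if t = s then pker s i j else 0)"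
      unfolding psum_def by (intro sum.cong) auto
    then have "psum n (\<lambda>t. if t = s then 1 else 0) i j = pker s i j" using assms by simp
    ultimately show "cnj (pker s i j) * real_comb n c $$ (i, j)
      = cnj (psum n (\<lambda>t. if t = s then 1 else 0) i j) * psum n (\<lambda>t. complex_of_real (c t)) i j" by simp
  qed
  also have "\<dots> = 2 ^ n * (\<Sum>t | length t = n. if t = s then complex_of_real (c s) else 0)"
    unfolding psum_inner by (intro arg_cong2[where f = "(*)"] sum.cong) auto
  also have "\<dots> = 2 ^ n * complex_of_real (c s)" using assms by simp
  finally show ?thesis by (simp add: bell_amp_def)
qed

text \<open>\<open>L\<close> is the set of sampled strings. The concentration set of
  \<open>c\<close> does not occur, so a learner can be built without knowing it; the set enters only
  in \<open>estimate_close\<close>.\<close>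

definition good_estimate :: "nat \<Rightarrow> real \<Rightarrow> real \<Rightarrow> (pauli list \<Rightarrow> real) \<Rightarrow> (pauli list \<Rightarrow> real) \<Rightarrow> bool" where
  "good_estimate n \<theta> v c f \<longleftrightarrow> (\<exists>L \<subseteq> {s. length s = n}. (\<forall>s. s \<notin> L \<longrightarrow> f s = 0) \<and>
     {s. length s = n \<and> \<theta> \<le> (c s)\<^sup>2} \<subseteq> L \<and> (\<Sum>s\<in>L. (f s - c s)\<^sup>2) \<le> v)"

text \<open>A string may be sampled repeatedly; any one of its estimates is taken.\<close>

definition table :: "('a \<Rightarrow> pauli list) \<Rightarrow> ('a \<Rightarrow> real) \<Rightarrow> 'a list \<Rightarrow> pauli list \<Rightarrow> real" where
  "table st est us s = (if \<exists>u\<in>set us. st u = s then est (SOME u. u \<in> set us \<and> st u = s) else 0)"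

lemma table_good:
  assumes len: "\<And>u. u \<in> set us \<Longrightarrow> length (st u) = n"
    and heavy: "\<And>s. length s = n \<Longrightarrow> \<theta> \<le> (c s)\<^sup>2 \<Longrightarrow> \<exists>u\<in>set us. st u = s"
    and acc: "\<And>u. u \<in> set us \<Longrightarrow> \<bar>est u - c (st u)\<bar> \<le> \<eta>"
  shows "good_estimate n \<theta> (real (length us) * \<eta>\<^sup>2) c (table st est us)"
  unfolding good_estimate_def
proof (intro exI[of _ "st ` set us"] conjI allI impI)
  let ?L = "st ` set us"
  show "?L \<subseteq> {s. length s = n}" using len by auto
  show "table st est us s = 0" if "s \<notin> ?L" for s using that by (auto simp: table_def)
  show "{s. length s = n \<and> \<theta> \<le> (c s)\<^sup>2} \<subseteq> ?L" using heavy by blast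
  have "(\<Sum>s\<in>?L. (table st est us s - c s)\<^sup>2) \<le> (\<Sum>s\<in>?L. \<eta>\<^sup>2)"
  proof (rule sum_mono)
    fix s assume s: "s \<in> ?L"
    define u where "u = (SOME u. u \<in> set us \<and> st u = s)"
    have "\<exists>u. u \<in> set us \<and> st u = s" using s by auto
    then have u: "u \<in> set us" "st u = s" unfolding u_def by (metis (mono_tags, lifting) someI_ex)+
    have "table st est us s = est u" using s by (auto simp: table_def u_def)
    then have "\<bar>table st est us s - c s\<bar> \<le> \<eta>" using acc[OF u(1)] u(2) by simp
    then have "\<bar>table st est us s - c s\<bar>\<^sup>2 \<le> \<eta>\<^sup>2" by (rule power_mono) simp
    then show "(table st est us s - c s)\<^sup>2 \<le> \<eta>\<^sup>2" by simp
  qed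
  also have "\<dots> = real (card ?L) * \<eta>\<^sup>2" by simp
  also have "\<dots> \<le> real (length us) * \<eta>\<^sup>2"
  proof (rule mult_right_mono)
    have "card ?L \<le> card (set us)" by (rule card_image_le) simp
    also have "\<dots> \<le> length us" by (rule card_length)
    finally show "real (card ?L) \<le> real (length us)" by simp
  qed simp
  finally show "(\<Sum>s\<in>?L. (table st est us s - c s)\<^sup>2) \<le> real (length us) * \<eta>\<^sup>2" .
qed

text \<open>Each of the \<open>m1\<close> units samples a Pauli string in the Bell basis and estimates its coefficient from \<open>m2\<close>
  further copies, by interference with the reference branch.\<close>

lemma learner:
  fixes n m1 m2 :: nat and \<eta> \<theta> \<delta> :: real
  assumes m2: "0 < m2" and \<eta>: "0 < \<eta>" "\<eta> \<le> 1" and \<theta>: "0 < \<theta>"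
    and d1: "1 / \<theta> * exp (- (real m1 * \<theta> / 2)) \<le> \<delta> / 2"
    and d2: "real m1 * (2 * exp (- (real m2 * \<eta>\<^sup>2 / 16))) \<le> \<delta> / 2"
  shows "\<exists>alg F. valid_alg n alg \<and> num_queries alg = Suc m2 * m1 \<and>
    (\<forall>c. (\<Sum>s | length s = n. (c s)\<^sup>2) = 1 \<longrightarrow>
      1 - \<delta> \<le> (\<Sum>i | i < total_dim n alg \<and> good_estimate n \<theta> (real m1 * \<eta>\<^sup>2) c (F i).
        (cmod (run_alg n alg (real_comb n c) (num_queries alg) $ i))\<^sup>2))"
proof -
  define M where "M = (2 :: nat) * 2 ^ n"
  define D where "D = 2 ^ n * M"
  have D0: "0 < D" by (simp add: D_def M_def)
  let ?o = "replicate n PI" and ?S = "{s :: pauli list. length s = n}"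
  obtain K0 KB and e :: "nat \<Rightarrow> bool \<times> pauli list" where K0: "kunitary D K0" and KB: "kunitary D KB"
    and e: "bij_betw e {..<D} (UNIV \<times> ?S)"
    and amp: "\<And>A r. A \<in> carrier_mat (2 ^ n) (2 ^ n) \<Longrightarrow> r < D \<Longrightarrow>
      bell_amp n A (e r) = (\<Sum>r'<D. KB r r' * (\<Sum>q<M. controlled n A $$ (r' mod M, q) * K0 (r' div M * M + q) 0))"
    by (rule bell_measurement[of n, folded M_def, folded D_def], rule that, assumption, assumption, assumption, simp)
  define st where "st = (\<lambda>r. snd (e r))"
  have st: "length (st r) = n" if "r < D" for r
  proof -
    have "e r \<in> UNIV \<times> ?S" using bij_betwE[OF e] that by blast
    then show ?thesis by (auto simp: mem_Times_iff st_def)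
  qed
  define ie where "ie = inv_into {..<D} e"
  have ie: "ie (b, s) < D" "e (ie (b, s)) = (b, s)" if "length s = n" for b s
  proof -
    have "(b, s) \<in> e ` {..<D}" using e that by (auto simp: bij_betw_def)
    then show "ie (b, s) < D" "e (ie (b, s)) = (b, s)"
      unfolding ie_def by (metis inv_into_into lessThan_iff, rule f_inv_into_f)
  qed
  \<comment> \<open>\<open>z\<close> is the only outcome of the idle branch with nonzero amplitude;
    \<open>y r\<close> is the outcome of the querying branch with the string of the sampled outcome
    \<open>r\<close>.\<close>
  define z where "z = ie (False, ?o)"
  define y where "y = (\<lambda>r. ie (True, st r))"
  have z: "z < D" "e z = (False, ?o)" unfolding z_def by (rule ie, simp)+
  have y: "y r < D" "e (y r) = (True, st r)" "z \<noteq> y r" if "r < D" for r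
  proof -
    show "y r < D" "e (y r) = (True, st r)" unfolding y_def using ie[OF st[OF that]] by auto
    then show "z \<noteq> y r" using z(2) by auto
  qed
  define V where "V = (\<lambda>r. hadamard_on z (y r))"
  have V: "kunitary D (V r)" if "r < D" for r unfolding V_def by (rule hadamard_unitary[OF z(1) y(1)[OF that] y(3)[OF that]])
  define E where "E = D ^ Suc m2"
  have E: "E = D ^ m2 * D" by (simp add: E_def)
  have E0: "0 < E" using D0 by (simp add: E_def)
  \<comment> \<open>The low digit is the first copy of a unit and holds the sampled outcome; it
    controls which Hadamard gate acts on the other \<open>m2\<close> copies. This replaces an
    intermediate measurement.\<close>
  define W where "W = (\<lambda>i j. kpow D (V (j mod D)) m2 (i div D) (j div D) * kid (i mod D) (j mod D))"
  have W: "kunitary E W" unfolding W_def E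
    by (rule kunitary_tensor[of D "D ^ m2" "\<lambda>b. kpow D (V b) m2" kid]) (auto intro: kunitary_kpow V kid_unitary)
  define m where "m = Suc m2 * m1"
  have Em: "E ^ m1 = D ^ m" unfolding E_def m_def by (rule power_mult[symmetric])
  define \<psi> where "\<psi> = (\<lambda>A r. bell_amp n A (e r))"
  define \<omega> where "\<omega> = (\<lambda>A u. \<psi> A (u mod D) * tpow D (\<lambda>i. \<Sum>j<D. V (u mod D) i j * \<psi> A j) m2 (u div D))"
  have dim: "D ^ m * 2 ^ n * (2 * 2 ^ n) = D ^ m * D" by (simp add: D_def M_def mult.assoc)
  have r0: "reach n (D ^ m * 2 ^ n) m (\<lambda>A i. if i mod D = 0 then tpow D (\<psi> A) m (i div D) else 0)"
    unfolding D_def M_def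
    by (rule multi_copy[OF K0[unfolded D_def M_def] KB[unfolded D_def M_def]])
      (use amp in \<open>simp_all add: \<psi>_def D_def M_def\<close>)
  have KU: "kunitary (D ^ m) (kpow E W m1)" using kunitary_kpow[OF W, of m1] unfolding Em .
  have W_apply: "(\<Sum>j<E. W u j * tpow D (\<psi> A) (Suc m2) j) = \<omega> A u" if "u < E" for A u
  proof -
    have u: "u div D < D ^ m2" using that unfolding E by (rule div_mod_less_mult)
    have "(\<Sum>j<E. W u j * tpow D (\<psi> A) (Suc m2) j)
        = (\<Sum>h<D ^ m2. \<Sum>q<D. kid q (u mod D) * (kpow D (V q) m2 (u div D) h * (tpow D (\<psi> A) m2 h * \<psi> A q)))"
      unfolding E sum_mult_split W_def by (intro sum.cong refl) (auto simp: kid_def)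
    also have "\<dots> = (\<Sum>h<D ^ m2. kpow D (V (u mod D)) m2 (u div D) h * (tpow D (\<psi> A) m2 h * \<psi> A (u mod D)))"
      using D0 by (intro sum.cong refl sum_kid) simp
    also have "\<dots> = (\<Sum>h<D ^ m2. kpow D (V (u mod D)) m2 (u div D) h * tpow D (\<psi> A) m2 h) * \<psi> A (u mod D)"
      unfolding sum_distrib_right by (simp only: mult.assoc)
    also have "\<dots> = \<omega> A u" unfolding kpow_tpow[OF u] \<omega>_def by (rule mult.commute)
    finally show ?thesis .
  qed
  have r1: "reach n (D ^ m * 2 ^ n) m (\<lambda>A i. if i mod D = 0 then tpow E (\<omega> A) m1 (i div D) else 0)"
  proof (rule reach_cong[OF reach_high[OF r0 dim KU]])
    fix A i assume "i < D ^ m * 2 ^ n * (2 * 2 ^ n)"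
    then have "i < D ^ m * D" unfolding dim .
    then have i: "i div D < E ^ m1" unfolding Em by (rule div_mod_less_mult)
    have md: "(h * D + i mod D) mod D = i mod D" "(h * D + i mod D) div D = h" for h using D0 by simp_all
    have "(\<Sum>h<D ^ m. kpow E W m1 (i div D) h * tpow D (\<psi> A) m h)
        = (\<Sum>h<E ^ m1. kpow E W m1 (i div D) h * tpow E (tpow D (\<psi> A) (Suc m2)) m1 h)"
      unfolding Em unfolding m_def tpow_tpow[OF D0] E_def ..
    also have "\<dots> = tpow E (\<lambda>u. \<Sum>j<E. W u j * tpow D (\<psi> A) (Suc m2) j) m1 (i div D)" by (rule kpow_tpow[OF i])
    also have "\<dots> = tpow E (\<omega> A) m1 (i div D)" by (rule tpow_cong[OF E0 W_apply])
    finally have "(\<Sum>h<D ^ m. kpow E W m1 (i div D) h * tpow D (\<psi> A) m h) = tpow E (\<omega> A) m1 (i div D)" .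
    then show "(\<Sum>h<D ^ m. kpow E W m1 (i div D) h *
        (if (h * D + i mod D) mod D = 0 then tpow D (\<psi> A) m ((h * D + i mod D) div D) else 0))
      = (if i mod D = 0 then tpow E (\<omega> A) m1 (i div D) else 0)"
      unfolding md by simp
  qed
  obtain alg where alg: "work_dim alg = D ^ m * 2 ^ n" "num_queries alg = m" "valid_alg n alg"
    and run: "\<And>A i. A \<in> carrier_mat (2 ^ n) (2 ^ n) \<Longrightarrow> i < D ^ m * 2 ^ n * (2 * 2 ^ n) \<Longrightarrow>
      run_alg n alg A m $ i = (if i mod D = 0 then tpow E (\<omega> A) m1 (i div D) else 0)"
    using r1 unfolding reach_def by auto
  have td: "total_dim n alg = D ^ m * D" unfolding total_dim_def alg(1) by (rule dim)
  \<comment> \<open>The score of an outcome; its mean is the signed coefficient of the sampled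
    string, see \<open>qX\<close>.\<close>
  define X where "X = (\<lambda>r x. if x = z then 1 else if x = y r then - 1 else 0 :: real)"
  define est where "est = (\<lambda>u. (\<Sum>x\<leftarrow>digs D m2 (u div D). X (u mod D) x) / real m2)"
  define F where "F = (\<lambda>i. table (\<lambda>u. st (u mod D)) est (digs E m1 (i div D)))"
  have main: "1 - \<delta> \<le> (\<Sum>i | i < total_dim n alg \<and> good_estimate n \<theta> (real m1 * \<eta>\<^sup>2) c (F i).
        (cmod (run_alg n alg (real_comb n c) (num_queries alg) $ i))\<^sup>2)"
    if one: "(\<Sum>s\<in>?S. (c s)\<^sup>2) = 1" for c
  proof -
    let ?A = "real_comb n c"
    define w where "w = (\<lambda>r. (cmod (\<psi> ?A r))\<^sup>2)"
    have ps: "\<psi> ?A r = of_real ((if fst (e r) then c (st r) else if st r = ?o then 1 else 0) / sqrt 2)" if "r < D" for r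
      using bell_amp_real_comb[OF st[OF that], of c "fst (e r)"] by (simp add: \<psi>_def st_def)
    have pz: "\<psi> ?A z = of_real (1 / sqrt 2)" using ps[OF z(1)] z(2) by (simp add: st_def)
    have py: "\<psi> ?A (y r) = of_real (c (st r) / sqrt 2)" if "r < D" for r
      using ps[OF y(1)[OF that]] y(2)[OF that] by (simp add: st_def[of])
    have w0: "0 \<le> w r" for r by (simp add: w_def)
    have w1: "(\<Sum>r<D. w r) = 1"
    proof -
      have "(\<Sum>r<D. w r) = (\<Sum>x\<in>UNIV \<times> ?S. (cmod (bell_amp n ?A x))\<^sup>2)"
        unfolding w_def \<psi>_def by (rule sum.reindex_bij_betw[OF e])
      also have "\<dots> = (\<Sum>b\<in>UNIV. \<Sum>s\<in>?S. (cmod (bell_amp n ?A (b, s)))\<^sup>2)"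
        by (simp add: sum.cartesian_product)
      also have "\<dots> = (\<Sum>b\<in>UNIV. \<Sum>s\<in>?S. (if b then (c s)\<^sup>2 / 2 else if s = ?o then 1 / 2 else 0))"
        by (intro sum.cong refl) (auto simp: bell_amp_real_comb power_divide norm_divide)
      also have "\<dots> = (\<Sum>s\<in>?S. if s = ?o then 1 / 2 else 0) + (\<Sum>s\<in>?S. (c s)\<^sup>2) / 2"
        by (simp add: UNIV_bool sum_divide_distrib)
      also have "\<dots> = 1" unfolding one by simp
      finally show ?thesis .
    qed
    define q where "q = (\<lambda>r i. (cmod (\<Sum>j<D. V r i j * \<psi> ?A j))\<^sup>2)"
    have q0: "0 \<le> q r i" for r i by (simp add: q_def)
    have s2: "sqrt 2 * sqrt 2 = (2 :: real)" by simp
    \<comment> \<open>The Hadamard gate changes the law \<open>w\<close> only at \<open>z\<close>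
      and \<open>y r\<close>, where it had the values \<open>1 / 2\<close> and
      \<open>(c (st r))\<^sup>2 / 2\<close>.\<close>
    have qv: "q r i = w i + ((if i = z then ((1 + c (st r)) / 2)\<^sup>2 - 1 / 2 else 0)
        + (if i = y r then ((1 - c (st r)) / 2)\<^sup>2 - (c (st r))\<^sup>2 / 2 else 0))" if "r < D" "i < D" for r i
    proof -
      let ?a = "c (st r)"
      have wz: "w z = 1 / 2" "w (y r) = ?a\<^sup>2 / 2" unfolding w_def pz py[OF that(1)] by (simp_all add: power_divide norm_divide)
      have "complex_of_real (1 / sqrt 2) + complex_of_real (?a / sqrt 2) = of_real ((1 + ?a) / sqrt 2)"
        "complex_of_real (1 / sqrt 2) - complex_of_real (?a / sqrt 2) = of_real ((1 - ?a) / sqrt 2)"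
        by (simp_all add: add_divide_distrib diff_divide_distrib)
      then have "(cmod ((\<psi> ?A z + \<psi> ?A (y r)) / of_real (sqrt 2)))\<^sup>2 = ((1 + ?a) / 2)\<^sup>2"
        "(cmod ((\<psi> ?A z - \<psi> ?A (y r)) / of_real (sqrt 2)))\<^sup>2 = ((1 - ?a) / 2)\<^sup>2"
        unfolding pz py[OF that(1)] by (simp_all add: norm_divide power_divide power2_eq_square[of 2] del: of_real_divide of_real_add of_real_diff)
      then show ?thesis
        unfolding q_def V_def hadamard_apply[OF z(1) y(1)[OF that(1)] y(3)[OF that(1)] that(2)]
        using wz y(3)[OF that(1)] by (auto simp: w_def)
    qed
    have q1: "(\<Sum>i<D. q r i) = 1" if r: "r < D" for r
    proof -
      have "(\<Sum>i<D. q r i) = (\<Sum>i<D. w i) + ((((1 + c (st r)) / 2)\<^sup>2 - 1 / 2) + (((1 - c (st r)) / 2)\<^sup>2 - (c (st r))\<^sup>2 / 2))"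
        using z(1) y(1)[OF r] by (simp add: qv[OF r] sum.distrib)
      then show ?thesis unfolding w1 by (simp add: power2_eq_square field_simps)
    qed
    have qX: "(\<Sum>i<D. q r i * X r i) = c (st r)" if r: "r < D" for r
    proof -
      have "(\<Sum>i<D. q r i * X r i) = (\<Sum>i<D. (if i = z then q r z else 0) - (if i = y r then q r (y r) else 0))"
        using y(3)[OF r] by (intro sum.cong refl) (auto simp: X_def)
      also have "\<dots> = q r z - q r (y r)" using z(1) y(1)[OF r] by (simp add: sum_subtractf)
      also have "\<dots> = ((1 + c (st r)) / 2)\<^sup>2 - ((1 - c (st r)) / 2)\<^sup>2"
      proof -
        have "w z = 1 / 2" "w (y r) = (c (st r))\<^sup>2 / 2"
          unfolding w_def pz py[OF r] by (simp_all add: power_divide norm_divide)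
        then show ?thesis unfolding qv[OF r z(1)] qv[OF r y(1)[OF r]] using y(3)[OF r] by simp
      qed
      also have "\<dots> = c (st r)" by (simp add: power2_eq_square field_simps)
      finally show ?thesis .
    qed
    define p where "p = (\<lambda>u. (cmod (\<omega> ?A u))\<^sup>2)"
    have p0: "0 \<le> p u" for u by (simp add: p_def)
    \<comment> \<open>A unit is a sampled outcome \<open>r\<close> with law \<open>w\<close>
      together with, given \<open>r\<close>, \<open>m2\<close> independent outcomes with law
      \<open>q r\<close>.\<close>
    have p_sum: "(\<Sum>u<E. p u * g u) = (\<Sum>r<D. w r * (\<Sum>h<D ^ m2. tpow D (q r) m2 h * g (h * D + r)))" for g
    proof -
      have "(\<Sum>u<E. p u * g u) = (\<Sum>h<D ^ m2. \<Sum>r<D. w r * (tpow D (q r) m2 h * g (h * D + r)))"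
        unfolding E sum_mult_split p_def \<omega>_def
        by (intro sum.cong refl) (simp add: norm_mult power_mult_distrib cmod_tpow w_def q_def mult.assoc)
      also have "\<dots> = (\<Sum>r<D. w r * (\<Sum>h<D ^ m2. tpow D (q r) m2 h * g (h * D + r)))"
        unfolding sum_distrib_left by (rule sum.swap)
      finally show ?thesis .
    qed
    have tq: "(\<Sum>h<D ^ m2. tpow D (q r) m2 h) = 1" if "r < D" for r unfolding sum_tpow q1[OF that] by simp
    have p1: "(\<Sum>u<E. p u) = 1" using p_sum[of "\<lambda>_. 1"] tq w1 by simp
    let ?bad = "\<lambda>u. \<eta> < \<bar>est u - c (st (u mod D))\<bar>"
    have bad: "(\<Sum>u<E. p u * (if ?bad u then 1 else 0)) \<le> 2 * exp (- (real m2 * \<eta>\<^sup>2 / 16))"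
    proof -
      have "(\<Sum>u<E. p u * (if ?bad u then 1 else 0)) \<le> (\<Sum>r<D. w r * (2 * exp (- (real m2 * \<eta>\<^sup>2 / 16))))"
        unfolding p_sum
      proof (intro sum_mono mult_left_mono w0)
        fix r assume "r \<in> {..<D}"
        then have r: "r < D" by simp
        have "(\<Sum>h<D ^ m2. tpow D (q r) m2 h * (if ?bad (h * D + r) then 1 else 0))
            = (\<Sum>h<D ^ m2. tpow D (q r) m2 h * (if \<eta> < \<bar>(\<Sum>u\<leftarrow>digs D m2 h. X r u) / real m2 - c (st r)\<bar> then 1 else 0))"
          using r by (simp add: est_def)
        also have "\<dots> \<le> 2 * exp (- (real m2 * \<eta>\<^sup>2 / 16))"
          by (rule chernoff[OF q0 q1[OF r] qX[OF r] _ \<eta> m2]) (simp add: X_def)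
        finally show "(\<Sum>h<D ^ m2. tpow D (q r) m2 h * (if ?bad (h * D + r) then 1 else 0)) \<le> 2 * exp (- (real m2 * \<eta>\<^sup>2 / 16))" .
      qed
      also have "\<dots> = 2 * exp (- (real m2 * \<eta>\<^sup>2 / 16))" unfolding sum_distrib_right[symmetric] w1 by simp
      finally show ?thesis .
    qed
    have miss: "(\<Sum>u<E. p u * (if st (u mod D) = s then 0 else 1)) \<le> 1 - (c s)\<^sup>2 / 2" if s: "length s = n" for s
    proof -
      have "(\<Sum>u<E. p u * (if st (u mod D) = s then 0 else 1)) = (\<Sum>r<D. w r * (if st r = s then 0 else 1))"
        unfolding p_sum
      proof (intro sum.cong refl arg_cong2[where f = "(*)"])
        fix r assume "r \<in> {..<D}"
        then have r: "r < D" by simp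
        then have "(\<Sum>h<D ^ m2. tpow D (q r) m2 h * (if st ((h * D + r) mod D) = s then 0 else 1))
          = (\<Sum>h<D ^ m2. tpow D (q r) m2 h) * (if st r = s then 0 else 1)"
          unfolding sum_distrib_right by simp
        then show "(\<Sum>h<D ^ m2. tpow D (q r) m2 h * (if st ((h * D + r) mod D) = s then 0 else 1)) = (if st r = s then 0 else 1)"
          unfolding tq[OF r] by simp
      qed
      also have "\<dots> = (\<Sum>r<D. w r) - (\<Sum>r<D. if st r = s then w r else 0)"
        unfolding sum_subtractf[symmetric] by (intro sum.cong) auto
      finally have total: "(\<Sum>u<E. p u * (if st (u mod D) = s then 0 else 1)) = (\<Sum>r<D. w r) - (\<Sum>r<D. if st r = s then w r else 0)" .
      \<comment> \<open>Only the outcome in the querying branch is counted, whence the factor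
        1/2.\<close>
      have "(c s)\<^sup>2 / 2 \<le> (\<Sum>r<D. if st r = s then w r else 0)"
      proof -
        let ?r = "ie (True, s)"
        have r: "?r < D" "e ?r = (True, s)" using ie[OF s] by auto
        then have sr: "st ?r = s" by (simp add: st_def)
        have "(c s)\<^sup>2 / 2 = (if st ?r = s then w ?r else 0)"
          unfolding w_def ps[OF r(1)] using sr r(2) by (simp add: power_divide norm_divide)
        also have "\<dots> \<le> (\<Sum>r<D. if st r = s then w r else 0)" using r w0 by (intro member_le_sum) auto
        finally show ?thesis .
      qed
      then show ?thesis unfolding total w1 by simp
    qed
    \<comment> \<open>Parseval leaves at most \<open>1 / \<theta>\<close> heavy strings, so the
      union bound does not run over all \<open>4 ^ n\<close> strings.\<close>
    define H where "H = {s \<in> ?S. \<theta> \<le> (c s)\<^sup>2}"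
    have fH: "finite H" by (simp add: H_def)
    have cH: "real (card H) \<le> 1 / \<theta>"
    proof -
      have "real (card H) * \<theta> = (\<Sum>s\<in>H. \<theta>)" by simp
      also have "\<dots> \<le> (\<Sum>s\<in>H. (c s)\<^sup>2)" by (rule sum_mono) (simp add: H_def)
      also have "\<dots> \<le> (\<Sum>s\<in>?S. (c s)\<^sup>2)" by (rule sum_mono2) (auto simp: H_def)
      finally show ?thesis using \<theta> unfolding one by (simp add: pos_le_divide_eq)
    qed
    let ?G = "\<lambda>h. good_estimate n \<theta> (real m1 * \<eta>\<^sup>2) c (table (\<lambda>u. st (u mod D)) est (digs E m1 h))"
    let ?i1 = "\<lambda>s h. if \<forall>u\<in>set (digs E m1 h). \<not> st (u mod D) = s then 1 else 0 :: real"
    let ?i2 = "\<lambda>h. if \<exists>u\<in>set (digs E m1 h). ?bad u then 1 else 0 :: real"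
    \<comment> \<open>The union bound in pointwise form: if the estimate fails, some heavy string
      was missed by all units or some unit was inaccurate.\<close>
    have ind: "1 \<le> (if ?G h then 1 else 0) + (\<Sum>s\<in>H. ?i1 s h) + ?i2 h" for h
    proof (cases "(\<exists>s\<in>H. \<forall>u\<in>set (digs E m1 h). \<not> st (u mod D) = s) \<or> (\<exists>u\<in>set (digs E m1 h). ?bad u)")
      case True
      have "0 \<le> (\<Sum>s\<in>H. ?i1 s h)" by (intro sum_nonneg) auto
      moreover have "1 \<le> (\<Sum>s\<in>H. ?i1 s h)" if "s \<in> H" "\<forall>u\<in>set (digs E m1 h). \<not> st (u mod D) = s" for s
        using member_le_sum[of s H "\<lambda>s. ?i1 s h"] that fH by auto
      ultimately show ?thesis using True by auto
    next
      case False
      have "good_estimate n \<theta> (real (length (digs E m1 h)) * \<eta>\<^sup>2) c (table (\<lambda>u. st (u mod D)) est (digs E m1 h))"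
      proof (rule table_good)
        show "length (st (u mod D)) = n" for u using D0 by (intro st) simp
        show "\<exists>u\<in>set (digs E m1 h). st (u mod D) = s" if "length s = n" "\<theta> \<le> (c s)\<^sup>2" for s
          using False that unfolding H_def by blast
        show "\<bar>est u - c (st (u mod D))\<bar> \<le> \<eta>" if "u \<in> set (digs E m1 h)" for u
          using False that by (meson linorder_not_less)
      qed
      then have "?G h" by simp
      moreover have "0 \<le> (\<Sum>s\<in>H. ?i1 s h)" by (intro sum_nonneg) auto
      ultimately show ?thesis by auto
    qed
    let ?P = "\<lambda>h. tpow E p m1 h"
    have "1 = (\<Sum>h<E ^ m1. ?P h)" unfolding sum_tpow p1 by simp
    also have "\<dots> \<le> (\<Sum>h<E ^ m1. ?P h * ((if ?G h then 1 else 0) + (\<Sum>s\<in>H. ?i1 s h) + ?i2 h))"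
    proof (rule sum_mono)
      fix h
      have "?P h * 1 \<le> ?P h * ((if ?G h then 1 else 0) + (\<Sum>s\<in>H. ?i1 s h) + ?i2 h)"
        using ind tpow_nonneg[OF p0] by (rule mult_left_mono)
      then show "?P h \<le> ?P h * ((if ?G h then 1 else 0) + (\<Sum>s\<in>H. ?i1 s h) + ?i2 h)" by (simp only: mult_1_right)
    qed
    also have "\<dots> = (\<Sum>h<E ^ m1. ?P h * (if ?G h then 1 else 0)) + (\<Sum>h<E ^ m1. \<Sum>s\<in>H. ?P h * ?i1 s h)
        + (\<Sum>h<E ^ m1. ?P h * ?i2 h)"
      by (simp only: distrib_left sum.distrib sum_distrib_left)
    also have "(\<Sum>h<E ^ m1. \<Sum>s\<in>H. ?P h * ?i1 s h) = (\<Sum>s\<in>H. \<Sum>h<E ^ m1. ?P h * ?i1 s h)" by (rule sum.swap)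
    also have "\<dots> \<le> \<delta> / 2"
    proof -
      have "(\<Sum>s\<in>H. \<Sum>h<E ^ m1. ?P h * ?i1 s h) \<le> (\<Sum>s\<in>H. exp (- (real m1 * \<theta> / 2)))"
      proof (rule sum_mono)
        fix s assume "s \<in> H"
        then have s: "length s = n" "\<theta> \<le> (c s)\<^sup>2" by (auto simp: H_def)
        have "(\<Sum>h<E ^ m1. ?P h * ?i1 s h) = (\<Sum>u<E. p u * (if st (u mod D) = s then 0 else 1)) ^ m1"
          by (rule prob_all_digits)
        also have "\<dots> \<le> exp (- (\<theta> / 2)) ^ m1"
        proof (rule power_mono)
          have "1 - (c s)\<^sup>2 / 2 \<le> 1 + (- (\<theta> / 2))" using s by simp
          also have "\<dots> \<le> exp (- (\<theta> / 2))" by (rule exp_ge_add_one_self)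
          finally show "(\<Sum>u<E. p u * (if st (u mod D) = s then 0 else 1)) \<le> exp (- (\<theta> / 2))"
            using miss[OF s(1)] by linarith
        qed (auto intro!: sum_nonneg simp: p0)
        also have "\<dots> = exp (- (real m1 * \<theta> / 2))" by (simp add: exp_of_nat_mult[symmetric])
        finally show "(\<Sum>h<E ^ m1. ?P h * ?i1 s h) \<le> exp (- (real m1 * \<theta> / 2))" .
      qed
      also have "\<dots> = real (card H) * exp (- (real m1 * \<theta> / 2))" by simp
      also have "\<dots> \<le> 1 / \<theta> * exp (- (real m1 * \<theta> / 2))" using cH by (rule mult_right_mono) simp
      finally show ?thesis using d1 by linarith
    qed
    also have "(\<Sum>h<E ^ m1. ?P h * ?i2 h) \<le> \<delta> / 2"
    proof -
      have "(\<Sum>h<E ^ m1. ?P h * ?i2 h) \<le> real m1 * (\<Sum>u<E. p u * (if ?bad u then 1 else 0))"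
        by (rule prob_some_digit_le[OF p0 p1])
      also have "\<dots> \<le> real m1 * (2 * exp (- (real m2 * \<eta>\<^sup>2 / 16)))" using bad by (rule mult_left_mono) simp
      finally show ?thesis using d2 by linarith
    qed
    finally have prob: "1 - \<delta> \<le> (\<Sum>h<E ^ m1. ?P h * (if ?G h then 1 else 0))" by simp
    let ?g = "\<lambda>i. good_estimate n \<theta> (real m1 * \<eta>\<^sup>2) c (F i)"
    have "(\<Sum>i | i < total_dim n alg \<and> ?g i. (cmod (run_alg n alg ?A (num_queries alg) $ i))\<^sup>2)
        = (\<Sum>i<D ^ m * D. if ?g i then (cmod (run_alg n alg ?A m $ i))\<^sup>2 else 0)"
      unfolding td alg(2) by (rule sum.mono_neutral_cong_left) auto
    also have "\<dots> = (\<Sum>h<D ^ m. \<Sum>x<D. if ?g (h * D + x) then (cmod (run_alg n alg ?A m $ (h * D + x)))\<^sup>2 else 0)"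
      by (rule sum_mult_split)
    \<comment> \<open>All amplitude sits at indices with low digit 0, where the remaining number
      \<open>h\<close> encodes the \<open>m1\<close> units.\<close>
    also have "\<dots> = (\<Sum>h<D ^ m. \<Sum>x<D. if x = 0 then ?P h * (if ?G h then 1 else 0) else 0)"
    proof (intro sum.cong refl)
      fix h x assume "h \<in> {..<D ^ m}" "x \<in> {..<D}"
      then have hx: "h < D ^ m" "x < D" by auto
      then have "Suc h * D \<le> D ^ m * D" by (intro mult_right_mono) auto
      then have "h * D + x < D ^ m * 2 ^ n * (2 * 2 ^ n)" unfolding dim using hx by simp
      then have "run_alg n alg ?A m $ (h * D + x) = (if x = 0 then tpow E (\<omega> ?A) m1 h else 0)"
        using run[OF pauli_comb_carrier] hx by simp
      moreover have "(cmod (tpow E (\<omega> ?A) m1 h))\<^sup>2 = ?P h" unfolding cmod_tpow p_def ..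
      moreover have "F (h * D + x) = table (\<lambda>u. st (u mod D)) est (digs E m1 h)" using hx by (simp add: F_def)
      ultimately show "(if ?g (h * D + x) then (cmod (run_alg n alg ?A m $ (h * D + x)))\<^sup>2 else 0)
        = (if x = 0 then ?P h * (if ?G h then 1 else 0) else 0)"
        by (cases "x = 0") (simp_all only: if_True if_False, simp_all)
    qed
    also have "\<dots> = (\<Sum>h<E ^ m1. ?P h * (if ?G h then 1 else 0))" using D0 by (simp add: Em)
    finally show ?thesis using prob by simp
  qed
  show ?thesis using alg(2,3) main unfolding m_def by (intro exI[of _ alg] exI[of _ F]) auto
qed

section \<open>Parameters, error budget and query count\<close>

text \<open>The accuracy \<open>\<epsilon> / (2 * sqrt (real m1))\<close> lets \<open>m1\<close>
  estimates contribute \<open>\<epsilon>\<^sup>2 / 4\<close> in total, and the threshold is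
  \<open>1 / Y\<close>. The sample numbers are chosen with extra summands \<open>2 * Y\<close> and
  \<open>4 * real m1\<close> in the exponents, which absorb the prefactors of the failure bounds
  through \<open>t \<le> exp t\<close>.\<close>

lemma learner_query_bound:
  fixes \<epsilon> \<delta> Y :: real
  assumes e: "0 < \<epsilon>" "\<epsilon> \<le> 1" and d: "0 < \<delta>" "\<delta> < 1" and Y: "4 / \<epsilon>\<^sup>2 \<le> Y"
  shows "\<exists>alg F. valid_alg n alg \<and> real (num_queries alg) \<le> 42 * (2 * Y + ln (1 / \<delta>) + 1) ^ 7 \<and>
    (\<forall>c. (\<Sum>s | length s = n. (c s)\<^sup>2) = 1 \<longrightarrow>
      1 - \<delta> \<le> (\<Sum>i | i < total_dim n alg \<and> good_estimate n (1 / Y) (\<epsilon>\<^sup>2 / 4) c (F i).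
        (cmod (run_alg n alg (real_comb n c) (num_queries alg) $ i))\<^sup>2))"
proof -
  define L where "L = ln (1 / \<delta>)"
  define Z where "Z = 2 * Y + L + 1"
  have L: "0 < L" "exp (- L) = \<delta>" using d by (simp_all add: L_def ln_div)
  have "\<epsilon>\<^sup>2 \<le> 1" using e by (simp add: power_le_one)
  then have "4 \<le> 4 / \<epsilon>\<^sup>2" using e by (simp add: pos_le_divide_eq)
  then have Y4: "4 \<le> Y" using Y by linarith
  have Z1: "1 \<le> Z" "2 * Y \<le> Z" "L \<le> Z" using Y4 L by (simp_all add: Z_def)
  define a where "a = 2 * Y * (2 * Y + L)"
  have a0: "0 < a" unfolding a_def using Y4 L by (intro mult_pos_pos) linarith+
  define m1 where "m1 = nat \<lceil>a\<rceil>"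
  have m1: "a \<le> real m1" "real m1 \<le> a + 1" using a0 unfolding m1_def by linarith+
  have m1p: "0 < real m1" using m1 a0 by linarith
  then have "1 \<le> m1" by simp
  then have m1g: "1 \<le> real m1" by simp
  define b where "b = 64 * real m1 / \<epsilon>\<^sup>2 * (4 * real m1 + L)"
  have b0: "0 < b" unfolding b_def using m1p e L by (intro mult_pos_pos divide_pos_pos) auto
  define m2 where "m2 = nat \<lceil>b\<rceil>"
  have m2: "b \<le> real m2" "real m2 \<le> b + 1" using b0 unfolding m2_def by linarith+
  then have "0 < real m2" using b0 by linarith
  then have m2p: "0 < m2" by simp
  define \<eta> where "\<eta> = \<epsilon> / (2 * sqrt (real m1))"
  have \<eta>2: "\<eta>\<^sup>2 = \<epsilon>\<^sup>2 / (4 * real m1)" by (simp add: \<eta>_def power_divide power_mult_distrib)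
  have "1 \<le> sqrt (real m1)" using m1g by simp
  then have "\<epsilon> \<le> 2 * sqrt (real m1)" "0 < sqrt (real m1)" using e by linarith+
  then have \<eta>: "0 < \<eta>" "\<eta> \<le> 1" using e unfolding \<eta>_def by (auto simp: divide_le_eq)
  have le_exp: "t \<le> exp t" for t :: real using exp_ge_add_one_self[of t] by linarith
  have d1: "1 / (1 / Y) * exp (- (real m1 * (1 / Y) / 2)) \<le> \<delta> / 2"
  proof -
    have "2 * Y + L = a / (2 * Y)" using Y4 by (simp add: a_def)
    also have "\<dots> \<le> real m1 / (2 * Y)" using m1 Y4 by (intro divide_right_mono) auto
    finally have "2 * Y + L \<le> real m1 * (1 / Y) / 2" by (simp add: mult.commute)
    then have "exp (- (real m1 * (1 / Y) / 2)) \<le> exp (- (2 * Y) + - L)" by simp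
    also have "\<dots> = exp (- (2 * Y)) * \<delta>" unfolding exp_add L(2) ..
    finally have "2 * Y * exp (- (real m1 * (1 / Y) / 2)) \<le> exp (2 * Y) * (exp (- (2 * Y)) * \<delta>)"
      using le_exp[of "2 * Y"] Y4 d by (intro mult_mono) auto
    also have "\<dots> = \<delta>" by (simp add: exp_minus)
    finally show ?thesis by simp
  qed
  have d2: "real m1 * (2 * exp (- (real m2 * \<eta>\<^sup>2 / 16))) \<le> \<delta> / 2"
  proof -
    have "4 * real m1 + L = b * (\<epsilon>\<^sup>2 / (64 * real m1))" using e m1p by (simp add: b_def)
    also have "\<dots> \<le> real m2 * (\<epsilon>\<^sup>2 / (64 * real m1))" using m2 by (intro mult_right_mono) auto
    also have "\<dots> = real m2 * \<eta>\<^sup>2 / 16" unfolding \<eta>2 by simp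
    finally have "exp (- (real m2 * \<eta>\<^sup>2 / 16)) \<le> exp (- (4 * real m1) + - L)" by simp
    also have "\<dots> = exp (- (4 * real m1)) * \<delta>" unfolding exp_add L(2) ..
    finally have "4 * real m1 * exp (- (real m2 * \<eta>\<^sup>2 / 16)) \<le> exp (4 * real m1) * (exp (- (4 * real m1)) * \<delta>)"
      using le_exp[of "4 * real m1"] m1p d by (intro mult_mono) auto
    also have "\<dots> = \<delta>" by (simp add: exp_minus)
    finally show ?thesis by simp
  qed
  have v: "real m1 * \<eta>\<^sup>2 = \<epsilon>\<^sup>2 / 4" unfolding \<eta>2 using m1p by simp
  \<comment> \<open>The degree 7 is 2 for \<open>m1\<close> plus 5 for \<open>m2\<close>; 42 is 40
    plus 2, for rounding up \<open>b\<close> and for the sampling copy of each unit.\<close>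
  have "real (Suc m2 * m1) \<le> 42 * Z ^ 7"
  proof -
    have "a + 1 \<le> (2 * Y + L) * (2 * Y + L) + 1" unfolding a_def using Y4 L by (intro add_right_mono mult_right_mono) linarith+
    also have "\<dots> \<le> Z * Z" unfolding Z_def using Y4 L by (simp add: algebra_simps)
    finally have m1Z: "real m1 \<le> Z ^ 2" using m1(2) by (simp add: power2_eq_square)
    have "64 * real m1 / \<epsilon>\<^sup>2 = 16 * real m1 * (4 / \<epsilon>\<^sup>2)" by simp
    also have "\<dots> \<le> 16 * real m1 * Y" using Y m1p by (intro mult_left_mono) auto
    also have "\<dots> \<le> 16 * Z ^ 2 * (Z / 2)" using m1Z Z1 m1p Y4 by (intro mult_mono) auto
    finally have b1: "64 * real m1 / \<epsilon>\<^sup>2 \<le> 8 * Z ^ 3" by (simp add: power3_eq_cube power2_eq_square)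
    have "Z \<le> Z ^ 2" using Z1 self_le_power[of Z 2] by simp
    then have "4 * real m1 + L \<le> 5 * Z ^ 2" using m1Z Z1 by linarith
    then have "b \<le> 8 * Z ^ 3 * (5 * Z ^ 2)" unfolding b_def using b1 m1p L Z1 by (intro mult_mono) auto
    then have "b \<le> 40 * Z ^ 5" by (simp add: power_add[symmetric] mult.assoc[symmetric] mult.commute)
    moreover have "1 \<le> Z ^ 5" using Z1 by simp
    ultimately have "real (Suc m2) \<le> 42 * Z ^ 5" using m2(2) by simp
    then have "real (Suc m2) * real m1 \<le> 42 * Z ^ 5 * Z ^ 2" using m1Z m1p Z1 by (intro mult_mono) auto
    also have "\<dots> = 42 * Z ^ 7" by (simp add: power_add[symmetric])
    finally show ?thesis by (simp only: of_nat_mult)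
  qed
  note T = this
  have "\<exists>alg F. valid_alg n alg \<and> num_queries alg = Suc m2 * m1 \<and>
    (\<forall>c. (\<Sum>s | length s = n. (c s)\<^sup>2) = 1 \<longrightarrow>
      1 - \<delta> \<le> (\<Sum>i | i < total_dim n alg \<and> good_estimate n (1 / Y) (real m1 * \<eta>\<^sup>2) c (F i).
        (cmod (run_alg n alg (real_comb n c) (num_queries alg) $ i))\<^sup>2))"
    by (rule learner[OF m2p \<eta> _ d1 d2]) (use Y4 in simp)
  then obtain alg F where alg: "valid_alg n alg" "num_queries alg = Suc m2 * m1"
    "\<And>c. (\<Sum>s | length s = n. (c s)\<^sup>2) = 1 \<Longrightarrow>
      1 - \<delta> \<le> (\<Sum>i | i < total_dim n alg \<and> good_estimate n (1 / Y) (real m1 * \<eta>\<^sup>2) c (F i).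
        (cmod (run_alg n alg (real_comb n c) (num_queries alg) $ i))\<^sup>2)" by blast
  have "real (num_queries alg) \<le> 42 * (2 * Y + ln (1 / \<delta>) + 1) ^ 7"
    using T unfolding alg(2) Z_def L_def .
  then show ?thesis using alg(1,3) unfolding v by blast
qed

lemma schatten_dist_real_comb:
  "schatten_norm n 2 (real_comb n c - pauli_comb n (\<lambda>s. complex_of_real (f s))) = sqrt (\<Sum>s | length s = n. (f s - c s)\<^sup>2)"
proof -
  have "real_comb n c - pauli_comb n (\<lambda>s. complex_of_real (f s)) = real_comb n (\<lambda>s. c s - f s)"
    by (rule eq_matI) (auto simp: pauli_comb_def left_diff_distrib sum_subtractf)
  then show ?thesis by (simp only: schatten_2_real_comb power2_commute)
qed

text \<open>The announcement does not enter the run, so it can be attached afterwards; every outcome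
  counted in \<open>p\<close> then leads to a successful announcement.\<close>

lemma success_prob_announce:
  fixes c :: "pauli list \<Rightarrow> real"
  assumes v: "valid_alg n alg"
    and p: "1 - \<delta> \<le> (\<Sum>i | i < total_dim n alg \<and> Q i. (cmod (run_alg n alg (real_comb n c) (num_queries alg) $ i))\<^sup>2)"
    and Q: "\<And>i. Q i \<Longrightarrow> (\<Sum>s | length s = n. (G i s - c s)\<^sup>2) \<le> \<epsilon>\<^sup>2" and e: "0 < \<epsilon>"
  shows "1 - \<delta> \<le> success_prob n \<epsilon> (alg\<lparr>announce := \<lambda>i s. complex_of_real (G i s)\<rparr>) (real_comb n c)"
proof -
  let ?alg = "alg\<lparr>announce := \<lambda>i s. complex_of_real (G i s)\<rparr>"
  have r: "run_alg n ?alg A t = run_alg n alg A t" for A t by (rule run_alg_cong) auto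
  have td: "total_dim n ?alg = total_dim n alg" by (simp add: total_dim_def)
  have "schatten_norm n 2 (real_comb n c - pauli_comb n (\<lambda>s. complex_of_real (G i s))) \<le> \<epsilon>" if "Q i" for i
    unfolding schatten_dist_real_comb using Q[OF that] e real_sqrt_le_mono[of _ "\<epsilon>\<^sup>2"] by fastforce
  then have "(\<Sum>i | i < total_dim n alg \<and> Q i. (cmod (run_alg n alg (real_comb n c) (num_queries alg) $ i))\<^sup>2)
      \<le> (\<Sum>i | i < total_dim n alg \<and> schatten_norm n 2 (real_comb n c - real_comb n (G i)) \<le> \<epsilon>.
        (cmod (run_alg n alg (real_comb n c) (num_queries alg) $ i))\<^sup>2)"
    by (intro sum_mono2) auto
  also have "\<dots> = success_prob n \<epsilon> ?alg (real_comb n c)" unfolding success_prob_def td r by simp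
  finally have "(\<Sum>i | i < total_dim n alg \<and> Q i. (cmod (run_alg n alg (real_comb n c) (num_queries alg) $ i))\<^sup>2)
      \<le> success_prob n \<epsilon> ?alg (real_comb n c)" .
  then show ?thesis using p by linarith
qed

text \<open>Three errors of at most \<open>\<epsilon>\<^sup>2 / 4\<close> each: the sampled strings,
  the strings outside \<open>S\<close>, and the unsampled strings of \<open>S\<close>, of which
  there are at most \<open>m\<close>, each with squared coefficient below
  \<open>1 / Y\<close>.\<close>

lemma estimate_close:
  assumes g: "good_estimate n (1 / Y) (\<epsilon>\<^sup>2 / 4) c f"
    and S: "S \<subseteq> {s. length s = n}" "real (card S) \<le> m" "(\<Sum>s\<in>{s. length s = n} - S. (c s)\<^sup>2) \<le> \<epsilon>\<^sup>2 / 4"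
    and Y: "Y = 4 * m / \<epsilon>\<^sup>2" and m: "0 < m" and e: "0 < \<epsilon>"
  shows "(\<Sum>s | length s = n. (f s - c s)\<^sup>2) \<le> \<epsilon>\<^sup>2"
proof -
  let ?S = "{s :: pauli list. length s = n}"
  obtain L where L: "L \<subseteq> ?S" "\<And>s. s \<notin> L \<Longrightarrow> f s = 0" "{s. length s = n \<and> 1 / Y \<le> (c s)\<^sup>2} \<subseteq> L"
    "(\<Sum>s\<in>L. (f s - c s)\<^sup>2) \<le> \<epsilon>\<^sup>2 / 4"
    using g unfolding good_estimate_def by auto
  have fS: "finite S" using S(1) finite_subset finite_strings by blast
  have "(\<Sum>s\<in>?S. (f s - c s)\<^sup>2) = (\<Sum>s\<in>?S - L. (f s - c s)\<^sup>2) + (\<Sum>s\<in>L. (f s - c s)\<^sup>2)"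
    by (rule sum.subset_diff[OF L(1)]) simp
  also have "(\<Sum>s\<in>?S - L. (f s - c s)\<^sup>2) = (\<Sum>s\<in>?S - L. (c s)\<^sup>2)"
    by (rule sum.cong) (auto simp: L(2))
  also have "\<dots> \<le> (\<Sum>s\<in>(?S - S) \<union> (S - L). (c s)\<^sup>2)" by (rule sum_mono2) (use fS in auto)
  also have "\<dots> = (\<Sum>s\<in>?S - S. (c s)\<^sup>2) + (\<Sum>s\<in>S - L. (c s)\<^sup>2)" by (rule sum.union_disjoint) (use fS in auto)
  also have "(\<Sum>s\<in>S - L. (c s)\<^sup>2) \<le> \<epsilon>\<^sup>2 / 4"
  proof -
    have "(\<Sum>s\<in>S - L. (c s)\<^sup>2) \<le> (\<Sum>s\<in>S - L. 1 / Y)"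
    proof (rule sum_mono)
      fix s assume "s \<in> S - L"
      then have "\<not> 1 / Y \<le> (c s)\<^sup>2" using L(3) S(1) by auto
      then show "(c s)\<^sup>2 \<le> 1 / Y" by simp
    qed
    also have "\<dots> \<le> m * (1 / Y)"
    proof -
      have "real (card (S - L)) \<le> real (card S)" using fS by (simp add: card_mono)
      then have "real (card (S - L)) * (1 / Y) \<le> m * (1 / Y)" using S(2) m e Y by (intro mult_right_mono) auto
      then show ?thesis by simp
    qed
    also have "\<dots> = \<epsilon>\<^sup>2 / 4" using m e by (simp add: Y)
    finally show ?thesis .
  qed
  finally show ?thesis using L(4) S(3) zero_le_power2[of \<epsilon>] by linarith
qed

text \<open>The identity coefficient \<open>x\<close> exceeds 1/2 in modulus and its estimate is off
  by at most 1/2, so the sign is right. Announcing the sign costs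
  \<open>2 * (1 - \<bar>x\<bar>)\<close> in squared distance, at most twice the variance.\<close>

lemma constant_close:
  assumes one: "(\<Sum>s | length s = n. (c s)\<^sup>2) = 1" and V: "1 - (c (replicate n PI))\<^sup>2 \<le> \<epsilon>\<^sup>2 / 4"
    and e: "0 < \<epsilon>" "\<epsilon> < 1" and g: "good_estimate n (1 / 4) (1 / 4) c f"
  shows "(\<Sum>s | length s = n. ((if s = replicate n PI then sgn (f s) else 0) - c s)\<^sup>2) \<le> \<epsilon>\<^sup>2"
proof -
  let ?S = "{s :: pauli list. length s = n}" and ?o = "replicate n PI"
  define x where "x = c ?o"
  have "\<epsilon>\<^sup>2 < 1" using e by (simp add: power_less_one_iff)
  then have x2: "3 / 4 < x\<^sup>2" using V unfolding x_def by linarith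
  obtain L where L: "L \<subseteq> ?S" "{s. length s = n \<and> 1 / 4 \<le> (c s)\<^sup>2} \<subseteq> L" "(\<Sum>s\<in>L. (f s - c s)\<^sup>2) \<le> 1 / 4"
    using g unfolding good_estimate_def by auto
  have oL: "?o \<in> L" using L(2) x2 by (auto simp: x_def)
  have "finite L" using L(1) finite_subset finite_strings by blast
  then have "(f ?o - c ?o)\<^sup>2 \<le> (\<Sum>s\<in>L. (f s - c s)\<^sup>2)" using oL by (intro member_le_sum) auto
  then have "(f ?o - x)\<^sup>2 \<le> (1 / 2)\<^sup>2" using L(3) by (simp add: x_def power2_eq_square)
  then have fx: "\<bar>f ?o - x\<bar> \<le> 1 / 2" using power2_le_iff_abs_le[of "1 / 2" "f ?o - x"] by simp
  have "(1 / 2)\<^sup>2 < \<bar>x\<bar>\<^sup>2" using x2 by (simp add: power2_eq_square)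
  then have "1 / 2 < \<bar>x\<bar>" by (rule power_less_imp_less_base) simp
  then have sg: "sgn (f ?o) = sgn x"
  proof (cases "0 < x")
    case True
    then have "0 < f ?o" using fx \<open>1 / 2 < \<bar>x\<bar>\<close> by linarith
    then show ?thesis using True by simp
  next
    case False
    then have "f ?o < 0" "x < 0" using fx \<open>1 / 2 < \<bar>x\<bar>\<close> by linarith+
    then show ?thesis by simp
  qed
  have "x \<noteq> 0" using x2 by auto
  have sx: "(sgn x - x)\<^sup>2 = (1 - \<bar>x\<bar>)\<^sup>2"
    using \<open>x \<noteq> 0\<close> by (cases "0 < x") (auto simp: sgn_if power2_eq_square algebra_simps)
  have rest: "(\<Sum>s\<in>?S - {?o}. (c s)\<^sup>2) = 1 - x\<^sup>2" unfolding one[symmetric] x_def by (simp add: sum_diff1)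
  have x1: "\<bar>x\<bar> \<le> 1"
  proof -
    have "0 \<le> (\<Sum>s\<in>?S - {?o}. (c s)\<^sup>2)" by (rule sum_nonneg) simp
    then have "\<bar>x\<bar>\<^sup>2 \<le> 1\<^sup>2" unfolding rest by simp
    then show ?thesis by (rule power2_le_imp_le) simp
  qed
  have "(\<Sum>s\<in>?S. ((if s = ?o then sgn (f s) else 0) - c s)\<^sup>2)
      = (sgn (f ?o) - c ?o)\<^sup>2 + (\<Sum>s\<in>?S - {?o}. ((if s = ?o then sgn (f s) else 0) - c s)\<^sup>2)"
    by (subst sum.remove[of _ ?o]) auto
  also have "(\<Sum>s\<in>?S - {?o}. ((if s = ?o then sgn (f s) else 0) - c s)\<^sup>2) = 1 - x\<^sup>2"
    unfolding rest[symmetric] by (rule sum.cong) auto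
  also have "(sgn (f ?o) - c ?o)\<^sup>2 = (1 - \<bar>x\<bar>)\<^sup>2" unfolding sg x_def[symmetric] by (rule sx)
  also have "(1 - \<bar>x\<bar>)\<^sup>2 + (1 - x\<^sup>2) = 2 * (1 - \<bar>x\<bar>)" by (simp add: power2_eq_square algebra_simps)
  also have "\<dots> \<le> 2 * (1 - x\<^sup>2)"
  proof -
    have "\<bar>x\<bar> * \<bar>x\<bar> \<le> 1 * \<bar>x\<bar>" using x1 by (intro mult_right_mono) auto
    then show ?thesis by (simp add: power2_eq_square)
  qed
  also have "\<dots> \<le> 2 * (\<epsilon>\<^sup>2 / 4)" using V unfolding x_def[symmetric] by (rule mult_left_mono) simp
  also have "\<dots> \<le> \<epsilon>\<^sup>2" by simp
  finally show ?thesis .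
qed

lemma k_bound_nonneg:
  assumes "quantum_boolean n A" shows "0 \<le> k_bound n \<epsilon> A"
proof -
  have "0 \<le> influence n 2 A" unfolding influence_def by (intro sum_nonneg) simp
  then show ?thesis by (simp add: k_bound_def Let_def)
qed

lemma four_powr_le: "r \<le> real k \<Longrightarrow> 4 powr r \<le> 4 ^ k"
  using powr_mono[of r "real k" 4] by (simp add: powr_realpow)

theorem proposition6p8:
  shows "\<exists>P :: real poly poly poly.
    \<forall>(n::nat) (\<epsilon>::real) (\<delta>::real). 1 \<le> n \<and> 0 < \<epsilon> \<and> 0 < \<delta> \<and> \<delta> < 1 \<longrightarrow>
      (\<exists>alg :: nat \<Rightarrow> query_alg.
        (\<forall>k. valid_alg n (alg k) \<and>
             real (num_queries (alg k)) \<le> poly3 P (real n) (4 ^ k) (ln (1 / \<delta>))) \<and>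
        (\<forall>A. quantum_boolean n A \<longrightarrow>
             (\<exists>k. real k \<le> k_bound n \<epsilon> A \<and>
                  (\<forall>k' \<ge> k. success_prob n \<epsilon> (alg k') A \<ge> 1 - \<delta>))))"
proof -
  \<comment> \<open>Integer versions of the constants of \<open>spectral_concentration\<close>:
    \<open>C1\<close> for the size of the concentration set, \<open>C2\<close> for the logarithm of
    the precision.\<close>
  define C1 where "C1 = nat \<lceil>64 * exp 22 :: real\<rceil>"
  define C2 where "C2 = nat \<lceil>64 * exp 58 :: real\<rceil>"
  have C1: "64 * exp 22 \<le> real C1" and C2: "64 * exp 58 \<le> real C2" unfolding C1_def C2_def by linarith+
  \<comment> \<open>The parameter \<open>Y = 4 * m / \<epsilon>\<^sup>2\<close> gets
    \<open>C1\<close> from \<open>m\<close> and twice \<open>C2\<close> from the inverse square of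
    the precision. In \<open>C\<close>, 9 is \<open>8 + 1\<close> from \<open>8 * B + l + 1\<close>,
    and \<open>4 ^ (7 * a)\<close> pays for \<open>Suc k\<close> in place of
    \<open>k\<close>.\<close>
  define a where "a = C1 + 2 * C2"
  define C where "C = (42 * 9 ^ 7 * 4 ^ (7 * a) :: real)"
  \<comment> \<open>Constant in the number of qubits, of degree \<open>7 * a\<close> in
    \<open>4 ^ k\<close> and of degree 7 in the logarithm.\<close>
  define P :: "real poly poly poly" where "P = [: monom (smult C ([:1, 1:] ^ 7)) (7 * a) :]"
  have P: "poly3 P x y z = C * (1 + z) ^ 7 * y ^ (7 * a)" for x y z
    by (simp add: poly3_def P_def poly_monom poly_const_pow poly_power mult.commute)
  have bound: "42 * (2 * Y + l + 1) ^ 7 \<le> C * (1 + l) ^ 7 * (4 ^ k) ^ (7 * a)"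
    if Y: "0 \<le> Y" "Y \<le> 4 * 4 ^ (a * Suc k)" and l: "0 \<le> l" for Y l :: real and k
  proof -
    define B where "B = (4 :: real) ^ (a * Suc k)"
    have B1: "1 \<le> B" unfolding B_def by (rule one_le_power) simp
    have "2 * Y + l + 1 \<le> 8 * B + l + 1" using Y by (simp add: B_def)
    also have "\<dots> \<le> 9 * B * (1 + l)"
    proof -
      have "1 * l \<le> 9 * B * l" using B1 l by (intro mult_right_mono) auto
      then show ?thesis using B1 by (simp add: algebra_simps)
    qed
    finally have "(2 * Y + l + 1) ^ 7 \<le> (9 * B * (1 + l)) ^ 7" using Y l by (intro power_mono) auto
    then have "42 * (2 * Y + l + 1) ^ 7 \<le> 42 * (9 * B * (1 + l)) ^ 7" by simp
    also have "\<dots> = 42 * 9 ^ 7 * B ^ 7 * (1 + l) ^ 7" by (simp add: power_mult_distrib)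
    also have "B ^ 7 = 4 ^ (7 * a) * (4 ^ k) ^ (7 * a)"
      unfolding B_def by (simp add: power_mult[symmetric] power_add[symmetric] algebra_simps)
    finally show ?thesis by (simp add: C_def mult_ac)
  qed
  show ?thesis
  proof (intro exI[of _ P] allI impI)
    fix n :: nat and \<epsilon> \<delta> :: real
    assume "1 \<le> n \<and> 0 < \<epsilon> \<and> 0 < \<delta> \<and> \<delta> < 1"
    then have e: "0 < \<epsilon>" and d: "0 < \<delta>" "\<delta> < 1" by auto
    let ?o = "replicate n PI" and ?S = "{s :: pauli list. length s = n}"
    have l0: "0 \<le> ln (1 / \<delta>)" using d by simp
    \<comment> \<open>The algorithm of index \<open>k\<close> must handle every operator whose
      \<open>k_bound\<close> is below \<open>k + 1\<close>; it then covers \<open>A\<close> as soon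
      as \<open>k\<close> is at least the integer part of the \<open>k_bound\<close> of
      \<open>A\<close>.\<close>
    define good where "good = (\<lambda>alg k. valid_alg n alg \<and>
      real (num_queries alg) \<le> poly3 P (real n) (4 ^ k) (ln (1 / \<delta>)) \<and>
      (\<forall>A. quantum_boolean n A \<and> k_bound n \<epsilon> A < real (Suc k) \<longrightarrow> 1 - \<delta> \<le> success_prob n \<epsilon> alg A))"
    have "\<exists>alg. good alg k" for k
    proof -
      have b4: "42 * (2 * 4 + ln (1 / \<delta>) + 1) ^ 7 \<le> poly3 P (real n) (4 ^ k) (ln (1 / \<delta>))"
        unfolding P
      proof (rule bound[OF _ _ l0])
        have "(1 :: real) \<le> 4 ^ (a * Suc k)" by (rule one_le_power) simp
        then show "(4 :: real) \<le> 4 * 4 ^ (a * Suc k)" by linarith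
      qed simp
      consider (trivial) "1 \<le> \<epsilon>" | (fine) "\<epsilon> < 1" "real C2 * real (Suc k) < ln (1 / \<epsilon>)"
        | (coarse) "\<epsilon> < 1" "ln (1 / \<epsilon>) \<le> real C2 * real (Suc k)" by linarith
      then show ?thesis
      proof cases
        \<comment> \<open>The zero operator is at distance 1, so any run will do; the learner with
          precision 1 supplies a valid one.\<close>
        case trivial
        obtain alg F where alg: "valid_alg n alg" "real (num_queries alg) \<le> 42 * (2 * 4 + ln (1 / \<delta>) + 1) ^ 7"
          "\<And>c. (\<Sum>s\<in>?S. (c s)\<^sup>2) = 1 \<Longrightarrow>
            1 - \<delta> \<le> (\<Sum>i | i < total_dim n alg \<and> good_estimate n (1 / 4) (1\<^sup>2 / 4) c (F i).
              (cmod (run_alg n alg (real_comb n c) (num_queries alg) $ i))\<^sup>2)"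
          using learner_query_bound[of 1 \<delta> 4 n] d by auto
        let ?alg = "alg\<lparr>announce := \<lambda>i s. complex_of_real ((\<lambda>i s. 0) i s)\<rparr>"
        have "1 - \<delta> \<le> success_prob n \<epsilon> ?alg A" if A: "quantum_boolean n A" for A
        proof -
          obtain c where c: "A = real_comb n c" "(\<Sum>s\<in>?S. (c s)\<^sup>2) = 1" by (rule quantum_boolean_expansion[OF A])
          have "1 \<le> \<epsilon>\<^sup>2" using trivial by simp
          then show ?thesis unfolding c(1)
            by (intro success_prob_announce[OF alg(1) alg(3)[OF c(2)]]) (use c(2) e in auto)
        qed
        moreover have "valid_alg n ?alg" using alg(1) by (simp add: valid_alg_def total_dim_def)
        ultimately show ?thesis unfolding good_def using alg(2) b4 by (intro exI[of _ ?alg]) auto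
      next
        \<comment> \<open>By the contrapositive of the bound on \<open>ln (1 / \<epsilon>)\<close>,
          every \<open>A\<close> within the scope of \<open>k\<close> is almost constant, and an
          estimate of fixed precision determines its sign.\<close>
        case fine
        obtain alg F where alg: "valid_alg n alg" "real (num_queries alg) \<le> 42 * (2 * 4 + ln (1 / \<delta>) + 1) ^ 7"
          "\<And>c. (\<Sum>s\<in>?S. (c s)\<^sup>2) = 1 \<Longrightarrow>
            1 - \<delta> \<le> (\<Sum>i | i < total_dim n alg \<and> good_estimate n (1 / 4) (1\<^sup>2 / 4) c (F i).
              (cmod (run_alg n alg (real_comb n c) (num_queries alg) $ i))\<^sup>2)"
          using learner_query_bound[of 1 \<delta> 4 n] d by auto
        let ?alg = "alg\<lparr>announce := \<lambda>i s. complex_of_real ((\<lambda>i s. if s = ?o then sgn (F i s) else 0) i s)\<rparr>"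
        have "1 - \<delta> \<le> success_prob n \<epsilon> ?alg A" if A: "quantum_boolean n A" "k_bound n \<epsilon> A < real (Suc k)" for A
        proof -
          obtain c where c: "A = real_comb n c" "(\<Sum>s\<in>?S. (c s)\<^sup>2) = 1" by (rule quantum_boolean_expansion[OF A(1)])
          have V: "1 - (c ?o)\<^sup>2 \<le> \<epsilon>\<^sup>2 / 4"
          proof (rule ccontr)
            assume "\<not> 1 - (c ?o)\<^sup>2 \<le> \<epsilon>\<^sup>2 / 4"
            then have "ln (1 / \<epsilon>) \<le> 64 * exp 58 * k_bound n \<epsilon> A"
              using spectral_concentration(2)[OF A(1)[unfolded c(1)] c(2) e fine(1)] unfolding c(1) by simp
            also have "\<dots> \<le> real C2 * real (Suc k)" using A C2 k_bound_nonneg[OF A(1)] by (intro mult_mono) auto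
            finally show False using fine(2) by simp
          qed
          have Q: "(\<Sum>s\<in>?S. ((if s = ?o then sgn (F i s) else 0) - c s)\<^sup>2) \<le> \<epsilon>\<^sup>2"
            if "good_estimate n (1 / 4) (1\<^sup>2 / 4) c (F i)" for i
            by (rule constant_close[OF c(2) V e fine(1)]) (use that in simp)
          show ?thesis unfolding c(1) by (rule success_prob_announce[OF alg(1) alg(3)[OF c(2)] Q e])
        qed
        moreover have "valid_alg n ?alg" using alg(1) by (simp add: valid_alg_def total_dim_def)
        ultimately show ?thesis unfolding good_def using alg(2) b4 by (intro exI[of _ ?alg]) auto
      next
        \<comment> \<open>Here \<open>1 / \<epsilon>\<close> is at most
          \<open>4 ^ (C2 * Suc k)\<close>, so the dependence of the learner on the precision fits
          the budget.\<close>
        case coarse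
        define m where "m = (4 :: real) ^ (C1 * Suc k)"
        have m1: "1 \<le> m" unfolding m_def by (rule one_le_power) simp
        define Y where "Y = 4 * m / \<epsilon>\<^sup>2"
        have "1 / \<epsilon> = exp (ln (1 / \<epsilon>))" using e by simp
        also have "\<dots> \<le> exp (real (C2 * Suc k))" using coarse(2) by (simp only: exp_le_cancel_iff of_nat_mult)
        also have "\<dots> = exp 1 ^ (C2 * Suc k)" by (simp add: exp_of_nat_mult[symmetric])
        also have "\<dots> \<le> 4 ^ (C2 * Suc k)" using exp_1_le_3 by (intro power_mono) auto
        finally have "(1 / \<epsilon>)\<^sup>2 \<le> (4 ^ (C2 * Suc k))\<^sup>2" using e by (intro power_mono) auto
        then have "m * (1 / \<epsilon>)\<^sup>2 \<le> m * (4 ^ (C2 * Suc k))\<^sup>2" using m1 by (intro mult_left_mono) auto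
        also have "\<dots> = 4 ^ (a * Suc k)"
          unfolding m_def a_def by (simp add: power_mult[symmetric] power_add[symmetric] algebra_simps)
        finally have Yb: "Y \<le> 4 * 4 ^ (a * Suc k)" by (simp add: Y_def power_divide)
        have Y0: "0 \<le> Y" using m1 e by (simp add: Y_def)
        have "4 / \<epsilon>\<^sup>2 \<le> Y" unfolding Y_def using m1 e by (intro divide_right_mono) auto
        then obtain alg F where alg: "valid_alg n alg" "real (num_queries alg) \<le> 42 * (2 * Y + ln (1 / \<delta>) + 1) ^ 7"
          "\<And>c. (\<Sum>s\<in>?S. (c s)\<^sup>2) = 1 \<Longrightarrow>
            1 - \<delta> \<le> (\<Sum>i | i < total_dim n alg \<and> good_estimate n (1 / Y) (\<epsilon>\<^sup>2 / 4) c (F i).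
              (cmod (run_alg n alg (real_comb n c) (num_queries alg) $ i))\<^sup>2)"
          using learner_query_bound[of \<epsilon> \<delta> Y n] d e coarse(1) by auto
        let ?alg = "alg\<lparr>announce := \<lambda>i s. complex_of_real (F i s)\<rparr>"
        have "1 - \<delta> \<le> success_prob n \<epsilon> ?alg A" if A: "quantum_boolean n A" "k_bound n \<epsilon> A < real (Suc k)" for A
        proof -
          obtain c where c: "A = real_comb n c" "(\<Sum>s\<in>?S. (c s)\<^sup>2) = 1" by (rule quantum_boolean_expansion[OF A(1)])
          have "\<exists>S\<subseteq>?S. real (card S) \<le> m \<and> (\<Sum>s\<in>?S - S. (c s)\<^sup>2) \<le> \<epsilon>\<^sup>2 / 4"
          proof (cases "1 - (c ?o)\<^sup>2 \<le> \<epsilon>\<^sup>2 / 4")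
            \<comment> \<open>For an almost constant \<open>A\<close> the identity string alone is a
              concentration set.\<close>
            case True
            then show ?thesis using c(2) m1 by (intro exI[of _ "{?o}"]) (simp add: sum_diff1)
          next
            case False
            then obtain S where S: "S \<subseteq> ?S" "real (card S) \<le> 4 powr (64 * exp 22 * k_bound n \<epsilon> A)"
              "(\<Sum>s\<in>?S - S. (c s)\<^sup>2) \<le> \<epsilon>\<^sup>2 / 4"
              using spectral_concentration(1)[OF A(1)[unfolded c(1)] c(2) e coarse(1)] unfolding c(1) by auto
            have "64 * exp 22 * k_bound n \<epsilon> A \<le> real C1 * real (Suc k)"
              using A C1 k_bound_nonneg[OF A(1)] by (intro mult_mono) auto
            then have "4 powr (64 * exp 22 * k_bound n \<epsilon> A) \<le> m"
              unfolding m_def by (intro four_powr_le) (simp only: of_nat_mult)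
            then show ?thesis using S by (intro exI[of _ S]) auto
          qed
          then obtain S where S: "S \<subseteq> ?S" "real (card S) \<le> m" "(\<Sum>s\<in>?S - S. (c s)\<^sup>2) \<le> \<epsilon>\<^sup>2 / 4" by blast
          have Q: "(\<Sum>s\<in>?S. (F i s - c s)\<^sup>2) \<le> \<epsilon>\<^sup>2" if "good_estimate n (1 / Y) (\<epsilon>\<^sup>2 / 4) c (F i)" for i
            by (rule estimate_close[OF that S Y_def _ e]) (use m1 in simp)
          show ?thesis unfolding c(1) by (rule success_prob_announce[OF alg(1) alg(3)[OF c(2)] Q e])
        qed
        moreover have "valid_alg n ?alg" using alg(1) by (simp add: valid_alg_def total_dim_def)
        moreover have "42 * (2 * Y + ln (1 / \<delta>) + 1) ^ 7 \<le> poly3 P (real n) (4 ^ k) (ln (1 / \<delta>))"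
          unfolding P by (rule bound[OF Y0 Yb l0])
        ultimately show ?thesis unfolding good_def using alg(2) by (intro exI[of _ ?alg]) auto
      qed
    qed
    then obtain alg where alg: "\<And>k. good (alg k) k" by metis
    show "\<exists>alg :: nat \<Rightarrow> query_alg.
        (\<forall>k. valid_alg n (alg k) \<and>
             real (num_queries (alg k)) \<le> poly3 P (real n) (4 ^ k) (ln (1 / \<delta>))) \<and>
        (\<forall>A. quantum_boolean n A \<longrightarrow>
             (\<exists>k. real k \<le> k_bound n \<epsilon> A \<and>
                  (\<forall>k' \<ge> k. success_prob n \<epsilon> (alg k') A \<ge> 1 - \<delta>)))"
    proof (intro exI[of _ alg] conjI allI impI)
      fix k
      show "valid_alg n (alg k)" "real (num_queries (alg k)) \<le> poly3 P (real n) (4 ^ k) (ln (1 / \<delta>))"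
        using alg[of k] by (auto simp: good_def)
    next
      fix A assume A: "quantum_boolean n A"
      define k where "k = nat \<lfloor>k_bound n \<epsilon> A\<rfloor>"
      have k: "real k \<le> k_bound n \<epsilon> A" "k_bound n \<epsilon> A < real (Suc k)"
        using k_bound_nonneg[OF A, of \<epsilon>] unfolding k_def by linarith+
      show "\<exists>k. real k \<le> k_bound n \<epsilon> A \<and> (\<forall>k' \<ge> k. success_prob n \<epsilon> (alg k') A \<ge> 1 - \<delta>)"
      proof (intro exI[of _ k] conjI allI impI k(1))
        fix k' assume "k \<le> k'"
        then have "k_bound n \<epsilon> A < real (Suc k')" using k(2) by simp
        then show "1 - \<delta> \<le> success_prob n \<epsilon> (alg k') A" using alg[of k'] A by (simp add: good_def)
      qed
    qed
  qed
qed

end
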